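(* Let $K$ be any field. Let $E$ be any finite graph, and let $Q$ be a nonzero finitely generated projective left $L_K(E)$-module. Then $\mathrm{End}_{L_K(E)}(Q)$ is isomorphic to a Leavitt path algebra; that is, there is a finite graph $G$ with $\mathrm{End}_{L_K(E)}(Q)\cong L_K(G)$ as $K$-algebras.
   Context: A (directed) graph $E=(E^0,E^1,s,r)$ consists of disjoint sets $E^0$ (vertices) and $E^1$ (edges) and maps $s,r:E^1\to E^0$. It is finite if $E^0$ and $E^1$ are finite; the vertex set is nonempty. A vertex $v$ is a sink if $s^{-1}(v)=\emptyset$; in a finite graph, a vertex is regular if it is not a sink. The Leavitt path algebra $L_K(E)$ is the $K$-algebra generated by $E^0\cup E^1\cup\{e^*\mid e\in E^1\}$ subject to, for all $v,w\in E^0$ and $e,f\in E^1$: (1) $vw=\delta_{v,w}w$; (2) $s(e)e=e=er(e)$ and $r(e)e^*=e^*=e^*s(e)$; (3) $e^*f=\delta_{e,f}r(e)$; (4) $v=\sum_{e\in s^{-1}(v)}ee^*$ for every regular vertex $v$. For finite $E$ it is unital with identity $\sum_{v\in E^0}v$. Endomorphisms of a left $R$-module $M$ are written on the right of their arguments: for $f,g\in\mathrm{End}_R(M)$, the product $fg$ means "first $f$, then $g$" (so $\mathrm{End}_R(Re)\cong eRe$ for an idempotent $e$). *)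

theory Defs
  imports "HOL-Algebra.QuotRing" "HOL-Algebra.Module" "Graph_Theory.Digraph"
begin

section \<open>Free algebras\<close>

text \<open>
  The free unital associative \<open>K\<close>-algebra on a set \<open>X\<close>: finitely supported \<open>K\<close>-valued functions
  on the words over \<open>X\<close>, with the concatenation product.  Like all \<open>K\<close>-algebras below it is a
  \<^type>\<open>module\<close> record, which has the ring operations and the scalar multiplication.  (The library
  locales \<^locale>\<open>module\<close> and \<^locale>\<open>algebra\<close> cover commutative rings only.)
\<close>

definition free_algebra :: "('k, 'c) ring_scheme \<Rightarrow> 'x set \<Rightarrow> ('k, 'x list \<Rightarrow> 'k) module"
  where "free_algebra K X =
    \<lparr>carrier = {f. range f \<subseteq> carrier K \<and> finite {w. f w \<noteq> \<zero>\<^bsub>K\<^esub>} \<and>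
       (\<forall>w. f w \<noteq> \<zero>\<^bsub>K\<^esub> \<longrightarrow> set w \<subseteq> X)},
     mult = (\<lambda>f g w. \<Oplus>\<^bsub>K\<^esub>i\<in>{..length w}. f (take i w) \<otimes>\<^bsub>K\<^esub> g (drop i w)),
     one = (\<lambda>w. if w = [] then \<one>\<^bsub>K\<^esub> else \<zero>\<^bsub>K\<^esub>),
     zero = (\<lambda>w. \<zero>\<^bsub>K\<^esub>),
     add = (\<lambda>f g w. f w \<oplus>\<^bsub>K\<^esub> g w),
     smult = (\<lambda>a f w. a \<otimes>\<^bsub>K\<^esub> f w)\<rparr>"

definition word :: "('k, 'c) ring_scheme \<Rightarrow> 'x list \<Rightarrow> ('x list \<Rightarrow> 'k)"
  where "word K u = (\<lambda>w. if w = u then \<one>\<^bsub>K\<^esub> else \<zero>\<^bsub>K\<^esub>)"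


section \<open>Leavitt path algebras\<close>

text \<open>
  A directed graph \<open>(E\<^sup>0, E\<^sup>1, s, r)\<close> is a \<^type>\<open>pre_digraph\<close>: \<open>s\<close> is \<^const>\<open>tail\<close>, \<open>r\<close> is
  \<^const>\<open>head\<close>, and \<open>s\<^sup>-\<^sup>1(v)\<close> is \<open>out_arcs E v\<close>.  \<^locale>\<open>fin_digraph\<close> allows loops, parallel arcs and
  the null graph.
\<close>

definition finite_graph :: "('v, 'e) pre_digraph \<Rightarrow> bool"
  where "finite_graph E \<longleftrightarrow> fin_digraph E \<and> verts E \<noteq> {}"

datatype ('v, 'e) generator = Vertex 'v | Edge 'e | Ghost 'e

definition generators :: "('v, 'e) pre_digraph \<Rightarrow> ('v, 'e) generator set"
  where "generators E = Vertex ` verts E \<union> Edge ` arcs E \<union> Ghost ` arcs E"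

abbreviation path_free_algebra ::
  "('k, 'c) ring_scheme \<Rightarrow> ('v, 'e) pre_digraph \<Rightarrow> ('k, ('v, 'e) generator list \<Rightarrow> 'k) module"
  where "path_free_algebra K E \<equiv> free_algebra K (generators E)"

text \<open>Each relation \<open>a = b\<close> is represented by the element \<open>a - b\<close> of the free algebra.\<close>

definition leavitt_relations ::
  "('k, 'c) ring_scheme \<Rightarrow> ('v, 'e) pre_digraph \<Rightarrow> (('v, 'e) generator list \<Rightarrow> 'k) set"
  where "leavitt_relations K E = (let F = path_free_algebra K E in
      {word K [Vertex v, Vertex w] \<ominus>\<^bsub>F\<^esub> (if v = w then word K [Vertex w] else \<zero>\<^bsub>F\<^esub>) | v w.
        v \<in> verts E \<and> w \<in> verts E}
    \<union> {word K [Vertex (tail E e), Edge e] \<ominus>\<^bsub>F\<^esub> word K [Edge e] | e. e \<in> arcs E}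
    \<union> {word K [Edge e, Vertex (head E e)] \<ominus>\<^bsub>F\<^esub> word K [Edge e] | e. e \<in> arcs E}
    \<union> {word K [Vertex (head E e), Ghost e] \<ominus>\<^bsub>F\<^esub> word K [Ghost e] | e. e \<in> arcs E}
    \<union> {word K [Ghost e, Vertex (tail E e)] \<ominus>\<^bsub>F\<^esub> word K [Ghost e] | e. e \<in> arcs E}
    \<union> {word K [Ghost e, Edge f] \<ominus>\<^bsub>F\<^esub> (if e = f then word K [Vertex (head E e)] else \<zero>\<^bsub>F\<^esub>) | e f.
        e \<in> arcs E \<and> f \<in> arcs E}
    \<union> {word K [Vertex v] \<ominus>\<^bsub>F\<^esub> (\<Oplus>\<^bsub>F\<^esub>e\<in>out_arcs E v. word K [Edge e, Ghost e]) | v.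
        v \<in> verts E \<and> out_arcs E v \<noteq> {}})"

definition leavitt_ideal ::
  "('k, 'c) ring_scheme \<Rightarrow> ('v, 'e) pre_digraph \<Rightarrow> (('v, 'e) generator list \<Rightarrow> 'k) set"
  where "leavitt_ideal K E = genideal (path_free_algebra K E) (leavitt_relations K E)"

text \<open>
  The presentation is one of algebras without a prescribed identity.  The free such algebra is the
  augmentation ideal (no term in the empty word) of the free unital algebra, and its two-sided ideal
  generated by the relations is the same as the one generated in the free unital algebra.  So
  \<open>L\<^sub>K(E)\<close> consists of the cosets of the elements without constant term; the coset of
  \<open>\<Sum>v\<in>E\<^sup>0. v\<close> is its identity.
\<close>

definition leavitt_path_algebra ::
  "('k, 'c) ring_scheme \<Rightarrow> ('v, 'e) pre_digraph \<Rightarrow> ('k, (('v, 'e) generator list \<Rightarrow> 'k) set) module"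
  where "leavitt_path_algebra K E = (let F = path_free_algebra K E; I = leavitt_ideal K E in
    \<lparr>carrier = {I +>\<^bsub>F\<^esub> x | x. x \<in> carrier F \<and> x [] = \<zero>\<^bsub>K\<^esub>},
     mult = rcoset_mult F I,
     one = I +>\<^bsub>F\<^esub> (\<Oplus>\<^bsub>F\<^esub>v\<in>verts E. word K [Vertex v]),
     zero = I,
     add = set_add F,
     smult = (\<lambda>a A. \<Union>x\<in>A. I +>\<^bsub>F\<^esub> (a \<odot>\<^bsub>F\<^esub> x))\<rparr>)"


section \<open>Left modules over a not necessarily commutative ring\<close>

locale left_module = R?: ring + M?: abelian_group M for M (structure) +
  assumes smult_closed [simp, intro]:
      "\<lbrakk>a \<in> carrier R; x \<in> carrier M\<rbrakk> \<Longrightarrow> a \<odot>\<^bsub>M\<^esub> x \<in> carrier M"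
    and smult_l_distr:
      "\<lbrakk>a \<in> carrier R; b \<in> carrier R; x \<in> carrier M\<rbrakk>
        \<Longrightarrow> (a \<oplus> b) \<odot>\<^bsub>M\<^esub> x = a \<odot>\<^bsub>M\<^esub> x \<oplus>\<^bsub>M\<^esub> b \<odot>\<^bsub>M\<^esub> x"
    and smult_r_distr:
      "\<lbrakk>a \<in> carrier R; x \<in> carrier M; y \<in> carrier M\<rbrakk>
        \<Longrightarrow> a \<odot>\<^bsub>M\<^esub> (x \<oplus>\<^bsub>M\<^esub> y) = a \<odot>\<^bsub>M\<^esub> x \<oplus>\<^bsub>M\<^esub> a \<odot>\<^bsub>M\<^esub> y"
    and smult_assoc1:
      "\<lbrakk>a \<in> carrier R; b \<in> carrier R; x \<in> carrier M\<rbrakk>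
        \<Longrightarrow> (a \<otimes> b) \<odot>\<^bsub>M\<^esub> x = a \<odot>\<^bsub>M\<^esub> (b \<odot>\<^bsub>M\<^esub> x)"
    and smult_one [simp]: "x \<in> carrier M \<Longrightarrow> \<one> \<odot>\<^bsub>M\<^esub> x = x"

definition left_module_hom ::
  "('r, 'c) ring_scheme \<Rightarrow> ('r, 'm, 'd) module_scheme \<Rightarrow> ('r, 'n, 'f) module_scheme \<Rightarrow> ('m \<Rightarrow> 'n) set"
  where "left_module_hom R M N = {h. h ` carrier M \<subseteq> carrier N \<and>
    (\<forall>x\<in>carrier M. \<forall>y\<in>carrier M. h (x \<oplus>\<^bsub>M\<^esub> y) = h x \<oplus>\<^bsub>N\<^esub> h y) \<and>
    (\<forall>a\<in>carrier R. \<forall>x\<in>carrier M. h (a \<odot>\<^bsub>M\<^esub> x) = a \<odot>\<^bsub>N\<^esub> h x)}"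

definition finitely_generated :: "('r, 'c) ring_scheme \<Rightarrow> ('r, 'm, 'd) module_scheme \<Rightarrow> bool"
  where "finitely_generated R M \<longleftrightarrow>
    (\<exists>S. finite S \<and> S \<subseteq> carrier M \<and> \<Inter>{N. submodule N R M \<and> S \<subseteq> N} = carrier M)"

text \<open>The free left module \<open>R\<^sup>(\<^sup>I\<^sup>)\<close>.  The ring fields of the record are irrelevant.\<close>

definition free_left_module :: "('r, 'c) ring_scheme \<Rightarrow> 'i set \<Rightarrow> ('r, 'i \<Rightarrow> 'r) module"
  where "free_left_module R I =
    \<lparr>carrier = {f. range f \<subseteq> carrier R \<and> finite {i. f i \<noteq> \<zero>\<^bsub>R\<^esub>} \<and> {i. f i \<noteq> \<zero>\<^bsub>R\<^esub>} \<subseteq> I},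
     mult = undefined,
     one = undefined,
     zero = (\<lambda>i. \<zero>\<^bsub>R\<^esub>),
     add = (\<lambda>f g i. f i \<oplus>\<^bsub>R\<^esub> g i),
     smult = (\<lambda>a f i. a \<otimes>\<^bsub>R\<^esub> f i)\<rparr>"

text \<open>
  A module is projective if it is isomorphic to a direct summand of a free module.  Index sets of
  the type of the elements of \<open>M\<close> suffice: a direct summand \<open>M\<close> of any free module is a quotient of
  \<open>R\<^sup>(\<^sup>I\<^sup>)\<close> with \<open>I\<close> the carrier of \<open>M\<close>, and this quotient map splits.
\<close>

definition projective :: "('r, 'c) ring_scheme \<Rightarrow> ('r, 'm, 'd) module_scheme \<Rightarrow> bool"
  where "projective R M \<longleftrightarrow>
    (\<exists>(I :: 'm set) A B. let F = free_left_module R I in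
      submodule A R F \<and> submodule B R F \<and> A <+>\<^bsub>F\<^esub> B = carrier F \<and> A \<inter> B = {\<zero>\<^bsub>F\<^esub>} \<and>
      (\<exists>h \<in> left_module_hom R M (F\<lparr>carrier := A\<rparr>). bij_betw h (carrier M) A))"

text \<open>
  The endomorphism algebra of a left module over a \<open>K\<close>-algebra \<open>R\<close>.  Endomorphisms are written on the
  right, so the product of \<open>f\<close> and \<open>g\<close> is ``first \<open>f\<close>, then \<open>g\<close>''; \<open>K\<close> acts on the module through
  \<open>a \<mapsto> a 1\<^sub>R\<close>.
\<close>

definition End_algebra :: "('k, 'r, 'c) module_scheme \<Rightarrow> ('r, 'm, 'd) module_scheme \<Rightarrow> ('k, 'm \<Rightarrow> 'm) module"
  where "End_algebra R M =
    \<lparr>carrier = left_module_hom R M M \<inter> extensional (carrier M),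
     mult = (\<lambda>f g. compose (carrier M) g f),
     one = (\<lambda>x\<in>carrier M. x),
     zero = (\<lambda>x\<in>carrier M. \<zero>\<^bsub>M\<^esub>),
     add = (\<lambda>f g. \<lambda>x\<in>carrier M. f x \<oplus>\<^bsub>M\<^esub> g x),
     smult = (\<lambda>a f. \<lambda>x\<in>carrier M. (a \<odot>\<^bsub>R\<^esub> \<one>\<^bsub>R\<^esub>) \<odot>\<^bsub>M\<^esub> f x)\<rparr>"

definition algebra_isomorphic ::
  "('k, 'c) ring_scheme \<Rightarrow> ('k, 'a, 'd) module_scheme \<Rightarrow> ('k, 'b, 'f) module_scheme \<Rightarrow> bool"
  where "algebra_isomorphic K A B \<longleftrightarrow>
    (\<exists>h \<in> ring_iso A B. \<forall>a\<in>carrier K. \<forall>x\<in>carrier A. h (a \<odot>\<^bsub>A\<^esub> x) = a \<odot>\<^bsub>B\<^esub> h x)"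

end

theory Submission
  imports Defs "HOL-Library.Countable_Set"
begin

text \<open>
  Let \<open>L\<close> be the Leavitt path algebra of \<open>E\<close>.  Its elements are combinations of products \<open>p q\<^sup>*\<close> of
  paths and ghost paths.  Two facts about ghost paths carry the proof.  First, every \<open>x\<close> in \<open>L\<close> can be
  recovered from its products \<open>p\<^sup>* x\<close>, where \<open>p\<close> ranges over the paths of a given length and the shorter ones
  that end at a sink, because \<open>x\<close> is the sum of the \<open>p p\<^sup>* x\<close>; and if the length is large enough, all
  \<open>p\<^sup>* x\<close> are combinations of ghost paths (\<open>in_subsetI\<close>, \<open>generated_imp_reducible\<close>).  Second, the
  ghost paths are linearly independent in \<open>L\<close>, as an explicit representation shows (\<open>L_faithful\<close>).
  Consequently a homomorphism from \<open>L\<close> is injective if the images of the ghost paths are linearly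
  independent (\<open>leavitt_embedding\<close>), and Leavitt path algebras can be recognized inside other algebras
  (\<open>corner_unit_isomorphic\<close>).

  The module \<open>Q\<close> is a finite direct sum of modules \<open>L v\<close> with vertices \<open>v\<close> (\<open>vertex_basis\<close>).  Indeed, \<open>Q\<close>
  embeds into a free module, and by the first fact it is generated by finitely many elements whose
  coordinates are combinations of ghost paths.  The ghost paths span a path algebra, which has a division
  algorithm like that of free algebras: if the generators are dependent, one of them can be replaced by an
  element of smaller degree (\<open>reduce_dependent\<close>).  When this process ends, the generators are independent
  over the algebra of ghost paths, and then, by the first fact again, over \<open>L\<close>.

  For each summand \<open>L v\<close>, attach to \<open>E\<close> a new vertex that emits a single edge, to \<open>v\<close>.  The new
  vertices then represent the summands of \<open>Q\<close>, and the endomorphism algebra of \<open>Q\<close> is the corner of the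
  Leavitt path algebra of the larger graph at the set of the new vertices (\<open>End_isomorphic_corner\<close>).

  So it is enough to treat corners at nonempty sets \<open>I\<close> of vertices (\<open>corner_leavitt\<close>).  If no edge
  leaves \<open>I\<close>, the corner is the Leavitt path algebra of the subgraph on \<open>I\<close>.  Otherwise let \<open>f\<close> be an edge from
  \<open>u\<close> in \<open>I\<close> to \<open>v\<close> outside.  The vertex \<open>u\<close> is the sum of \<open>u - f f\<^sup>*\<close> and \<open>f f\<^sup>*\<close>, and \<open>f f\<^sup>*\<close> is equivalent to
  \<open>v\<close>.  Hence, up to isomorphism, the corner is unchanged if \<open>u\<close> is replaced by \<open>u - f f\<^sup>*\<close> and \<open>v\<close> is added to \<open>I\<close>
  (\<open>corner_splitting\<close>).  These idempotents belong to the graph that arises from \<open>E\<close> by deleting \<open>f\<close> and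
  adding an edge \<open>g f\<close> for each edge \<open>g\<close> into \<open>u\<close>; if \<open>f\<close> is the only edge at \<open>u\<close>, then \<open>u - f f\<^sup>* = 0\<close>, and \<open>u\<close> is
  dropped.  Each such step lowers the number of vertices outside \<open>I\<close>.
\<close>

section \<open>Algebras over a field\<close>

locale kalgebra = K: field K + ring A
  for K :: "('k, 'c) ring_scheme" and A :: "('k, 'a, 'm) module_scheme" (structure) +
  assumes smult_closed [simp, intro]:
      "\<lbrakk>a \<in> carrier K; x \<in> carrier A\<rbrakk> \<Longrightarrow> a \<odot> x \<in> carrier A"
    and smult_l_distr:
      "\<lbrakk>a \<in> carrier K; b \<in> carrier K; x \<in> carrier A\<rbrakk> \<Longrightarrow> (a \<oplus>\<^bsub>K\<^esub> b) \<odot> x = a \<odot> x \<oplus> b \<odot> x"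
    and smult_r_distr:
      "\<lbrakk>a \<in> carrier K; x \<in> carrier A; y \<in> carrier A\<rbrakk> \<Longrightarrow> a \<odot> (x \<oplus> y) = a \<odot> x \<oplus> a \<odot> y"
    and smult_assoc1:
      "\<lbrakk>a \<in> carrier K; b \<in> carrier K; x \<in> carrier A\<rbrakk> \<Longrightarrow> (a \<otimes>\<^bsub>K\<^esub> b) \<odot> x = a \<odot> (b \<odot> x)"
    and smult_one [simp]: "x \<in> carrier A \<Longrightarrow> \<one>\<^bsub>K\<^esub> \<odot> x = x"
    and smult_mult_l:
      "\<lbrakk>a \<in> carrier K; x \<in> carrier A; y \<in> carrier A\<rbrakk> \<Longrightarrow> (a \<odot> x) \<otimes> y = a \<odot> (x \<otimes> y)"
    and smult_mult_r:
      "\<lbrakk>a \<in> carrier K; x \<in> carrier A; y \<in> carrier A\<rbrakk> \<Longrightarrow> x \<otimes> (a \<odot> y) = a \<odot> (x \<otimes> y)"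
begin

lemma smult_zero [simp]: "a \<in> carrier K \<Longrightarrow> a \<odot> \<zero> = \<zero>"
  by (metis add.l_cancel_one' smult_closed smult_r_distr r_zero zero_closed)

lemma zero_smult [simp]: "x \<in> carrier A \<Longrightarrow> \<zero>\<^bsub>K\<^esub> \<odot> x = \<zero>"
  by (metis K.r_zero K.zero_closed add.l_cancel_one' smult_closed smult_l_distr)

lemma minus_one_smult: "x \<in> carrier A \<Longrightarrow> (\<ominus>\<^bsub>K\<^esub> \<one>\<^bsub>K\<^esub>) \<odot> x = \<ominus> x"
  by (metis K.add.inv_closed K.l_neg K.one_closed add.inv_equality smult_closed smult_l_distr smult_one
      zero_smult)

end


section \<open>The free algebra\<close>

context field
begin

lemma free_algebra_simps:
  "mult (free_algebra R X) = (\<lambda>f g w. \<Oplus>i\<in>{..length w}. f (take i w) \<otimes> g (drop i w))"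
  "one (free_algebra R X) = (\<lambda>w. if w = [] then \<one> else \<zero>)"
  "zero (free_algebra R X) = (\<lambda>w. \<zero>)"
  "add (free_algebra R X) = (\<lambda>f g w. f w \<oplus> g w)"
  "smult (free_algebra R X) = (\<lambda>a f w. a \<otimes> f w)"
  by (simp_all add: free_algebra_def)

lemma free_algebra_carrier:
  "f \<in> carrier (free_algebra R X) \<longleftrightarrow> (\<forall>w. f w \<in> carrier R) \<and> finite {w. f w \<noteq> \<zero>} \<and>
    (\<forall>w. f w \<noteq> \<zero> \<longrightarrow> set w \<subseteq> X)"
  by (auto simp: free_algebra_def)

lemma free_algebra_coeff [simp]: "f \<in> carrier (free_algebra R X) \<Longrightarrow> f w \<in> carrier R"
  by (simp add: free_algebra_carrier)

lemma free_algebra_zero_closed: "\<zero>\<^bsub>free_algebra R X\<^esub> \<in> carrier (free_algebra R X)"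
  by (simp add: free_algebra_carrier free_algebra_simps)

lemma free_algebra_add_closed:
  assumes "f \<in> carrier (free_algebra R X)" "g \<in> carrier (free_algebra R X)"
  shows "f \<oplus>\<^bsub>free_algebra R X\<^esub> g \<in> carrier (free_algebra R X)"
proof -
  have "{w. f w \<oplus> g w \<noteq> \<zero>} \<subseteq> {w. f w \<noteq> \<zero>} \<union> {w. g w \<noteq> \<zero>}" by auto
  moreover have "set w \<subseteq> X" if "f w \<oplus> g w \<noteq> \<zero>" for w
    using that assms unfolding free_algebra_carrier
    by (metis l_zero zero_closed)
  ultimately show ?thesis
    using assms unfolding free_algebra_carrier free_algebra_simps
    by (auto intro: finite_subset)
qed

lemma free_algebra_smult_closed:
  assumes "a \<in> carrier R" "f \<in> carrier (free_algebra R X)"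
  shows "a \<odot>\<^bsub>free_algebra R X\<^esub> f \<in> carrier (free_algebra R X)"
proof -
  have "{w. a \<otimes> f w \<noteq> \<zero>} \<subseteq> {w. f w \<noteq> \<zero>}" using assms by auto
  moreover from this have "finite {w. a \<otimes> f w \<noteq> \<zero>}"
    by (rule finite_subset) (use assms in \<open>simp add: free_algebra_carrier\<close>)
  ultimately show ?thesis
    using assms unfolding free_algebra_carrier free_algebra_simps by auto
qed

lemma word_closed:
  assumes "set u \<subseteq> X" shows "word R u \<in> carrier (free_algebra R X)"
proof -
  have "{w. word R u w \<noteq> \<zero>} \<subseteq> {u}" by (auto simp: word_def)
  then have "finite {w. word R u w \<noteq> \<zero>}" by (rule finite_subset) simp
  then show ?thesis
    using assms unfolding free_algebra_carrier by (auto simp: word_def)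
qed

lemma free_algebra_mult_closed:
  assumes f: "f \<in> carrier (free_algebra R X)" and g: "g \<in> carrier (free_algebra R X)"
  shows "f \<otimes>\<^bsub>free_algebra R X\<^esub> g \<in> carrier (free_algebra R X)"
proof -
  let ?h = "\<lambda>w. \<Oplus>i\<in>{..length w}. f (take i w) \<otimes> g (drop i w)"
  have nz: "\<exists>u v. w = u @ v \<and> f u \<noteq> \<zero> \<and> g v \<noteq> \<zero>" if "?h w \<noteq> \<zero>" for w
  proof (rule ccontr)
    assume *: "\<not> ?thesis"
    have "f (take i w) \<otimes> g (drop i w) = \<zero>" for i
    proof -
      have "f (take i w) = \<zero> \<or> g (drop i w) = \<zero>"
        using * append_take_drop_id[of i w] by metis
      then show ?thesis using f g by auto
    qed
    then have "?h w = \<zero>" by (intro add.finprod_one_eqI) auto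
    with that show False ..
  qed
  have "{w. ?h w \<noteq> \<zero>} \<subseteq> (\<lambda>(u, v). u @ v) ` ({w. f w \<noteq> \<zero>} \<times> {w. g w \<noteq> \<zero>})"
    using nz by fastforce
  moreover have "finite ({w. f w \<noteq> \<zero>} \<times> {w. g w \<noteq> \<zero>})"
    using f g by (simp add: free_algebra_carrier)
  ultimately have "finite {w. ?h w \<noteq> \<zero>}" by (meson finite_imageI finite_subset)
  moreover have "set w \<subseteq> X" if "?h w \<noteq> \<zero>" for w
    using nz[OF that] f g by (fastforce simp: free_algebra_carrier)
  moreover have "?h w \<in> carrier R" for w
    using f g by (intro finsum_closed) auto
  ultimately show ?thesis by (simp add: free_algebra_carrier[of _ X] free_algebra_simps)
qed

lemma free_algebra_abelian_group: "abelian_group (free_algebra R X)"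
proof (rule abelian_groupI)
  fix f assume f: "f \<in> carrier (free_algebra R X)"
  have "(\<ominus> \<one>) \<odot>\<^bsub>free_algebra R X\<^esub> f \<in> carrier (free_algebra R X)"
    using f by (intro free_algebra_smult_closed) auto
  moreover have "((\<ominus> \<one>) \<odot>\<^bsub>free_algebra R X\<^esub> f) \<oplus>\<^bsub>free_algebra R X\<^esub> f = \<zero>\<^bsub>free_algebra R X\<^esub>"
    using f by (auto simp: free_algebra_simps l_minus l_neg)
  ultimately show "\<exists>g\<in>carrier (free_algebra R X). g \<oplus>\<^bsub>free_algebra R X\<^esub> f = \<zero>\<^bsub>free_algebra R X\<^esub>"
    by blast
qed (auto simp: free_algebra_zero_closed free_algebra_add_closed,
    auto simp: free_algebra_simps a_assoc intro!: ext a_comm)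

text \<open>Linear statements about the free algebra need to be checked on words only; \<open>N\<close> records the
  shape of the words that occur.\<close>

lemma free_algebra_support_induct [consumes 1, case_names support zero add]:
  assumes "f \<in> carrier (free_algebra R X)" and "\<And>w. f w \<noteq> \<zero> \<Longrightarrow> N w"
    and zero: "P (\<zero>\<^bsub>free_algebra R X\<^esub>)"
    and add: "\<And>a u g. \<lbrakk>a \<in> carrier R; set u \<subseteq> X; N u; g \<in> carrier (free_algebra R X);
      \<And>w. g w \<noteq> \<zero> \<Longrightarrow> N w; P g\<rbrakk>
      \<Longrightarrow> P (a \<odot>\<^bsub>free_algebra R X\<^esub> word R u \<oplus>\<^bsub>free_algebra R X\<^esub> g)"
  shows "P f"
  using assms(1,2)
proof (induct "card {w. f w \<noteq> \<zero>}" arbitrary: f)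
  case 0
  then have "{w. f w \<noteq> \<zero>} = {}" by (simp add: free_algebra_carrier)
  then have "f = \<zero>\<^bsub>free_algebra R X\<^esub>" by (auto simp: free_algebra_simps)
  then show ?case using zero by simp
next
  case (Suc n)
  then have "{w. f w \<noteq> \<zero>} \<noteq> {}" by (metis card.empty nat.distinct(1))
  then obtain u where u: "f u \<noteq> \<zero>" by auto
  let ?g = "f(u := \<zero>)"
  have eq: "{w. ?g w \<noteq> \<zero>} = {w. f w \<noteq> \<zero>} - {u}" by auto
  have g: "?g \<in> carrier (free_algebra R X)"
    using Suc(3) unfolding free_algebra_carrier eq by (auto simp: free_algebra_carrier)
  have gN: "N w" if "?g w \<noteq> \<zero>" for w
    using that Suc(4) by (auto split: if_splits)
  have "card {w. ?g w \<noteq> \<zero>} = n"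
    unfolding eq using Suc(2,3) u by (simp add: free_algebra_carrier)
  then have "P ?g" using Suc(1) g gN by blast
  moreover have "f = f u \<odot>\<^bsub>free_algebra R X\<^esub> word R u \<oplus>\<^bsub>free_algebra R X\<^esub> ?g"
    using Suc(3) by (auto simp: free_algebra_simps word_def fun_eq_iff)
  moreover have "N u" using Suc(4) u by blast
  ultimately show ?case
    using add[of "f u" u ?g] g gN Suc(3) u by (auto simp: free_algebra_carrier)
qed

lemma free_algebra_induct [consumes 1, case_names zero add]:
  assumes "f \<in> carrier (free_algebra R X)"
    and "P (\<zero>\<^bsub>free_algebra R X\<^esub>)"
    and "\<And>a u g. \<lbrakk>a \<in> carrier R; set u \<subseteq> X; g \<in> carrier (free_algebra R X); P g\<rbrakk>
      \<Longrightarrow> P (a \<odot>\<^bsub>free_algebra R X\<^esub> word R u \<oplus>\<^bsub>free_algebra R X\<^esub> g)"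
  shows "P f"
  using assms(1) by (rule free_algebra_support_induct[where N = "\<lambda>_. True"]) (use assms in auto)

lemma word_mult:
  assumes g: "g \<in> carrier (free_algebra R X)"
  shows "(word R u \<otimes>\<^bsub>free_algebra R X\<^esub> g) w =
    (if take (length u) w = u then g (drop (length u) w) else \<zero>)"
proof -
  have "(word R u \<otimes>\<^bsub>free_algebra R X\<^esub> g) w =
      (\<Oplus>i\<in>{..length w}. if length u = i then word R u (take i w) \<otimes> g (drop i w) else \<zero>)"
    unfolding free_algebra_simps
  proof (rule finsum_cong')
    fix i assume "i \<in> {..length w}"
    then show "word R u (take i w) \<otimes> g (drop i w) =
      (if length u = i then word R u (take i w) \<otimes> g (drop i w) else \<zero>)"
      using g by (auto simp: word_def)
  qed (use g in \<open>auto simp: word_def\<close>)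
  also have "\<dots> = (if take (length u) w = u then g (drop (length u) w) else \<zero>)"
  proof (cases "length u \<le> length w")
    case True
    then show ?thesis using g by (subst finsum_singleton) (auto simp: word_def)
  next
    case False
    then have "take (length u) w \<noteq> u"
      by (metis length_take min.absorb_iff2 min.commute nle_le)
    moreover have "(\<Oplus>i\<in>{..length w}. if length u = i then word R u (take i w) \<otimes> g (drop i w) else \<zero>) = \<zero>"
      using False by (intro add.finprod_one_eqI) auto
    ultimately show ?thesis by simp
  qed
  finally show ?thesis .
qed

lemma word_mult_word: "word R u \<otimes>\<^bsub>free_algebra R X\<^esub> word R v = word R (u @ v)"
proof
  fix w
  have "(word R u \<otimes>\<^bsub>free_algebra R X\<^esub> word R v) w = (word R u \<otimes>\<^bsub>free_algebra R UNIV\<^esub> word R v) w"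
    by (simp add: free_algebra_simps)
  also have "\<dots> = word R (u @ v) w"
    by (subst word_mult) (auto simp: word_closed, auto simp: word_def, metis append_take_drop_id)
  finally show "(word R u \<otimes>\<^bsub>free_algebra R X\<^esub> word R v) w = word R (u @ v) w" .
qed

text \<open>Associativity is trilinear, so by \<open>free_algebra_induct\<close> in each argument it reduces to the
  associativity of concatenation.\<close>

lemma free_algebra_kalgebra: "kalgebra R (free_algebra R X)"
proof -
  let ?F = "free_algebra R X"
  interpret F: abelian_group ?F by (rule free_algebra_abelian_group)
  note cl [simp] = free_algebra_mult_closed free_algebra_smult_closed
  have l_distr: "(f \<oplus>\<^bsub>?F\<^esub> g) \<otimes>\<^bsub>?F\<^esub> h = f \<otimes>\<^bsub>?F\<^esub> h \<oplus>\<^bsub>?F\<^esub> g \<otimes>\<^bsub>?F\<^esub> h"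
    if "f \<in> carrier ?F" "g \<in> carrier ?F" "h \<in> carrier ?F" for f g h
    using that by (auto simp: free_algebra_simps l_distr Pi_def intro!: ext simp flip: finsum_addf)
  have r_distr: "h \<otimes>\<^bsub>?F\<^esub> (f \<oplus>\<^bsub>?F\<^esub> g) = h \<otimes>\<^bsub>?F\<^esub> f \<oplus>\<^bsub>?F\<^esub> h \<otimes>\<^bsub>?F\<^esub> g"
    if "f \<in> carrier ?F" "g \<in> carrier ?F" "h \<in> carrier ?F" for f g h
    using that by (auto simp: free_algebra_simps r_distr Pi_def intro!: ext simp flip: finsum_addf)
  have sm_l: "(a \<odot>\<^bsub>?F\<^esub> f) \<otimes>\<^bsub>?F\<^esub> g = a \<odot>\<^bsub>?F\<^esub> (f \<otimes>\<^bsub>?F\<^esub> g)"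
    if "a \<in> carrier R" "f \<in> carrier ?F" "g \<in> carrier ?F" for a f g
    using that by (auto simp: free_algebra_simps m_assoc finsum_rdistr Pi_def intro!: ext)
  have sm_r: "f \<otimes>\<^bsub>?F\<^esub> (a \<odot>\<^bsub>?F\<^esub> g) = a \<odot>\<^bsub>?F\<^esub> (f \<otimes>\<^bsub>?F\<^esub> g)"
    if "a \<in> carrier R" "f \<in> carrier ?F" "g \<in> carrier ?F" for a f g
    using that by (auto simp: free_algebra_simps m_lcomm finsum_rdistr Pi_def intro!: ext)
  have zl: "\<zero>\<^bsub>?F\<^esub> \<otimes>\<^bsub>?F\<^esub> g = \<zero>\<^bsub>?F\<^esub>" if "g \<in> carrier ?F" for g
    using that by (auto simp: free_algebra_simps intro!: ext add.finprod_one_eqI)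
  have zr: "g \<otimes>\<^bsub>?F\<^esub> \<zero>\<^bsub>?F\<^esub> = \<zero>\<^bsub>?F\<^esub>" if "g \<in> carrier ?F" for g
    using that by (auto simp: free_algebra_simps intro!: ext add.finprod_one_eqI)
  have one: "\<one>\<^bsub>?F\<^esub> = word R []"
    by (simp add: free_algebra_simps word_def)
  have w [simp]: "word R u \<in> carrier ?F" if "set u \<subseteq> X" for u
    using that by (rule word_closed)
  have assoc_w: "(word R u \<otimes>\<^bsub>?F\<^esub> word R v) \<otimes>\<^bsub>?F\<^esub> h = word R u \<otimes>\<^bsub>?F\<^esub> (word R v \<otimes>\<^bsub>?F\<^esub> h)"
    if "h \<in> carrier ?F" "set u \<subseteq> X" "set v \<subseteq> X" for u v h
    using that
    by (induct h rule: free_algebra_induct)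
      (simp_all add: zr r_distr sm_r word_mult_word F.add.m_closed)
  have assoc_w2: "(word R u \<otimes>\<^bsub>?F\<^esub> g) \<otimes>\<^bsub>?F\<^esub> h = word R u \<otimes>\<^bsub>?F\<^esub> (g \<otimes>\<^bsub>?F\<^esub> h)"
    if "g \<in> carrier ?F" "h \<in> carrier ?F" "set u \<subseteq> X" for u g h
    using that
    by (induct g rule: free_algebra_induct)
      (simp_all add: zr zl r_distr l_distr sm_r sm_l assoc_w)
  have assoc: "(f \<otimes>\<^bsub>?F\<^esub> g) \<otimes>\<^bsub>?F\<^esub> h = f \<otimes>\<^bsub>?F\<^esub> (g \<otimes>\<^bsub>?F\<^esub> h)"
    if "f \<in> carrier ?F" "g \<in> carrier ?F" "h \<in> carrier ?F" for f g h
    using that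
    by (induct f rule: free_algebra_induct)
      (simp_all add: zl l_distr sm_l assoc_w2)
  have l_one: "word R [] \<otimes>\<^bsub>?F\<^esub> g = g" if "g \<in> carrier ?F" for g
    using that by (auto simp: word_mult)
  have r_one: "g \<otimes>\<^bsub>?F\<^esub> word R [] = g" if "g \<in> carrier ?F" for g
    using that
    by (induct g rule: free_algebra_induct) (simp_all add: zl l_distr sm_l word_mult_word)
  show ?thesis
  proof (intro kalgebra.intro ringI kalgebra_axioms.intro)
    show "Group.monoid ?F"
      by (rule monoidI) (simp_all add: assoc l_one r_one one)
    show "(a \<oplus> b) \<odot>\<^bsub>?F\<^esub> f = a \<odot>\<^bsub>?F\<^esub> f \<oplus>\<^bsub>?F\<^esub> b \<odot>\<^bsub>?F\<^esub> f"
      if "a \<in> carrier R" "b \<in> carrier R" "f \<in> carrier ?F" for a b f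
      using that by (auto simp: free_algebra_simps semiring.l_distr semiring_axioms)
    show "a \<odot>\<^bsub>?F\<^esub> (f \<oplus>\<^bsub>?F\<^esub> g) = a \<odot>\<^bsub>?F\<^esub> f \<oplus>\<^bsub>?F\<^esub> a \<odot>\<^bsub>?F\<^esub> g"
      if "a \<in> carrier R" "f \<in> carrier ?F" "g \<in> carrier ?F" for a f g
      using that by (auto simp: free_algebra_simps semiring.r_distr semiring_axioms)
    show "(a \<otimes> b) \<odot>\<^bsub>?F\<^esub> f = a \<odot>\<^bsub>?F\<^esub> (b \<odot>\<^bsub>?F\<^esub> f)"
      if "a \<in> carrier R" "b \<in> carrier R" "f \<in> carrier ?F" for a b f
      using that by (auto simp: free_algebra_simps m_assoc)
    show "\<one> \<odot>\<^bsub>?F\<^esub> f = f" if "f \<in> carrier ?F" for f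
      using that by (auto simp: free_algebra_simps)
  qed (use field_axioms F.abelian_group_axioms in \<open>simp_all add: l_distr r_distr sm_l sm_r\<close>)
qed

end

text \<open>The homomorphism from the free algebra that extends the assignment \<open>val\<close> of the letters.\<close>

definition eval_word :: "('k, 'a, 'm) module_scheme \<Rightarrow> ('x \<Rightarrow> 'a) \<Rightarrow> 'x list \<Rightarrow> 'a"
  where "eval_word A val w = foldr (\<lambda>x y. val x \<otimes>\<^bsub>A\<^esub> y) w \<one>\<^bsub>A\<^esub>"

definition eval_free ::
  "('k, 'c) ring_scheme \<Rightarrow> ('k, 'a, 'm) module_scheme \<Rightarrow> ('x \<Rightarrow> 'a) \<Rightarrow> ('x list \<Rightarrow> 'k) \<Rightarrow> 'a"
  where "eval_free K A val f = (\<Oplus>\<^bsub>A\<^esub>w\<in>{w. f w \<noteq> \<zero>\<^bsub>K\<^esub>}. f w \<odot>\<^bsub>A\<^esub> eval_word A val w)"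

context kalgebra
begin

lemma eval_word_Nil [simp]: "eval_word A val [] = \<one>"
  by (simp add: eval_word_def)

lemma eval_word_Cons [simp]: "eval_word A val (x # w) = val x \<otimes> eval_word A val w"
  by (simp add: eval_word_def)

lemma eval_word_closed [simp]: "\<forall>x\<in>set w. val x \<in> carrier A \<Longrightarrow> eval_word A val w \<in> carrier A"
  by (induct w) auto

lemma eval_word_append:
  "\<lbrakk>\<forall>x\<in>set u. val x \<in> carrier A; \<forall>x\<in>set v. val x \<in> carrier A\<rbrakk>
    \<Longrightarrow> eval_word A val (u @ v) = eval_word A val u \<otimes> eval_word A val v"
  by (induct u) (auto simp: m_assoc)

lemma eval_free_superset:
  assumes "f \<in> carrier (free_algebra K X)" "val \<in> X \<rightarrow> carrier A"
    and "finite B" "{w. f w \<noteq> \<zero>\<^bsub>K\<^esub>} \<subseteq> B" "\<And>w. w \<in> B \<Longrightarrow> set w \<subseteq> X"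
  shows "eval_free K A val f = (\<Oplus>w\<in>B. f w \<odot> eval_word A val w)"
  unfolding eval_free_def
proof (rule add.finprod_mono_neutral_cong_left)
  have c: "eval_word A val w \<in> carrier A" if "w \<in> B" for w
    using assms(2) assms(5)[OF that] by (intro eval_word_closed) auto
  show "f w \<odot> eval_word A val w = \<zero>" if "w \<in> B - {w. f w \<noteq> \<zero>\<^bsub>K\<^esub>}" for w
    using that c by auto
  show "(\<lambda>w. f w \<odot> eval_word A val w) \<in> B \<rightarrow> carrier A"
    using c assms(1) by (auto simp: K.free_algebra_carrier)
qed (use assms in auto)

lemma eval_free_cong:
  assumes "f \<in> carrier (free_algebra K X)" "val \<in> X \<rightarrow> carrier A" "\<And>x. x \<in> X \<Longrightarrow> val' x = val x"
  shows "eval_free K A val' f = eval_free K A val f"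
  unfolding eval_free_def
proof (rule finsum_cong')
  fix w assume "w \<in> {w. f w \<noteq> \<zero>\<^bsub>K\<^esub>}"
  then have w: "set w \<subseteq> X" using assms(1) by (auto simp: K.free_algebra_carrier)
  then have "eval_word A val' w = eval_word A val w"
    using assms(3) by (induct w) auto
  then show "f w \<odot> eval_word A val' w = f w \<odot> eval_word A val w" by simp
next
  show "(\<lambda>w. f w \<odot> eval_word A val w) \<in> {w. f w \<noteq> \<zero>\<^bsub>K\<^esub>} \<rightarrow> carrier A"
    using assms(1,2) by (auto simp: K.free_algebra_carrier intro!: smult_closed eval_word_closed)
qed simp

context
  fixes X :: "'x set" and val :: "'x \<Rightarrow> 'a"
  assumes val: "val \<in> X \<rightarrow> carrier A"
begin

lemma eval_word_in_carrier: "set w \<subseteq> X \<Longrightarrow> eval_word A val w \<in> carrier A"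
  using val by (intro eval_word_closed) auto

lemma eval_free_closed:
  "f \<in> carrier (free_algebra K X) \<Longrightarrow> eval_free K A val f \<in> carrier A"
  unfolding eval_free_def using eval_word_in_carrier
  by (intro finsum_closed) (auto simp: K.free_algebra_carrier)

lemma eval_free_zero: "eval_free K A val \<zero>\<^bsub>free_algebra K X\<^esub> = \<zero>"
  by (simp add: eval_free_def K.free_algebra_simps)

lemma eval_free_add:
  assumes "f \<in> carrier (free_algebra K X)" "g \<in> carrier (free_algebra K X)"
  shows "eval_free K A val (f \<oplus>\<^bsub>free_algebra K X\<^esub> g) = eval_free K A val f \<oplus> eval_free K A val g"
proof -
  let ?B = "{w. f w \<noteq> \<zero>\<^bsub>K\<^esub>} \<union> {w. g w \<noteq> \<zero>\<^bsub>K\<^esub>}"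
  have B: "finite ?B" "\<And>w. w \<in> ?B \<Longrightarrow> set w \<subseteq> X"
    using assms by (auto simp: K.free_algebra_carrier)
  have c: "eval_word A val w \<in> carrier A" if "w \<in> ?B" for w
    using B(2)[OF that] by (rule eval_word_in_carrier)
  have "eval_free K A val (f \<oplus>\<^bsub>free_algebra K X\<^esub> g) =
      (\<Oplus>w\<in>?B. (f \<oplus>\<^bsub>free_algebra K X\<^esub> g) w \<odot> eval_word A val w)"
    using B assms by (intro eval_free_superset[OF _ val] K.free_algebra_add_closed)
      (auto simp: K.free_algebra_simps)
  also have "\<dots> = (\<Oplus>w\<in>?B. f w \<odot> eval_word A val w \<oplus> g w \<odot> eval_word A val w)"
    using assms c by (intro finsum_cong')
      (auto simp: K.free_algebra_simps smult_l_distr)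
  also have "\<dots> = (\<Oplus>w\<in>?B. f w \<odot> eval_word A val w) \<oplus> (\<Oplus>w\<in>?B. g w \<odot> eval_word A val w)"
    using assms c by (intro finsum_addf) auto
  also have "\<dots> = eval_free K A val f \<oplus> eval_free K A val g"
    using B assms eval_free_superset[OF assms(1) val B(1)] eval_free_superset[OF assms(2) val B(1)]
    by auto
  finally show ?thesis .
qed

lemma eval_free_word:
  assumes "a \<in> carrier K" "set u \<subseteq> X"
  shows "eval_free K A val (a \<odot>\<^bsub>free_algebra K X\<^esub> word K u) = a \<odot> eval_word A val u"
proof -
  have "eval_free K A val (a \<odot>\<^bsub>free_algebra K X\<^esub> word K u) =
      (\<Oplus>w\<in>{u}. (a \<odot>\<^bsub>free_algebra K X\<^esub> word K u) w \<odot> eval_word A val w)"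
    using assms by (intro eval_free_superset[OF _ val] K.free_algebra_smult_closed K.word_closed)
      (auto simp: K.free_algebra_simps word_def)
  also have "\<dots> = a \<odot> eval_word A val u"
    using assms eval_word_in_carrier by (simp add: K.free_algebra_simps word_def)
  finally show ?thesis .
qed

lemma eval_free_word1:
  assumes "set u \<subseteq> X"
  shows "eval_free K A val (word K u) = eval_word A val u"
proof -
  have "\<one>\<^bsub>K\<^esub> \<odot>\<^bsub>free_algebra K X\<^esub> word K u = word K u"
    by (auto simp: K.free_algebra_simps word_def)
  then show ?thesis
    using eval_free_word[of "\<one>\<^bsub>K\<^esub>" u] assms eval_word_in_carrier by auto
qed

lemma eval_free_smult:
  assumes "a \<in> carrier K" "f \<in> carrier (free_algebra K X)"
  shows "eval_free K A val (a \<odot>\<^bsub>free_algebra K X\<^esub> f) = a \<odot> eval_free K A val f"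
proof -
  interpret F: kalgebra K "free_algebra K X" by (rule K.free_algebra_kalgebra)
  show ?thesis using assms(2)
  proof (induct f rule: K.free_algebra_induct)
    case zero
    then show ?case using assms by (simp add: eval_free_zero)
  next
    case (add b u g)
    then show ?case using assms eval_word_in_carrier
      by (simp add: F.smult_r_distr eval_free_add eval_free_word eval_free_closed
          smult_r_distr K.word_closed smult_assoc1 flip: F.smult_assoc1)
  qed
qed

lemma eval_free_mult:
  assumes f: "f \<in> carrier (free_algebra K X)" and g: "g \<in> carrier (free_algebra K X)"
  shows "eval_free K A val (f \<otimes>\<^bsub>free_algebra K X\<^esub> g) = eval_free K A val f \<otimes> eval_free K A val g"
proof -
  let ?F = "free_algebra K X"
  interpret F: kalgebra K ?F by (rule K.free_algebra_kalgebra)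
  note [simp] = K.word_closed eval_word_in_carrier eval_free_closed
  have ww: "eval_free K A val (word K u \<otimes>\<^bsub>?F\<^esub> g) = eval_word A val u \<otimes> eval_free K A val g"
    if u: "set u \<subseteq> X" for u
    using g
  proof (induct g rule: K.free_algebra_induct)
    case zero
    then show ?case using u by (simp add: eval_free_zero)
  next
    case (add b v h)
    have "eval_word A val (u @ v) = eval_word A val u \<otimes> eval_word A val v"
      using add u val by (intro eval_word_append) auto
    with add show ?case using u
      by (simp add: F.r_distr F.smult_mult_r eval_free_add eval_free_smult K.word_mult_word
          eval_free_word1 r_distr smult_mult_r)
  qed
  show ?thesis using f
  proof (induct f rule: K.free_algebra_induct)
    case zero
    then show ?case using g by (simp add: eval_free_zero)
  next
    case (add b v h)
    then show ?case using g
      by (simp add: F.l_distr F.smult_mult_l eval_free_add eval_free_smult ww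
          eval_free_word1 l_distr smult_mult_l)
  qed
qed

end

text \<open>An injective substitution \<open>\<eta>\<close> of words causes no cancellation.  If it matches the values of words
  under \<open>val'\<close> and \<open>val\<close>, up to the factors \<open>p'\<close>, \<open>p\<close> and \<open>q\<close>, then linear independence of the values
  under \<open>val\<close> implies that of the values under \<open>val'\<close>.\<close>

lemma eval_free_push:
  fixes f :: "'x list \<Rightarrow> 'k" and val' :: "'x \<Rightarrow> 'a" and val :: "'y \<Rightarrow> 'a"
  assumes f: "f \<in> carrier (free_algebra K X)" and val': "val' \<in> X \<rightarrow> carrier A"
    and val: "val \<in> Y \<rightarrow> carrier A"
    and c: "p \<in> carrier A" "p' \<in> carrier A" "q \<in> carrier A"
    and inj: "inj_on \<eta> {w. f w \<noteq> \<zero>\<^bsub>K\<^esub>}"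
    and Y: "\<And>w. f w \<noteq> \<zero>\<^bsub>K\<^esub> \<Longrightarrow> set (\<eta> w) \<subseteq> Y"
    and eq: "\<And>w. f w \<noteq> \<zero>\<^bsub>K\<^esub> \<Longrightarrow>
      eval_word A val' w \<otimes> p' = q \<otimes> (eval_word A val (\<eta> w) \<otimes> p)"
  obtains g where "g \<in> carrier (free_algebra K Y)"
    and "\<And>z. g z \<noteq> \<zero>\<^bsub>K\<^esub> \<Longrightarrow> \<exists>w. z = \<eta> w \<and> f w \<noteq> \<zero>\<^bsub>K\<^esub>"
    and "eval_free K A val' f \<otimes> p' = q \<otimes> (eval_free K A val g \<otimes> p)"
    and "g = \<zero>\<^bsub>free_algebra K Y\<^esub> \<Longrightarrow> f = \<zero>\<^bsub>free_algebra K X\<^esub>"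
proof -
  let ?W = "{w. f w \<noteq> \<zero>\<^bsub>K\<^esub>}"
  define g where "g z = (if z \<in> \<eta> ` ?W then f (inv_into ?W \<eta> z) else \<zero>\<^bsub>K\<^esub>)" for z
  have W: "finite ?W" "\<And>w. w \<in> ?W \<Longrightarrow> set w \<subseteq> X" and fc: "\<And>w. f w \<in> carrier K"
    using f by (auto simp: K.free_algebra_carrier)
  have g\<eta>: "g (\<eta> w) = f w" if "w \<in> ?W" for w
    using that inj by (simp add: g_def inv_into_f_f)
  have supp: "{z. g z \<noteq> \<zero>\<^bsub>K\<^esub>} = \<eta> ` ?W"
  proof (intro equalityI subsetI)
    fix z assume "z \<in> {z. g z \<noteq> \<zero>\<^bsub>K\<^esub>}"
    then show "z \<in> \<eta> ` ?W" unfolding g_def by (simp split: if_splits)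
  next
    fix z assume "z \<in> \<eta> ` ?W"
    then show "z \<in> {z. g z \<noteq> \<zero>\<^bsub>K\<^esub>}" using g\<eta> by auto
  qed
  have gc: "g \<in> carrier (free_algebra K Y)"
    unfolding K.free_algebra_carrier
  proof (intro conjI allI impI)
    show "g z \<in> carrier K" for z using fc by (simp add: g_def)
    show "finite {z. g z \<noteq> \<zero>\<^bsub>K\<^esub>}" unfolding supp using W(1) by simp
    show "set z \<subseteq> Y" if "g z \<noteq> \<zero>\<^bsub>K\<^esub>" for z
    proof -
      have "z \<in> \<eta> ` ?W" using that supp by blast
      then show ?thesis using Y by auto
    qed
  qed
  have c1: "eval_word A val' w \<in> carrier A" if "w \<in> ?W" for w
    using W(2)[OF that] by (rule eval_word_in_carrier[OF val'])
  have c2: "eval_word A val (\<eta> w) \<in> carrier A" if "w \<in> ?W" for w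
    using that Y by (intro eval_word_in_carrier[OF val]) auto
  have "eval_free K A val' f \<otimes> p' = (\<Oplus>w\<in>?W. (f w \<odot> eval_word A val' w) \<otimes> p')"
    unfolding eval_free_def using W(1) c c1 fc by (intro finsum_ldistr) auto
  also have "\<dots> = (\<Oplus>w\<in>?W. q \<otimes> ((g (\<eta> w) \<odot> eval_word A val (\<eta> w)) \<otimes> p))"
    using c c1 c2 fc g\<eta> eq by (intro finsum_cong') (auto simp: smult_mult_l smult_mult_r)
  also have "\<dots> = q \<otimes> (\<Oplus>w\<in>?W. (g (\<eta> w) \<odot> eval_word A val (\<eta> w)) \<otimes> p)"
    using W(1) c c2 fc g\<eta> by (intro finsum_rdistr[symmetric]) auto
  also have "(\<Oplus>w\<in>?W. (g (\<eta> w) \<odot> eval_word A val (\<eta> w)) \<otimes> p) =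
      (\<Oplus>w\<in>?W. g (\<eta> w) \<odot> eval_word A val (\<eta> w)) \<otimes> p"
    using W(1) c c2 fc g\<eta> by (intro finsum_ldistr[symmetric]) auto
  also have "(\<Oplus>w\<in>?W. g (\<eta> w) \<odot> eval_word A val (\<eta> w)) = eval_free K A val g"
    unfolding eval_free_def supp using c2 fc g\<eta> inj
    by (intro finsum_reindex[symmetric]) auto
  finally have "eval_free K A val' f \<otimes> p' = q \<otimes> (eval_free K A val g \<otimes> p)" .
  moreover have "f = \<zero>\<^bsub>free_algebra K X\<^esub>" if "g = \<zero>\<^bsub>free_algebra K Y\<^esub>"
  proof -
    have "\<eta> ` ?W = {}" using that supp by (auto simp: K.free_algebra_simps)
    then show ?thesis by (auto simp: K.free_algebra_simps)
  qed
  moreover have "\<exists>w. z = \<eta> w \<and> f w \<noteq> \<zero>\<^bsub>K\<^esub>" if "g z \<noteq> \<zero>\<^bsub>K\<^esub>" for z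
  proof -
    have "z \<in> \<eta> ` ?W" using that supp by blast
    then show ?thesis by auto
  qed
  ultimately show thesis using that gc by blast
qed

end


section \<open>Leavitt families\<close>

text \<open>The words \<open>e\<^sub>1 \<dots> e\<^sub>n\<close> for which the product \<open>e\<^sub>1\<^sup>* \<dots> e\<^sub>n\<^sup>*\<close> of ghost edges does not vanish
  already because \<open>e\<^sup>* f\<^sup>*\<close> is zero when \<open>e\<^sup>*\<close> does not end where \<open>f\<^sup>*\<close> starts.  A ghost edge leads from \<^const>\<open>head\<close> to \<^const>\<open>tail\<close>.\<close>

inductive ghost_path :: "('v, 'e) pre_digraph \<Rightarrow> 'v \<Rightarrow> 'e list \<Rightarrow> 'v \<Rightarrow> bool" for E where
  Nil: "x \<in> verts E \<Longrightarrow> ghost_path E x [] x"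
| Cons: "\<lbrakk>e \<in> arcs E; ghost_path E (tail E e) u y\<rbrakk> \<Longrightarrow> ghost_path E (head E e) (e # u) y"

inductive_simps ghost_path_Nil [simp]: "ghost_path E x [] y"
inductive_simps ghost_path_Cons [simp]: "ghost_path E x (e # u) y"

lemma ghost_path_append: "ghost_path E x u y \<Longrightarrow> ghost_path E y v z \<Longrightarrow> ghost_path E x (u @ v) z"
  by (induct rule: ghost_path.induct) auto

lemma ghost_path_suffix: "ghost_path E x u y \<Longrightarrow> ghost_path E x (u @ v) z \<Longrightarrow> ghost_path E y v z"
  by (induct rule: ghost_path.induct) auto

lemma ghost_path_arcs: "ghost_path E x u y \<Longrightarrow> set u \<subseteq> arcs E"
  by (induct rule: ghost_path.induct) auto

lemma ghost_path_end: "ghost_path E x u y \<Longrightarrow> y \<in> verts E"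
  by (induct rule: ghost_path.induct) auto

text \<open>The formal combinations of ghost paths from \<open>x\<close> to \<open>y\<close>.  They live in the free algebra on the edges,
  whose product is then the product of ghost paths.\<close>

definition ghost_coeffs ::
  "('k, 'c) ring_scheme \<Rightarrow> ('v, 'e) pre_digraph \<Rightarrow> 'v \<Rightarrow> 'v \<Rightarrow> ('e list \<Rightarrow> 'k) set"
  where "ghost_coeffs K E x y =
    {f \<in> carrier (free_algebra K (arcs E)). \<forall>w. f w \<noteq> \<zero>\<^bsub>K\<^esub> \<longrightarrow> ghost_path E x w y}"

context field
begin

lemma ghost_coeffs_carrier: "f \<in> ghost_coeffs R E x y \<Longrightarrow> f \<in> carrier (free_algebra R (arcs E))"
  by (simp add: ghost_coeffs_def)

lemma ghost_coeffs_path: "\<lbrakk>f \<in> ghost_coeffs R E x y; f w \<noteq> \<zero>\<rbrakk> \<Longrightarrow> ghost_path E x w y"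
  by (simp add: ghost_coeffs_def)

lemma ghost_coeffs_zero: "\<zero>\<^bsub>free_algebra R (arcs E)\<^esub> \<in> ghost_coeffs R E x y"
  by (simp add: ghost_coeffs_def free_algebra_zero_closed) (simp add: free_algebra_simps)

lemma ghost_coeffs_add:
  assumes "f \<in> ghost_coeffs R E x y" "g \<in> ghost_coeffs R E x y"
  shows "f \<oplus>\<^bsub>free_algebra R (arcs E)\<^esub> g \<in> ghost_coeffs R E x y"
  using assms unfolding ghost_coeffs_def
  by (simp add: free_algebra_add_closed) (metis (mono_tags) free_algebra_simps(4) l_zero zero_closed)

lemma ghost_coeffs_smult:
  assumes "a \<in> carrier R" "f \<in> ghost_coeffs R E x y"
  shows "a \<odot>\<^bsub>free_algebra R (arcs E)\<^esub> f \<in> ghost_coeffs R E x y"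
  using assms unfolding ghost_coeffs_def
  by (simp add: free_algebra_smult_closed) (metis free_algebra_simps(5) r_null)

lemma ghost_coeffs_word: "ghost_path E x u y \<Longrightarrow> word R u \<in> ghost_coeffs R E x y"
  unfolding ghost_coeffs_def using word_closed[OF ghost_path_arcs]
  by (auto simp: word_def)

lemma free_algebra_mult_support:
  assumes "f \<in> carrier (free_algebra R X)" "g \<in> carrier (free_algebra R X)"
    and "(f \<otimes>\<^bsub>free_algebra R X\<^esub> g) w \<noteq> \<zero>"
  obtains u v where "w = u @ v" "f u \<noteq> \<zero>" "g v \<noteq> \<zero>"
proof (rule ccontr)
  assume "\<not> thesis"
  then have *: "\<And>u v. w = u @ v \<Longrightarrow> f u = \<zero> \<or> g v = \<zero>" using that by blast
  have "f (take i w) \<otimes> g (drop i w) = \<zero>" for i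
    using *[of "take i w" "drop i w"] assms by auto
  then have "(f \<otimes>\<^bsub>free_algebra R X\<^esub> g) w = \<zero>"
    unfolding free_algebra_simps by (intro add.finprod_one_eqI) auto
  with assms show False by blast
qed

lemma ghost_coeffs_mult:
  assumes f: "f \<in> ghost_coeffs R E x y" and g: "g \<in> ghost_coeffs R E y z"
  shows "f \<otimes>\<^bsub>free_algebra R (arcs E)\<^esub> g \<in> ghost_coeffs R E x z"
proof -
  note c = ghost_coeffs_carrier[OF f] ghost_coeffs_carrier[OF g]
  have "ghost_path E x w z" if "(f \<otimes>\<^bsub>free_algebra R (arcs E)\<^esub> g) w \<noteq> \<zero>" for w
    using c that
    by (rule free_algebra_mult_support)
      (use ghost_path_append[OF ghost_coeffs_path[OF f] ghost_coeffs_path[OF g]] in auto)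
  then show ?thesis
    using free_algebra_mult_closed[OF c] by (simp add: ghost_coeffs_def)
qed

end

text \<open>Elements \<open>P v\<close>, \<open>S e\<close>, \<open>T e\<close> in the roles of \<open>v\<close>, \<open>e\<close>, \<open>e\<^sup>*\<close>.  The sum of the \<open>P v\<close> is an idempotent
  \<open>unit\<close>, in general different from \<open>\<one>\<close>: below, families of several graphs live in corners of the same
  algebra.\<close>

locale leavitt_family = kalgebra K A + E: fin_digraph E
  for K :: "('k, 'c) ring_scheme" and A :: "('k, 'a, 'm) module_scheme" (structure)
    and E :: "('v, 'e) pre_digraph" +
  fixes P :: "'v \<Rightarrow> 'a" and S T :: "'e \<Rightarrow> 'a"
  assumes P_closed [simp]: "v \<in> verts E \<Longrightarrow> P v \<in> carrier A"
    and S_closed [simp]: "e \<in> arcs E \<Longrightarrow> S e \<in> carrier A"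
    and T_closed [simp]: "e \<in> arcs E \<Longrightarrow> T e \<in> carrier A"
    and P_P: "\<lbrakk>v \<in> verts E; w \<in> verts E\<rbrakk> \<Longrightarrow> P v \<otimes> P w = (if v = w then P w else \<zero>)"
    and tail_S [simp]: "e \<in> arcs E \<Longrightarrow> P (tail E e) \<otimes> S e = S e"
    and S_head [simp]: "e \<in> arcs E \<Longrightarrow> S e \<otimes> P (head E e) = S e"
    and head_T [simp]: "e \<in> arcs E \<Longrightarrow> P (head E e) \<otimes> T e = T e"
    and T_tail [simp]: "e \<in> arcs E \<Longrightarrow> T e \<otimes> P (tail E e) = T e"
    and T_S: "\<lbrakk>e \<in> arcs E; f \<in> arcs E\<rbrakk> \<Longrightarrow> T e \<otimes> S f = (if e = f then P (head E e) else \<zero>)"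
    and sum_S_T: "\<lbrakk>v \<in> verts E; out_arcs E v \<noteq> {}\<rbrakk> \<Longrightarrow> P v = (\<Oplus>e\<in>out_arcs E v. S e \<otimes> T e)"
begin

lemma P_S: "\<lbrakk>v \<in> verts E; e \<in> arcs E\<rbrakk> \<Longrightarrow> P v \<otimes> S e = (if v = tail E e then S e else \<zero>)"
  using P_P[of v "tail E e"] m_assoc[of "P v" "P (tail E e)" "S e"] by (auto split: if_splits)

lemma S_P: "\<lbrakk>v \<in> verts E; e \<in> arcs E\<rbrakk> \<Longrightarrow> S e \<otimes> P v = (if v = head E e then S e else \<zero>)"
  using P_P[of "head E e" v] m_assoc[of "S e" "P (head E e)" "P v"] by (auto split: if_splits)

lemma P_T: "\<lbrakk>v \<in> verts E; e \<in> arcs E\<rbrakk> \<Longrightarrow> P v \<otimes> T e = (if v = head E e then T e else \<zero>)"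
  using P_P[of v "head E e"] m_assoc[of "P v" "P (head E e)" "T e"] by (auto split: if_splits)

lemma T_P: "\<lbrakk>v \<in> verts E; e \<in> arcs E\<rbrakk> \<Longrightarrow> T e \<otimes> P v = (if v = tail E e then T e else \<zero>)"
  using P_P[of "tail E e" v] m_assoc[of "T e" "P (tail E e)" "P v"] by (auto split: if_splits)

lemma left_assoc:
  assumes "x \<in> carrier A"
  shows "\<lbrakk>v \<in> verts E; w \<in> verts E\<rbrakk> \<Longrightarrow> P v \<otimes> (P w \<otimes> x) = (if v = w then P w \<otimes> x else \<zero>)"
    and "\<lbrakk>v \<in> verts E; e \<in> arcs E\<rbrakk> \<Longrightarrow> P v \<otimes> (S e \<otimes> x) = (if v = tail E e then S e \<otimes> x else \<zero>)"
    and "\<lbrakk>v \<in> verts E; e \<in> arcs E\<rbrakk> \<Longrightarrow> S e \<otimes> (P v \<otimes> x) = (if v = head E e then S e \<otimes> x else \<zero>)"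
    and "\<lbrakk>v \<in> verts E; e \<in> arcs E\<rbrakk> \<Longrightarrow> P v \<otimes> (T e \<otimes> x) = (if v = head E e then T e \<otimes> x else \<zero>)"
    and "\<lbrakk>v \<in> verts E; e \<in> arcs E\<rbrakk> \<Longrightarrow> T e \<otimes> (P v \<otimes> x) = (if v = tail E e then T e \<otimes> x else \<zero>)"
    and "\<lbrakk>e \<in> arcs E; f \<in> arcs E\<rbrakk> \<Longrightarrow> T e \<otimes> (S f \<otimes> x) = (if e = f then P (head E e) \<otimes> x else \<zero>)"
  using assms by (simp_all add: P_P P_S S_P P_T T_P T_S flip: m_assoc)

lemmas rels = P_P P_S S_P P_T T_P T_S left_assoc

definition unit :: 'a
  where "unit = (\<Oplus>v\<in>verts E. P v)"

lemma unit_closed [simp]: "unit \<in> carrier A"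
  unfolding unit_def by (intro finsum_closed) auto

lemma P_funcset [simp]: "P \<in> verts E \<rightarrow> carrier A" by simp

lemma unit_P [simp]: "v \<in> verts E \<Longrightarrow> unit \<otimes> P v = P v"
proof -
  assume v: "v \<in> verts E"
  have "unit \<otimes> P v = (\<Oplus>w\<in>verts E. P w \<otimes> P v)"
    unfolding unit_def using v by (intro finsum_ldistr) auto
  also have "\<dots> = (\<Oplus>w\<in>verts E. if v = w then P w else \<zero>)"
    using v by (intro finsum_cong') (auto simp: P_P)
  also have "\<dots> = P v" using v by (intro finsum_singleton) auto
  finally show ?thesis .
qed

lemma P_unit [simp]: "v \<in> verts E \<Longrightarrow> P v \<otimes> unit = P v"
proof -
  assume v: "v \<in> verts E"
  have "P v \<otimes> unit = (\<Oplus>w\<in>verts E. P v \<otimes> P w)"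
    unfolding unit_def using v by (intro finsum_rdistr) auto
  also have "\<dots> = (\<Oplus>w\<in>verts E. if v = w then P w else \<zero>)"
    using v by (intro finsum_cong') (auto simp: P_P)
  also have "\<dots> = P v" using v by (intro finsum_singleton) auto
  finally show ?thesis .
qed

lemma unit_S [simp]: "e \<in> arcs E \<Longrightarrow> unit \<otimes> S e = S e"
  using m_assoc[of unit "P (tail E e)" "S e"] by simp

lemma S_unit [simp]: "e \<in> arcs E \<Longrightarrow> S e \<otimes> unit = S e"
  using m_assoc[of "S e" "P (head E e)" unit] by simp

lemma unit_T [simp]: "e \<in> arcs E \<Longrightarrow> unit \<otimes> T e = T e"
  using m_assoc[of unit "P (head E e)" "T e"] by simp

lemma T_unit [simp]: "e \<in> arcs E \<Longrightarrow> T e \<otimes> unit = T e"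
  using m_assoc[of "T e" "P (tail E e)" unit] by simp

lemma unit_unit [simp]: "unit \<otimes> unit = unit"
proof -
  have "unit \<otimes> unit = (\<Oplus>w\<in>verts E. unit \<otimes> P w)"
    by (subst (2) unit_def) (intro finsum_rdistr, auto)
  also have "\<dots> = unit" unfolding unit_def[symmetric]
    by (subst unit_def[of]) (intro finsum_cong', auto)
  finally show ?thesis .
qed

lemma unit_left: "x \<in> carrier A \<Longrightarrow> unit \<otimes> x = (\<Oplus>v\<in>verts E. P v \<otimes> x)"
  unfolding unit_def by (intro finsum_ldistr) auto

lemma unit_right: "x \<in> carrier A \<Longrightarrow> x \<otimes> unit = (\<Oplus>v\<in>verts E. x \<otimes> P v)"
  unfolding unit_def by (intro finsum_rdistr) auto

lemma P_expand:
  assumes "v \<in> verts E" "out_arcs E v \<noteq> {}" "x \<in> carrier A"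
  shows "P v \<otimes> x = (\<Oplus>e\<in>out_arcs E v. S e \<otimes> (T e \<otimes> x))"
proof -
  have f: "finite (out_arcs E v)" by (rule finite_subset[OF _ E.finite_arcs]) auto
  have "P v \<otimes> x = (\<Oplus>e\<in>out_arcs E v. (S e \<otimes> T e) \<otimes> x)"
    using assms f by (subst sum_S_T) (auto intro!: finsum_ldistr)
  also have "\<dots> = (\<Oplus>e\<in>out_arcs E v. S e \<otimes> (T e \<otimes> x))"
    using assms by (intro finsum_cong') (auto simp: m_assoc)
  finally show ?thesis .
qed

lemma finsum_in_subset:
  assumes "\<zero> \<in> N" "\<And>x y. \<lbrakk>x \<in> N; y \<in> N\<rbrakk> \<Longrightarrow> x \<oplus> y \<in> N" "N \<subseteq> carrier A" "f \<in> B \<rightarrow> N"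
  shows "(\<Oplus>i\<in>B. f i) \<in> N"
  using assms(4)
proof (induct B rule: infinite_finite_induct)
  case (insert i B)
  then have "f i \<in> N" "f \<in> B \<rightarrow> carrier A" using assms(3) by auto
  with insert assms show ?case by (auto simp: subset_iff)
qed (use assms in auto)

text \<open>The relation at the regular vertices expands \<open>x = \<Sum>v. P v \<otimes> x\<close> into the elements
  \<open>S e \<otimes> (T e \<otimes> x)\<close> and the \<open>P w \<otimes> x\<close> at sinks \<open>w\<close>.  So \<open>x\<close> is determined by its products
  with the \<open>T e\<close> and with the sinks from the left.\<close>

lemma in_subsetI:
  assumes N: "\<zero> \<in> N" "\<And>x y. \<lbrakk>x \<in> N; y \<in> N\<rbrakk> \<Longrightarrow> x \<oplus> y \<in> N" "N \<subseteq> carrier A"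
    and x: "x \<in> carrier A" "unit \<otimes> x = x"
    and arcs: "\<And>e. e \<in> arcs E \<Longrightarrow> S e \<otimes> (T e \<otimes> x) \<in> N"
    and sinks: "\<And>w. \<lbrakk>w \<in> verts E; out_arcs E w = {}\<rbrakk> \<Longrightarrow> P w \<otimes> x \<in> N"
  shows "x \<in> N"
proof -
  have "P v \<otimes> x \<in> N" if "v \<in> verts E" for v
  proof (cases "out_arcs E v = {}")
    case False
    then show ?thesis
      using finsum_in_subset[OF N, where f = "\<lambda>e. S e \<otimes> (T e \<otimes> x)" and B = "out_arcs E v"] arcs that
      by (subst P_expand[OF _ _ x(1)]) auto
  qed (use sinks that in auto)
  then have "(\<Oplus>v\<in>verts E. P v \<otimes> x) \<in> N"
    by (intro finsum_in_subset[OF N]) auto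
  then show ?thesis using unit_left[OF x(1)] x(2) by simp
qed

lemma eq_zeroI:
  assumes "x \<in> carrier A" "unit \<otimes> x = x"
    and "\<And>e. e \<in> arcs E \<Longrightarrow> T e \<otimes> x = \<zero>"
    and "\<And>w. \<lbrakk>w \<in> verts E; out_arcs E w = {}\<rbrakk> \<Longrightarrow> P w \<otimes> x = \<zero>"
  shows "x = \<zero>"
proof -
  have "x \<in> {\<zero>}" by (rule in_subsetI) (use assms in auto)
  then show ?thesis by simp
qed

inductive_set generated :: "'a set" where
  zero: "\<zero> \<in> generated"
| P: "v \<in> verts E \<Longrightarrow> P v \<in> generated"
| S: "e \<in> arcs E \<Longrightarrow> S e \<in> generated"
| T: "e \<in> arcs E \<Longrightarrow> T e \<in> generated"
| add: "\<lbrakk>x \<in> generated; y \<in> generated\<rbrakk> \<Longrightarrow> x \<oplus> y \<in> generated"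
| smult: "\<lbrakk>a \<in> carrier K; x \<in> generated\<rbrakk> \<Longrightarrow> a \<odot> x \<in> generated"
| mult: "\<lbrakk>x \<in> generated; y \<in> generated\<rbrakk> \<Longrightarrow> x \<otimes> y \<in> generated"

lemma generated_carrier: "x \<in> generated \<Longrightarrow> x \<in> carrier A"
  by (induct rule: generated.induct) auto

lemma generated_unit_left: "x \<in> generated \<Longrightarrow> unit \<otimes> x = x"
  by (induct rule: generated.induct)
    (auto simp: r_distr smult_mult_r generated_carrier simp flip: m_assoc)

lemma generated_unit_right: "x \<in> generated \<Longrightarrow> x \<otimes> unit = x"
  by (induct rule: generated.induct)
    (auto simp: l_distr smult_mult_l generated_carrier m_assoc)

abbreviation eval_ghost :: "('e list \<Rightarrow> 'k) \<Rightarrow> 'a"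
  where "eval_ghost \<equiv> eval_free K A T"

lemma T_funcset: "T \<in> arcs E \<rightarrow> carrier A" by simp

lemmas eval_ghost_closed [simp] = eval_free_closed[OF T_funcset, OF K.ghost_coeffs_carrier]

text \<open>The span of the ghost paths, described through the Peirce components \<open>P x \<otimes> (a \<otimes> P y)\<close>.  In this
  form each component comes with its coefficients.\<close>

definition ghosts :: "'a set"
  where "ghosts = {a \<in> carrier A. unit \<otimes> a = a \<and> a \<otimes> unit = a \<and>
    (\<forall>x\<in>verts E. \<forall>y\<in>verts E. \<exists>f\<in>ghost_coeffs K E x y. P x \<otimes> (a \<otimes> P y) = eval_ghost f \<otimes> P y)}"

text \<open>Linear independence of the ghost paths in the algebra.\<close>

definition faithful :: bool
  where "faithful \<longleftrightarrow> (\<forall>x\<in>verts E. \<forall>y\<in>verts E. \<forall>f\<in>ghost_coeffs K E x y.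
    eval_ghost f \<otimes> P y = \<zero> \<longrightarrow> f = \<zero>\<^bsub>free_algebra K (arcs E)\<^esub>)"

definition full :: bool
  where "full \<longleftrightarrow> (\<forall>x\<in>carrier A. unit \<otimes> (x \<otimes> unit) = x \<longrightarrow> x \<in> generated)"

lemma eval_word_ghost_path:
  assumes "ghost_path E x u y" "z \<in> verts E"
  shows "P z \<otimes> (eval_word A T u \<otimes> P y) = (if z = x then eval_word A T u \<otimes> P y else \<zero>)"
proof -
  have c: "eval_word A T v \<in> carrier A" if "set v \<subseteq> arcs E" for v
    using eval_word_in_carrier[OF T_funcset] that by simp
  show ?thesis
    using assms(1)
  proof (cases rule: ghost_path.cases)
    case Nil
    then show ?thesis using assms(2) by (simp add: rels)
  next
    case (Cons e v)
    then have "set v \<subseteq> arcs E" "y \<in> verts E" using ghost_path_arcs ghost_path_end by fast+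
    then show ?thesis using Cons c[of v] assms(2) by (simp add: rels m_assoc)
  qed
qed

lemma P_eval_ghost:
  assumes f: "f \<in> ghost_coeffs K E x y" and z: "z \<in> verts E" and y: "y \<in> verts E"
  shows "P z \<otimes> (eval_ghost f \<otimes> P y) = (if z = x then eval_ghost f \<otimes> P y else \<zero>)"
  using K.ghost_coeffs_carrier[OF f]
proof (induct rule: K.free_algebra_support_induct[where N = "\<lambda>w. ghost_path E x w y"])
  case (support w)
  then show ?case using K.ghost_coeffs_path[OF f] by blast
next
  case zero
  then show ?case using z y by (simp add: eval_free_zero[OF T_funcset])
next
  case (add a u g)
  note c = eval_free_closed[OF T_funcset] eval_word_in_carrier[OF T_funcset] K.word_closed
    K.free_algebra_smult_closed
  show ?case
    using add z y eval_word_ghost_path[OF add(3) z]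
    by (simp add: c eval_free_add[OF T_funcset] eval_free_smult[OF T_funcset]
        eval_free_word1[OF T_funcset] l_distr r_distr smult_mult_l smult_mult_r)
qed

lemma ghostsI:
  assumes "a \<in> carrier A" "unit \<otimes> a = a" "a \<otimes> unit = a"
    and "\<And>x y. \<lbrakk>x \<in> verts E; y \<in> verts E\<rbrakk>
      \<Longrightarrow> \<exists>f\<in>ghost_coeffs K E x y. P x \<otimes> (a \<otimes> P y) = eval_ghost f \<otimes> P y"
  shows "a \<in> ghosts"
  using assms unfolding ghosts_def by blast

lemma ghostsE:
  assumes "a \<in> ghosts" "x \<in> verts E" "y \<in> verts E"
  obtains f where "f \<in> ghost_coeffs K E x y" "P x \<otimes> (a \<otimes> P y) = eval_ghost f \<otimes> P y"
  using assms unfolding ghosts_def by blast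

lemma ghosts_carrier: "a \<in> ghosts \<Longrightarrow> a \<in> carrier A"
  and ghosts_unit_left: "a \<in> ghosts \<Longrightarrow> unit \<otimes> a = a"
  and ghosts_unit_right: "a \<in> ghosts \<Longrightarrow> a \<otimes> unit = a"
  by (auto simp: ghosts_def)

lemma ghosts_zero: "\<zero> \<in> ghosts"
  by (rule ghostsI) (auto simp: eval_free_zero[OF T_funcset] intro!: bexI[OF _ K.ghost_coeffs_zero])

lemma ghosts_add:
  assumes a: "a \<in> ghosts" and b: "b \<in> ghosts"
  shows "a \<oplus> b \<in> ghosts"
proof (rule ghostsI)
  note c = ghosts_carrier[OF a] ghosts_carrier[OF b]
  fix x y assume xy: "x \<in> verts E" "y \<in> verts E"
  from ghostsE[OF a xy] ghostsE[OF b xy] obtain f g where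
    f: "f \<in> ghost_coeffs K E x y" "P x \<otimes> (a \<otimes> P y) = eval_ghost f \<otimes> P y" and
    g: "g \<in> ghost_coeffs K E x y" "P x \<otimes> (b \<otimes> P y) = eval_ghost g \<otimes> P y" by metis
  show "\<exists>f\<in>ghost_coeffs K E x y. P x \<otimes> ((a \<oplus> b) \<otimes> P y) = eval_ghost f \<otimes> P y"
    using f g xy c
    by (intro bexI[OF _ K.ghost_coeffs_add[OF f(1) g(1)]])
      (simp add: l_distr r_distr eval_free_add[OF T_funcset] K.ghost_coeffs_carrier)
qed (use assms in \<open>auto simp: ghosts_carrier ghosts_unit_left ghosts_unit_right l_distr r_distr\<close>)

lemma ghosts_smult:
  assumes k: "k \<in> carrier K" and a: "a \<in> ghosts"
  shows "k \<odot> a \<in> ghosts"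
proof (rule ghostsI)
  note c = ghosts_carrier[OF a]
  fix x y assume xy: "x \<in> verts E" "y \<in> verts E"
  from ghostsE[OF a xy] obtain f where
    f: "f \<in> ghost_coeffs K E x y" "P x \<otimes> (a \<otimes> P y) = eval_ghost f \<otimes> P y" by metis
  show "\<exists>f\<in>ghost_coeffs K E x y. P x \<otimes> ((k \<odot> a) \<otimes> P y) = eval_ghost f \<otimes> P y"
    using f xy c k
    by (intro bexI[OF _ K.ghost_coeffs_smult[OF k f(1)]])
      (simp add: smult_mult_l smult_mult_r eval_free_smult[OF T_funcset] K.ghost_coeffs_carrier)
qed (use assms in \<open>auto simp: ghosts_carrier ghosts_unit_left ghosts_unit_right smult_mult_l smult_mult_r\<close>)

lemma ghosts_T:
  assumes e: "e \<in> arcs E" and a: "a \<in> ghosts"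
  shows "T e \<otimes> a \<in> ghosts"
proof (rule ghostsI)
  note c = ghosts_carrier[OF a]
  fix x y assume xy: "x \<in> verts E" "y \<in> verts E"
  from ghostsE[OF a E.tail_in_verts[OF e] xy(2)] obtain f where
    f: "f \<in> ghost_coeffs K E (tail E e) y" "P (tail E e) \<otimes> (a \<otimes> P y) = eval_ghost f \<otimes> P y" by metis
  show "\<exists>f\<in>ghost_coeffs K E x y. P x \<otimes> ((T e \<otimes> a) \<otimes> P y) = eval_ghost f \<otimes> P y"
  proof (cases "x = head E e")
    case True
    have w: "word K [e] \<in> ghost_coeffs K E x (tail E e)"
      using True e by (intro K.ghost_coeffs_word) auto
    have "P x \<otimes> ((T e \<otimes> a) \<otimes> P y) = T e \<otimes> (P (tail E e) \<otimes> (a \<otimes> P y))"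
      using True e c xy by (simp add: m_assoc rels)
    also have "\<dots> = eval_ghost (word K [e] \<otimes>\<^bsub>free_algebra K (arcs E)\<^esub> f) \<otimes> P y"
      using f e xy w by (simp add: eval_free_mult[OF T_funcset] K.ghost_coeffs_carrier
          eval_free_word1[OF T_funcset] m_assoc)
    finally show ?thesis using K.ghost_coeffs_mult[OF w f(1)] by blast
  next
    case False
    then show ?thesis using e c xy
      by (intro bexI[OF _ K.ghost_coeffs_zero]) (simp add: m_assoc rels eval_free_zero[OF T_funcset])
  qed
qed (use assms in \<open>auto simp: ghosts_carrier ghosts_unit_left ghosts_unit_right m_assoc,
    simp add: ghosts_carrier flip: m_assoc\<close>)

lemma ghosts_P:
  assumes v: "v \<in> verts E" and a: "a \<in> ghosts"
  shows "P v \<otimes> a \<in> ghosts"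
proof (rule ghostsI)
  note c = ghosts_carrier[OF a]
  fix x y assume xy: "x \<in> verts E" "y \<in> verts E"
  from ghostsE[OF a xy] obtain f where
    f: "f \<in> ghost_coeffs K E x y" "P x \<otimes> (a \<otimes> P y) = eval_ghost f \<otimes> P y" by metis
  show "\<exists>f\<in>ghost_coeffs K E x y. P x \<otimes> ((P v \<otimes> a) \<otimes> P y) = eval_ghost f \<otimes> P y"
  proof (cases "x = v")
    case True
    then show ?thesis using f xy c v P_eval_ghost[OF f(1) v xy(2)]
      by (intro bexI[OF _ f(1)]) (simp add: m_assoc)
  next
    case False
    then show ?thesis using c xy v
      by (intro bexI[OF _ K.ghost_coeffs_zero]) (simp add: m_assoc rels eval_free_zero[OF T_funcset])
  qed
qed (use assms in \<open>auto simp: ghosts_carrier ghosts_unit_left ghosts_unit_right m_assoc,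
    simp add: ghosts_carrier flip: m_assoc\<close>)

lemma unit_ghost: "unit \<in> ghosts"
proof (rule ghostsI)
  fix x y assume xy: "x \<in> verts E" "y \<in> verts E"
  show "\<exists>f\<in>ghost_coeffs K E x y. P x \<otimes> (unit \<otimes> P y) = eval_ghost f \<otimes> P y"
  proof (cases "x = y")
    case True
    have "word K [] \<in> ghost_coeffs K E x y"
      using True xy by (intro K.ghost_coeffs_word) auto
    then show ?thesis using xy True
      by (intro bexI[of _ "word K []"]) (auto simp: P_P eval_free_word1[OF T_funcset])
  next
    case False
    then show ?thesis using xy
      by (intro bexI[OF _ K.ghost_coeffs_zero]) (simp add: P_P eval_free_zero[OF T_funcset])
  qed
qed auto

text \<open>An element lies in \<open>reducible n\<close> if its products \<open>p\<^sup>* x\<close> are combinations of ghost paths for all paths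
  \<open>p\<close> of length \<open>n\<close> and all shorter paths \<open>p\<close> that end at a sink.\<close>

primrec reducible :: "nat \<Rightarrow> 'a set" where
  "reducible 0 = ghosts"
| "reducible (Suc n) = {x \<in> carrier A. unit \<otimes> x = x \<and> (\<forall>e\<in>arcs E. T e \<otimes> x \<in> reducible n) \<and>
    (\<forall>w\<in>verts E. out_arcs E w = {} \<longrightarrow> P w \<otimes> x \<in> ghosts)}"

lemma reducible_carrier: "x \<in> reducible n \<Longrightarrow> x \<in> carrier A"
  by (cases n) (simp_all add: ghosts_carrier)

lemma reducible_zero: "\<zero> \<in> reducible n"
  by (induct n) (auto simp: ghosts_zero)

lemma reducible_add: "\<lbrakk>x \<in> reducible n; y \<in> reducible n\<rbrakk> \<Longrightarrow> x \<oplus> y \<in> reducible n"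
  by (induct n arbitrary: x y) (auto simp: ghosts_add r_distr)

lemma reducible_smult: "\<lbrakk>k \<in> carrier K; x \<in> reducible n\<rbrakk> \<Longrightarrow> k \<odot> x \<in> reducible n"
  by (induct n arbitrary: x) (auto simp: ghosts_smult smult_mult_r)

lemma reducible_Suc: "x \<in> reducible n \<Longrightarrow> x \<in> reducible (Suc n)"
  by (induct n arbitrary: x)
    (auto simp: ghosts_carrier ghosts_unit_left ghosts_T ghosts_P)

lemma reducible_mono: "\<lbrakk>m \<le> n; x \<in> reducible m\<rbrakk> \<Longrightarrow> x \<in> reducible n"
  by (induct rule: dec_induct) (auto simp del: reducible.simps intro: reducible_Suc)

lemma reducible_P: "\<lbrakk>v \<in> verts E; x \<in> reducible n\<rbrakk> \<Longrightarrow> P v \<otimes> x \<in> reducible n"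
proof (induct n)
  case (Suc n)
  then have x: "x \<in> carrier A" by simp
  have "unit \<otimes> (P v \<otimes> x) = P v \<otimes> x" using x Suc(2) by (simp flip: m_assoc)
  then show ?case using Suc x by (auto simp: rels reducible_zero ghosts_zero)
qed (simp add: ghosts_P)

lemma reducible_S: "\<lbrakk>e \<in> arcs E; x \<in> reducible n\<rbrakk> \<Longrightarrow> S e \<otimes> x \<in> reducible (Suc n)"
proof -
  assume e: "e \<in> arcs E" and x: "x \<in> reducible n"
  have c: "x \<in> carrier A" using x by (rule reducible_carrier)
  have "P w \<otimes> (S e \<otimes> x) = \<zero>" if "w \<in> verts E" "out_arcs E w = {}" for w
    using that e c by (auto simp: rels)
  moreover have "unit \<otimes> (S e \<otimes> x) = S e \<otimes> x" using e c by (simp flip: m_assoc)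
  ultimately show ?thesis
    using e x c by (auto simp: rels reducible_zero reducible_P ghosts_zero)
qed

lemma reducible_T: "\<lbrakk>e \<in> arcs E; x \<in> reducible n\<rbrakk> \<Longrightarrow> T e \<otimes> x \<in> reducible n"
proof (cases n)
  case 0
  then show "\<lbrakk>e \<in> arcs E; x \<in> reducible n\<rbrakk> \<Longrightarrow> T e \<otimes> x \<in> reducible n" by (simp add: ghosts_T)
next
  case (Suc m)
  assume "e \<in> arcs E" "x \<in> reducible n"
  then have "T e \<otimes> x \<in> reducible m" using Suc by simp
  then show "T e \<otimes> x \<in> reducible n" unfolding Suc by (rule reducible_Suc)
qed

text \<open>Left multiplication by \<open>S e\<close> raises the level by one at most, since \<open>T e\<close> cancels it; the other
  generators do not raise the level.\<close>

lemma generated_reducible: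
  assumes "x \<in> generated" "y \<in> reducible m"
  shows "\<exists>n. x \<otimes> y \<in> reducible n"
  using assms
proof (induct arbitrary: y m rule: generated.induct)
  case zero
  then show ?case using reducible_zero reducible_carrier by auto
next
  case (P v)
  then show ?case using reducible_P by blast
next
  case (S e)
  then show ?case using reducible_S by blast
next
  case (T e)
  then show ?case using reducible_T by blast
next
  case (add x x')
  from add(2,4)[OF add(5)] obtain n n' where "x \<otimes> y \<in> reducible n" "x' \<otimes> y \<in> reducible n'" by blast
  then have "x \<otimes> y \<in> reducible (max n n')" "x' \<otimes> y \<in> reducible (max n n')"
    using reducible_mono[OF max.cobounded1] reducible_mono[OF max.cobounded2] by blast+
  then have "(x \<oplus> x') \<otimes> y \<in> reducible (max n n')"
    using reducible_add add generated_carrier reducible_carrier by (simp add: l_distr)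
  then show ?case ..
next
  case (smult a x)
  from smult(3)[OF smult(4)] obtain n where "x \<otimes> y \<in> reducible n" by blast
  then have "(a \<odot> x) \<otimes> y \<in> reducible n"
    using smult generated_carrier reducible_carrier[OF smult(4)] reducible_smult by (simp add: smult_mult_l)
  then show ?case ..
next
  case (mult x x')
  from mult(4)[OF mult(5)] obtain n where n: "x' \<otimes> y \<in> reducible n" by blast
  from mult(2)[OF n] show ?case
    using mult generated_carrier reducible_carrier[OF mult(5)] by (simp add: m_assoc)
qed

lemma generated_imp_reducible:
  assumes "x \<in> generated"
  shows "\<exists>n. x \<in> reducible n"
  using generated_reducible[OF assms, of unit 0] generated_unit_right[OF assms] unit_ghost by simp

end


section \<open>Corners and homomorphisms\<close>

definition corner :: "('k, 'a, 'm) module_scheme \<Rightarrow> 'a \<Rightarrow> ('k, 'a, 'm) module_scheme"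
  where "corner A p = A\<lparr>carrier := {x \<in> carrier A. p \<otimes>\<^bsub>A\<^esub> (x \<otimes>\<^bsub>A\<^esub> p) = x}, one := p\<rparr>"

lemma corner_simps [simp]:
  "mult (corner A p) = mult A" "add (corner A p) = add A" "zero (corner A p) = zero A"
  "one (corner A p) = p" "smult (corner A p) = smult A"
  "carrier (corner A p) = {x \<in> carrier A. p \<otimes>\<^bsub>A\<^esub> (x \<otimes>\<^bsub>A\<^esub> p) = x}"
  by (simp_all add: corner_def)

lemma (in kalgebra) corner_iff:
  assumes "p \<in> carrier A" "p \<otimes> p = p" "x \<in> carrier A"
  shows "p \<otimes> (x \<otimes> p) = x \<longleftrightarrow> p \<otimes> x = x \<and> x \<otimes> p = x"
proof
  assume *: "p \<otimes> (x \<otimes> p) = x"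
  have "p \<otimes> (p \<otimes> (x \<otimes> p)) = p \<otimes> (x \<otimes> p)" "(p \<otimes> (x \<otimes> p)) \<otimes> p = p \<otimes> (x \<otimes> p)"
    using assms by (simp flip: m_assoc) (simp add: assms m_assoc)
  then show "p \<otimes> x = x \<and> x \<otimes> p = x" using * by simp
qed simp

lemma (in kalgebra) kalgebra_corner:
  assumes p: "p \<in> carrier A" "p \<otimes> p = p"
  shows "kalgebra K (corner A p)"
proof (intro kalgebra.intro ringI kalgebra_axioms.intro)
  show "field K" by (rule K.field_axioms)
  show "abelian_group (corner A p)"
  proof (rule abelian_groupI)
    fix x assume "x \<in> carrier (corner A p)"
    then show "\<exists>y\<in>carrier (corner A p). y \<oplus>\<^bsub>corner A p\<^esub> x = \<zero>\<^bsub>corner A p\<^esub>"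
      using p by (intro bexI[of _ "\<ominus> x"]) (auto simp: l_neg l_minus r_minus)
  qed (use p in \<open>auto simp: l_distr r_distr a_ac\<close>)
  show "Group.monoid (corner A p)"
    using p by (intro monoidI) (auto simp: corner_iff m_assoc, simp flip: m_assoc)
qed (use p in \<open>auto simp: l_distr r_distr smult_l_distr smult_r_distr smult_assoc1 smult_mult_l smult_mult_r\<close>)

lemma (in abelian_group) eq_if_minus_zero:
  "\<lbrakk>x \<ominus> y = \<zero>; x \<in> carrier G; y \<in> carrier G\<rbrakk> \<Longrightarrow> x = y"
  using minus_equality[of x "\<ominus> y"] by (simp add: minus_eq)

lemma additive_finsum:
  assumes "abelian_group A" "abelian_group B"
    and h: "\<And>x. x \<in> carrier A \<Longrightarrow> h x \<in> carrier B"
      "\<And>x y. \<lbrakk>x \<in> carrier A; y \<in> carrier A\<rbrakk> \<Longrightarrow> h (x \<oplus>\<^bsub>A\<^esub> y) = h x \<oplus>\<^bsub>B\<^esub> h y"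
    and f: "f \<in> I \<rightarrow> carrier A"
  shows "h (\<Oplus>\<^bsub>A\<^esub>i\<in>I. f i) = (\<Oplus>\<^bsub>B\<^esub>i\<in>I. h (f i))"
proof -
  interpret A: abelian_group A by fact
  interpret B: abelian_group B by fact
  have zero: "h \<zero>\<^bsub>A\<^esub> = \<zero>\<^bsub>B\<^esub>"
    by (metis A.l_zero A.zero_closed B.add.l_cancel_one' h)
  show ?thesis using f
  proof (induct I rule: infinite_finite_induct)
    case (insert i I)
    then have "f i \<in> carrier A" "f \<in> I \<rightarrow> carrier A" "(\<lambda>i. h (f i)) \<in> I \<rightarrow> carrier B"
      using h(1) by auto
    with insert show ?case using h by simp
  qed (simp_all add: zero)
qed

lemma (in kalgebra) corner_finsum:
  assumes p: "p \<in> carrier A" "p \<otimes> p = p" and f: "f \<in> I \<rightarrow> carrier (corner A p)"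
  shows "(\<Oplus>\<^bsub>corner A p\<^esub>i\<in>I. f i) = (\<Oplus>i\<in>I. f i)"
proof -
  interpret C: kalgebra K "corner A p" using p by (rule kalgebra_corner)
  show ?thesis
    using additive_finsum[OF C.is_abelian_group is_abelian_group _ _ f, of "\<lambda>x. x"] by simp
qed

definition nonunital_hom ::
  "('k, 'c) ring_scheme \<Rightarrow> ('k, 'a, 'm) module_scheme \<Rightarrow> ('k, 'b, 'n) module_scheme \<Rightarrow> ('a \<Rightarrow> 'b) \<Rightarrow> bool"
  where "nonunital_hom K A B h \<longleftrightarrow> (\<forall>x\<in>carrier A. h x \<in> carrier B) \<and>
    (\<forall>x\<in>carrier A. \<forall>y\<in>carrier A. h (x \<oplus>\<^bsub>A\<^esub> y) = h x \<oplus>\<^bsub>B\<^esub> h y) \<and>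
    (\<forall>x\<in>carrier A. \<forall>y\<in>carrier A. h (x \<otimes>\<^bsub>A\<^esub> y) = h x \<otimes>\<^bsub>B\<^esub> h y) \<and>
    (\<forall>a\<in>carrier K. \<forall>x\<in>carrier A. h (a \<odot>\<^bsub>A\<^esub> x) = a \<odot>\<^bsub>B\<^esub> h x)"

lemma nonunital_homD:
  assumes "nonunital_hom K A B h"
  shows "x \<in> carrier A \<Longrightarrow> h x \<in> carrier B"
    and "\<lbrakk>x \<in> carrier A; y \<in> carrier A\<rbrakk> \<Longrightarrow> h (x \<oplus>\<^bsub>A\<^esub> y) = h x \<oplus>\<^bsub>B\<^esub> h y"
    and "\<lbrakk>x \<in> carrier A; y \<in> carrier A\<rbrakk> \<Longrightarrow> h (x \<otimes>\<^bsub>A\<^esub> y) = h x \<otimes>\<^bsub>B\<^esub> h y"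
    and "\<lbrakk>a \<in> carrier K; x \<in> carrier A\<rbrakk> \<Longrightarrow> h (a \<odot>\<^bsub>A\<^esub> x) = a \<odot>\<^bsub>B\<^esub> h x"
  using assms by (auto simp: nonunital_hom_def)

lemma nonunital_hom_zero:
  assumes "kalgebra K A" "kalgebra K B" "nonunital_hom K A B h"
  shows "h \<zero>\<^bsub>A\<^esub> = \<zero>\<^bsub>B\<^esub>"
proof -
  interpret A: kalgebra K A by fact
  interpret B: kalgebra K B by fact
  show ?thesis
    by (metis A.l_zero A.zero_closed B.add.l_cancel_one' nonunital_homD(1,2)[OF assms(3)])
qed

lemma nonunital_hom_finsum:
  assumes "kalgebra K A" "kalgebra K B" "nonunital_hom K A B h" "f \<in> I \<rightarrow> carrier A"
  shows "h (\<Oplus>\<^bsub>A\<^esub>i\<in>I. f i) = (\<Oplus>\<^bsub>B\<^esub>i\<in>I. h (f i))"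
proof -
  interpret A: kalgebra K A by fact
  interpret B: kalgebra K B by fact
  show ?thesis
    using assms(3,4)
    by (intro additive_finsum A.is_abelian_group B.is_abelian_group) (auto dest: nonunital_homD)
qed

lemma nonunital_hom_eval_free:
  assumes A: "kalgebra K A" and B: "kalgebra K B" and h: "nonunital_hom K A B h"
    and f: "f \<in> carrier (free_algebra K X)" and val: "val \<in> X \<rightarrow> carrier A" and p: "p \<in> carrier A"
  shows "h (eval_free K A val f \<otimes>\<^bsub>A\<^esub> p) = eval_free K B (h \<circ> val) f \<otimes>\<^bsub>B\<^esub> h p"
proof -
  interpret A: kalgebra K A by fact
  interpret B: kalgebra K B by fact
  note h = nonunital_homD[OF h] nonunital_hom_zero[OF A B h]
  define v where "v = h \<circ> val"
  have v: "v x = h (val x)" for x by (simp add: v_def)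
  have val': "v \<in> X \<rightarrow> carrier B" using val h(1) by (simp add: Pi_iff v)
  have w: "h (eval_word A val u \<otimes>\<^bsub>A\<^esub> p) = eval_word B v u \<otimes>\<^bsub>B\<^esub> h p" if "set u \<subseteq> X" for u
    using that
  proof (induct u)
    case (Cons x u)
    then have "val x \<in> carrier A" "eval_word A val u \<in> carrier A" "eval_word B v u \<in> carrier B"
      using val A.eval_word_in_carrier[OF val] B.eval_word_in_carrier[OF val'] by auto
    with Cons p show ?case by (simp add: A.m_assoc B.m_assoc h v[of x])
  qed (use p h in simp)
  show ?thesis unfolding v_def[symmetric] using f
  proof (induct rule: A.K.free_algebra_induct)
    case zero
    show ?case
      using p by (simp add: A.eval_free_zero[OF val] B.eval_free_zero[OF val'] h)
  next
    case (add a u g)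
    note c = A.eval_free_closed[OF val] A.eval_word_in_carrier[OF val] A.K.word_closed
      A.K.free_algebra_smult_closed B.eval_free_closed[OF val'] B.eval_word_in_carrier[OF val']
    from add p w[OF add(2)] show ?case
      by (simp add: c h A.eval_free_add[OF val] A.eval_free_smult[OF val] A.eval_free_word1[OF val]
          B.eval_free_add[OF val'] B.eval_free_smult[OF val'] B.eval_free_word1[OF val']
          A.l_distr A.smult_mult_l B.l_distr B.smult_mult_l)
  qed
qed

lemma (in leavitt_family) family_corner_unit: "leavitt_family K (corner A unit) E P S T"
proof -
  interpret C: kalgebra K "corner A unit" by (rule kalgebra_corner) auto
  show ?thesis
  proof unfold_locales
    fix v assume v: "v \<in> verts E" "out_arcs E v \<noteq> {}"
    have "P v = (\<Oplus>e\<in>out_arcs E v. S e \<otimes> T e)" using v by (rule sum_S_T)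
    also have "\<dots> = (\<Oplus>\<^bsub>corner A unit\<^esub>e\<in>out_arcs E v. S e \<otimes> T e)"
      by (intro corner_finsum[symmetric]) (auto simp: m_assoc, simp flip: m_assoc)
    finally show "P v = (\<Oplus>\<^bsub>corner A unit\<^esub>e\<in>out_arcs E v. S e \<otimes>\<^bsub>corner A unit\<^esub> T e)" by simp
  qed (auto simp: P_P T_S)
qed


section \<open>The Leavitt path algebra as an algebra\<close>

locale leavitt_presentation = K: field K + E: fin_digraph E
  for K :: "('k, 'c) ring_scheme" and E :: "('v, 'e) pre_digraph"
begin

abbreviation F where "F \<equiv> path_free_algebra K E"
abbreviation I where "I \<equiv> leavitt_ideal K E"

sublocale F: kalgebra K F
  by (rule K.free_algebra_kalgebra)

lemma word_closed [simp]: "set u \<subseteq> generators E \<Longrightarrow> word K u \<in> carrier F"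
  by (rule K.word_closed)

lemma generators_simps [simp]:
  "Vertex v \<in> generators E \<longleftrightarrow> v \<in> verts E"
  "Edge e \<in> generators E \<longleftrightarrow> e \<in> arcs E"
  "Ghost e \<in> generators E \<longleftrightarrow> e \<in> arcs E"
  by (auto simp: generators_def)

lemma finsum_words_closed: "(\<Oplus>\<^bsub>F\<^esub>e\<in>out_arcs E v. word K [Edge e, Ghost e]) \<in> carrier F"
  by (intro F.finsum_closed) auto

lemma leavitt_relations_carrier: "leavitt_relations K E \<subseteq> carrier F"
  unfolding leavitt_relations_def Let_def
  using finsum_words_closed by (auto intro!: F.minus_closed)

sublocale I: ideal I F
  unfolding leavitt_ideal_def using leavitt_relations_carrier by (rule F.genideal_ideal)

definition coset :: "(('v, 'e) generator list \<Rightarrow> 'k) \<Rightarrow> (('v, 'e) generator list \<Rightarrow> 'k) set"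
  where "coset x = I +>\<^bsub>F\<^esub> x"

lemma coset_eq_iff:
  "\<lbrakk>x \<in> carrier F; y \<in> carrier F\<rbrakk> \<Longrightarrow> coset x = coset y \<longleftrightarrow> x \<ominus>\<^bsub>F\<^esub> y \<in> I"
  unfolding coset_def using F.quotient_eq_iff_same_a_r_cos[OF I.ideal_axioms] by blast

lemma coset_relation:
  assumes "x \<ominus>\<^bsub>F\<^esub> y \<in> leavitt_relations K E" "x \<in> carrier F" "y \<in> carrier F"
  shows "coset x = coset y"
proof -
  have "x \<ominus>\<^bsub>F\<^esub> y \<in> I"
    using F.genideal_self[OF leavitt_relations_carrier] assms(1) unfolding leavitt_ideal_def by blast
  then show ?thesis using assms coset_eq_iff by simp
qed

text \<open>The quotient of the whole free algebra.  The Leavitt path algebra is its corner at the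
  sum of the vertices.\<close>

definition U :: "('k, (('v, 'e) generator list \<Rightarrow> 'k) set) module"
  where "U = \<lparr>carrier = a_rcosets\<^bsub>F\<^esub> I, mult = rcoset_mult F I, one = I +>\<^bsub>F\<^esub> \<one>\<^bsub>F\<^esub>, zero = I,
    add = set_add F, smult = (\<lambda>a A. \<Union>x\<in>A. I +>\<^bsub>F\<^esub> (a \<odot>\<^bsub>F\<^esub> x))\<rparr>"

lemma carrier_U: "carrier U = coset ` carrier F"
  by (auto simp: U_def coset_def A_RCOSETS_def' )

lemma zero_U: "\<zero>\<^bsub>U\<^esub> = coset \<zero>\<^bsub>F\<^esub>"
  unfolding coset_def using I.a_rcos_const[OF I.zero_closed] by (simp add: U_def)

lemma add_U: "\<lbrakk>x \<in> carrier F; y \<in> carrier F\<rbrakk> \<Longrightarrow> coset x \<oplus>\<^bsub>U\<^esub> coset y = coset (x \<oplus>\<^bsub>F\<^esub> y)"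
  by (simp add: U_def coset_def I.a_rcos_sum)

lemma mult_U: "\<lbrakk>x \<in> carrier F; y \<in> carrier F\<rbrakk> \<Longrightarrow> coset x \<otimes>\<^bsub>U\<^esub> coset y = coset (x \<otimes>\<^bsub>F\<^esub> y)"
  by (simp add: U_def coset_def I.rcoset_mult_add)

lemma smult_U:
  assumes a: "a \<in> carrier K" and x: "x \<in> carrier F"
  shows "a \<odot>\<^bsub>U\<^esub> coset x = coset (a \<odot>\<^bsub>F\<^esub> x)"
proof -
  have "coset (a \<odot>\<^bsub>F\<^esub> y) = coset (a \<odot>\<^bsub>F\<^esub> x)" if y: "y \<in> coset x" for y
  proof -
    have yc: "y \<in> carrier F" using y x unfolding coset_def by (rule I.a_elemrcos_carrier[rotated])
    then have "y \<ominus>\<^bsub>F\<^esub> x \<in> I"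
      using y x unfolding coset_def by (simp add: I.a_rcos_module_minus F.ring_axioms)
    then have "(a \<odot>\<^bsub>F\<^esub> \<one>\<^bsub>F\<^esub>) \<otimes>\<^bsub>F\<^esub> (y \<ominus>\<^bsub>F\<^esub> x) \<in> I"
      using a by (intro I.I_l_closed) auto
    also have "(a \<odot>\<^bsub>F\<^esub> \<one>\<^bsub>F\<^esub>) \<otimes>\<^bsub>F\<^esub> (y \<ominus>\<^bsub>F\<^esub> x) = a \<odot>\<^bsub>F\<^esub> y \<ominus>\<^bsub>F\<^esub> a \<odot>\<^bsub>F\<^esub> x"
      using a x yc
      by (simp add: F.minus_eq F.r_distr F.smult_mult_l F.r_minus)
    finally show ?thesis using a x yc by (simp add: coset_eq_iff)
  qed
  moreover have "x \<in> coset x" unfolding coset_def using x by (rule I.a_rcos_self)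
  ultimately have "(\<Union>y\<in>coset x. coset (a \<odot>\<^bsub>F\<^esub> y)) = coset (a \<odot>\<^bsub>F\<^esub> x)" by blast
  then show ?thesis by (simp add: U_def coset_def)
qed

lemma U_ring: "ring U"
proof -
  interpret Q: ring "F Quot I" by (rule I.quotient_is_ring)
  have eq: "carrier U = carrier (F Quot I)" "mult U = mult (F Quot I)" "one U = one (F Quot I)"
    "zero U = zero (F Quot I)" "add U = add (F Quot I)"
    by (simp_all add: U_def FactRing_def)
  have "abelian_group U"
    by (rule abelian_groupI; unfold eq) (use Q.l_neg in \<open>auto simp: Q.a_ac\<close>)
  moreover have "Group.monoid U"
    by (rule monoidI; unfold eq) (auto simp: Q.m_assoc)
  ultimately show ?thesis
    by (rule ringI; unfold eq) (auto simp: Q.l_distr Q.r_distr)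
qed

sublocale U: kalgebra K U
proof (intro kalgebra.intro kalgebra_axioms.intro U_ring)
  show "field K" by (rule K.field_axioms)
qed (auto simp: carrier_U smult_U add_U mult_U F.smult_l_distr F.smult_r_distr F.smult_assoc1
    F.smult_mult_l F.smult_mult_r)

lemma coset_closed [simp]: "x \<in> carrier F \<Longrightarrow> coset x \<in> carrier U"
  by (simp add: carrier_U)

lemma coset_hom: "nonunital_hom K F U coset"
  by (auto simp: nonunital_hom_def add_U mult_U smult_U)

lemma coset_word_mult:
  "\<lbrakk>set u \<subseteq> generators E; set v \<subseteq> generators E\<rbrakk>
    \<Longrightarrow> coset (word K u) \<otimes>\<^bsub>U\<^esub> coset (word K v) = coset (word K (u @ v))"
  by (simp add: mult_U K.word_mult_word)

definition LV where "LV v = coset (word K [Vertex v])"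
definition LE where "LE e = coset (word K [Edge e])"
definition LG where "LG e = coset (word K [Ghost e])"

sublocale U: leavitt_family K U E LV LE LG
proof unfold_locales
  note coset_rel = coset_relation[unfolded leavitt_relations_def Let_def]
  have two: "coset (word K [x]) \<otimes>\<^bsub>U\<^esub> coset (word K [y]) = coset (word K [x, y])"
    if "x \<in> generators E" "y \<in> generators E" for x y
    using that coset_word_mult[of "[x]" "[y]"] by simp
  fix v w e f assume v: "v \<in> verts E"
  {
    assume w: "w \<in> verts E"
    have "coset (word K [Vertex v, Vertex w]) = coset (if v = w then word K [Vertex w] else \<zero>\<^bsub>F\<^esub>)"
      using v w by (intro coset_rel) auto
    then show "LV v \<otimes>\<^bsub>U\<^esub> LV w = (if v = w then LV w else \<zero>\<^bsub>U\<^esub>)"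
      using v w by (auto simp: LV_def two zero_U)
  }
  assume ne: "out_arcs E v \<noteq> {}"
  have "coset (word K [Vertex v]) = coset (\<Oplus>\<^bsub>F\<^esub>e\<in>out_arcs E v. word K [Edge e, Ghost e])"
    using v ne finsum_words_closed by (intro coset_rel) auto
  also have "\<dots> = (\<Oplus>\<^bsub>U\<^esub>e\<in>out_arcs E v. coset (word K [Edge e, Ghost e]))"
    by (intro nonunital_hom_finsum[OF F.kalgebra_axioms U.kalgebra_axioms coset_hom]) auto
  also have "\<dots> = (\<Oplus>\<^bsub>U\<^esub>e\<in>out_arcs E v. LE e \<otimes>\<^bsub>U\<^esub> LG e)"
    by (intro U.finsum_cong') (auto simp: LE_def LG_def two intro!: U.m_closed)
  finally show "LV v = (\<Oplus>\<^bsub>U\<^esub>e\<in>out_arcs E v. LE e \<otimes>\<^bsub>U\<^esub> LG e)" by (simp add: LV_def)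
next
  note coset_rel = coset_relation[unfolded leavitt_relations_def Let_def]
  have two: "coset (word K [x]) \<otimes>\<^bsub>U\<^esub> coset (word K [y]) = coset (word K [x, y])"
    if "x \<in> generators E" "y \<in> generators E" for x y
    using that coset_word_mult[of "[x]" "[y]"] by simp
  fix e f assume e: "e \<in> arcs E"
  show "LV (tail E e) \<otimes>\<^bsub>U\<^esub> LE e = LE e" unfolding LV_def LE_def
    using e by (subst two, simp_all) (rule coset_rel, auto)
  show "LE e \<otimes>\<^bsub>U\<^esub> LV (head E e) = LE e" unfolding LV_def LE_def
    using e by (subst two, simp_all) (rule coset_rel, auto)
  show "LV (head E e) \<otimes>\<^bsub>U\<^esub> LG e = LG e" unfolding LV_def LG_def
    using e by (subst two, simp_all) (rule coset_rel, auto)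
  show "LG e \<otimes>\<^bsub>U\<^esub> LV (tail E e) = LG e" unfolding LV_def LG_def
    using e by (subst two, simp_all) (rule coset_rel, auto)
  assume f: "f \<in> arcs E"
  have "coset (word K [Ghost e, Edge f]) = coset (if e = f then word K [Vertex (head E e)] else \<zero>\<^bsub>F\<^esub>)"
    using e f by (intro coset_rel) auto
  then show "LG e \<otimes>\<^bsub>U\<^esub> LE f = (if e = f then LV (head E e) else \<zero>\<^bsub>U\<^esub>)"
    using e f by (auto simp: LV_def LE_def LG_def two zero_U)
qed (auto simp: LV_def LE_def LG_def)

abbreviation L where "L \<equiv> leavitt_path_algebra K E"

lemma coset_in_generated:
  assumes x: "x \<in> carrier F" and "x [] = \<zero>\<^bsub>K\<^esub>"
  shows "coset x \<in> U.generated"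
  using x
proof (induct rule: K.free_algebra_support_induct[where N = "\<lambda>w. w \<noteq> []"])
  case (support w)
  then show ?case using assms(2) by auto
next
  case zero
  then show ?case using U.generated.zero by (simp add: zero_U)
next
  case (add a u g)
  have one: "coset (word K [y]) \<in> U.generated" if "y \<in> generators E" for y
    using that U.generated.P U.generated.S U.generated.T
    by (cases y) (auto simp: LV_def LE_def LG_def)
  have "coset (word K u) \<in> U.generated"
    using add(2,3)
  proof (induct u)
    case (Cons y u)
    show ?case
    proof (cases "u = []")
      case True
      then show ?thesis using one Cons by simp
    next
      case False
      then have "coset (word K [y]) \<otimes>\<^bsub>U\<^esub> coset (word K u) \<in> U.generated"
        using Cons one by (intro U.generated.mult) auto
      then show ?thesis using Cons(2) by (simp add: coset_word_mult)
    qed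
  qed simp
  then have "a \<odot>\<^bsub>U\<^esub> coset (word K u) \<oplus>\<^bsub>U\<^esub> coset g \<in> U.generated"
    using add U.generated.add U.generated.smult by simp
  then show ?case using add by (simp add: smult_U add_U)
qed

lemma generated_in_coset:
  assumes "X \<in> U.generated"
  shows "\<exists>x\<in>carrier F. x [] = \<zero>\<^bsub>K\<^esub> \<and> X = coset x"
  using assms
proof (induct rule: U.generated.induct)
  case zero
  then show ?case by (intro bexI[of _ "\<zero>\<^bsub>F\<^esub>"]) (auto simp: zero_U, simp add: K.free_algebra_simps)
next
  case (P v)
  then show ?case by (intro bexI[of _ "word K [Vertex v]"]) (auto simp: LV_def, simp add: word_def)
next
  case (S e)
  then show ?case by (intro bexI[of _ "word K [Edge e]"]) (auto simp: LE_def, simp add: word_def)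
next
  case (T e)
  then show ?case by (intro bexI[of _ "word K [Ghost e]"]) (auto simp: LG_def, simp add: word_def)
next
  case (add X Y)
  then obtain x y where xy: "x \<in> carrier F" "x [] = \<zero>\<^bsub>K\<^esub>" "X = coset x"
    "y \<in> carrier F" "y [] = \<zero>\<^bsub>K\<^esub>" "Y = coset y" by blast
  then show ?case
    by (intro bexI[of _ "x \<oplus>\<^bsub>F\<^esub> y"]) (simp_all add: add_U, simp add: K.free_algebra_simps)
next
  case (smult a X)
  then obtain x where xy: "x \<in> carrier F" "x [] = \<zero>\<^bsub>K\<^esub>" "X = coset x" by blast
  then show ?case using smult
    by (intro bexI[of _ "a \<odot>\<^bsub>F\<^esub> x"]) (simp_all add: smult_U, simp add: K.free_algebra_simps)
next
  case (mult X Y)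
  then obtain x y where xy: "x \<in> carrier F" "x [] = \<zero>\<^bsub>K\<^esub>" "X = coset x"
    "y \<in> carrier F" "y [] = \<zero>\<^bsub>K\<^esub>" "Y = coset y" by blast
  then show ?case
    by (intro bexI[of _ "x \<otimes>\<^bsub>F\<^esub> y"]) (simp_all add: mult_U, simp add: K.free_algebra_simps)
qed

lemma constant_coeff_mult:
  assumes "x \<in> carrier F" "y \<in> carrier F"
  shows "(x \<otimes>\<^bsub>F\<^esub> y) [] = x [] \<otimes>\<^bsub>K\<^esub> y []"
  using assms by (simp add: K.free_algebra_simps)

lemma carrier_L: "carrier L = U.generated"
  using coset_in_generated generated_in_coset
  by (fastforce simp: leavitt_path_algebra_def Let_def coset_def)

lemma carrier_corner_U: "carrier (corner U U.unit) = U.generated"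
proof (intro equalityI subsetI)
  fix X assume "X \<in> U.generated"
  then show "X \<in> carrier (corner U U.unit)"
    by (simp add: U.generated_carrier U.generated_unit_left U.generated_unit_right)
next
  fix X assume "X \<in> carrier (corner U U.unit)"
  then have X: "X \<in> carrier U" "U.unit \<otimes>\<^bsub>U\<^esub> (X \<otimes>\<^bsub>U\<^esub> U.unit) = X" by auto
  then obtain x where x: "x \<in> carrier F" "X = coset x" by (auto simp: carrier_U)
  have "U.unit \<in> U.generated"
    unfolding U.unit_def
    by (intro U.finsum_in_subset) (auto simp: U.generated.intros U.generated_carrier)
  then obtain u where u: "u \<in> carrier F" "u [] = \<zero>\<^bsub>K\<^esub>" "U.unit = coset u"
    using generated_in_coset by blast
  have "X = coset (u \<otimes>\<^bsub>F\<^esub> (x \<otimes>\<^bsub>F\<^esub> u))" using X x u by (simp add: mult_U)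
  then show "X \<in> U.generated"
    using coset_in_generated[of "u \<otimes>\<^bsub>F\<^esub> (x \<otimes>\<^bsub>F\<^esub> u)"] u x by (simp add: constant_coeff_mult)
qed

lemma one_L: "\<one>\<^bsub>L\<^esub> = U.unit"
proof -
  have "\<one>\<^bsub>L\<^esub> = coset (\<Oplus>\<^bsub>F\<^esub>v\<in>verts E. word K [Vertex v])"
    by (simp add: leavitt_path_algebra_def Let_def coset_def)
  also have "\<dots> = (\<Oplus>\<^bsub>U\<^esub>v\<in>verts E. coset (word K [Vertex v]))"
    by (intro nonunital_hom_finsum[OF F.kalgebra_axioms U.kalgebra_axioms coset_hom]) auto
  finally show ?thesis by (simp add: U.unit_def LV_def)
qed

lemma L_eq_corner: "L = corner U U.unit"
proof (rule module.equality)
  show "carrier L = carrier (corner U U.unit)" using carrier_L carrier_corner_U by simp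
qed (simp_all add: one_L, simp_all add: leavitt_path_algebra_def Let_def U_def)

sublocale L: leavitt_family K L E LV LE LG
  using U.family_corner_unit by (simp add: L_eq_corner)

lemma unit_L: "L.unit = \<one>\<^bsub>L\<^esub>"
proof -
  have "L.unit = (\<Oplus>\<^bsub>L\<^esub>v\<in>verts E. LV v)" by (rule L.unit_def)
  also have "\<dots> = (\<Oplus>\<^bsub>corner U U.unit\<^esub>v\<in>verts E. LV v)" by (simp only: L_eq_corner)
  also have "\<dots> = (\<Oplus>\<^bsub>U\<^esub>v\<in>verts E. LV v)"
    by (intro U.corner_finsum) auto
  finally show ?thesis by (simp add: U.unit_def one_L)
qed

lemma L_generated: "X \<in> carrier L \<Longrightarrow> X \<in> L.generated"
proof -
  assume "X \<in> carrier L"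
  then have "X \<in> U.generated" by (simp add: carrier_L)
  then show "X \<in> L.generated"
  proof (induct rule: U.generated.induct)
    case zero
    then show ?case using L.generated.zero by (simp add: L_eq_corner)
  next
    case (add x y)
    then show ?case using L.generated.add[of x y] by (simp add: L_eq_corner)
  next
    case (smult a x)
    then show ?case using L.generated.smult[of a x] by (simp add: L_eq_corner)
  next
    case (mult x y)
    then show ?case using L.generated.mult[of x y] by (simp add: L_eq_corner)
  qed (auto intro: L.generated.intros)
qed

text \<open>The homomorphism from the free algebra to \<open>B\<close> that is given by the family kills the relations,
  hence the ideal, and so factors through the quotient \<open>U\<close>.\<close>

lemma universal_property:
  assumes B: "leavitt_family K B E P S T"
  obtains h where "nonunital_hom K L B h"
    and "\<And>v. v \<in> verts E \<Longrightarrow> h (LV v) = P v"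
    and "\<And>e. e \<in> arcs E \<Longrightarrow> h (LE e) = S e" and "\<And>e. e \<in> arcs E \<Longrightarrow> h (LG e) = T e"
proof -
  interpret B: leavitt_family K B E P S T by fact
  define val where "val = case_generator P S T"
  have val: "val \<in> generators E \<rightarrow> carrier B"
    by (auto simp: val_def generators_def)
  define \<psi> where "\<psi> = eval_free K B val"
  note hom = B.eval_free_closed[OF val, folded \<psi>_def] B.eval_free_add[OF val, folded \<psi>_def]
    B.eval_free_mult[OF val, folded \<psi>_def] B.eval_free_smult[OF val, folded \<psi>_def]
    B.eval_free_zero[OF val, folded \<psi>_def]
  have word: "\<psi> (word K u) = eval_word B val u" if "set u \<subseteq> generators E" for u
    unfolding \<psi>_def using val that by (rule B.eval_free_word1)
  have one: "\<psi> \<one>\<^bsub>F\<^esub> = \<one>\<^bsub>B\<^esub>"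
  proof -
    have "\<one>\<^bsub>F\<^esub> = word K []" by (simp add: K.free_algebra_simps word_def)
    then show ?thesis using word[of "[]"] by simp
  qed
  \<comment> \<open>With the identity of \<open>B\<close> as value of the empty word, the extension is a ring homomorphism, and
    its kernel is an ideal.\<close>
  have "\<psi> \<in> ring_hom F B" using hom one by (auto intro: ring_hom_memI)
  then interpret \<psi>: ring_hom_ring F B \<psi>
    by (intro ring_hom_ringI2 F.ring_axioms B.ring_axioms)
  have diff: "\<psi> (x \<ominus>\<^bsub>F\<^esub> y) = \<psi> x \<ominus>\<^bsub>B\<^esub> \<psi> y" if "x \<in> carrier F" "y \<in> carrier F" for x y
    using that unfolding F.minus_eq B.minus_eq by (subst \<psi>.hom_add) auto
  have kernel: "x \<ominus>\<^bsub>F\<^esub> y \<in> a_kernel F B \<psi>" if "\<psi> x = \<psi> y" "x \<in> carrier F" "y \<in> carrier F" for x y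
  proof -
    have "\<psi> (x \<ominus>\<^bsub>F\<^esub> y) = \<psi> y \<oplus>\<^bsub>B\<^esub> (\<ominus>\<^bsub>B\<^esub> \<psi> y)"
      unfolding diff[OF that(2,3)] that(1) B.minus_eq ..
    also have "\<dots> = \<zero>\<^bsub>B\<^esub>"
      using that(3) hom(1) by (intro B.r_neg) auto
    finally show ?thesis
      using that(2,3) unfolding a_kernel_def' by auto
  qed
  have vsum: "\<psi> (\<Oplus>\<^bsub>F\<^esub>e\<in>out_arcs E v. word K [Edge e, Ghost e]) = (\<Oplus>\<^bsub>B\<^esub>e\<in>out_arcs E v. S e \<otimes>\<^bsub>B\<^esub> T e)" for v
  proof -
    have "\<psi> (\<Oplus>\<^bsub>F\<^esub>e\<in>out_arcs E v. word K [Edge e, Ghost e]) =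
        (\<Oplus>\<^bsub>B\<^esub>e\<in>out_arcs E v. \<psi> (word K [Edge e, Ghost e]))"
      by (rule additive_finsum[where h = \<psi>, OF F.is_abelian_group B.is_abelian_group])
        (use hom in auto)
    also have "\<dots> = (\<Oplus>\<^bsub>B\<^esub>e\<in>out_arcs E v. S e \<otimes>\<^bsub>B\<^esub> T e)"
      by (intro B.finsum_cong') (auto simp: word val_def)
    finally show ?thesis .
  qed
  have "leavitt_relations K E \<subseteq> a_kernel F B \<psi>"
    unfolding leavitt_relations_def Let_def
  proof (intro Un_least subsetI; elim CollectE exE conjE; hypsubst)
    fix v assume v: "v \<in> verts E" "out_arcs E v \<noteq> {}"
    have "\<psi> (word K [Vertex v]) = \<psi> (\<Oplus>\<^bsub>F\<^esub>e\<in>out_arcs E v. word K [Edge e, Ghost e])"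
      using v(1) B.sum_S_T[OF v] by (simp only: vsum) (simp add: word val_def)
    then show "word K [Vertex v] \<ominus>\<^bsub>F\<^esub> (\<Oplus>\<^bsub>F\<^esub>e\<in>out_arcs E v. word K [Edge e, Ghost e]) \<in> a_kernel F B \<psi>"
      using v(1) finsum_words_closed by (intro kernel) auto
  qed (rule kernel; force simp: word val_def B.rels hom)+
  then have I: "I \<subseteq> a_kernel F B \<psi>"
    unfolding leavitt_ideal_def by (intro F.genideal_minimal \<psi>.kernel_is_ideal)
  define h where "h X = \<psi> (SOME x. x \<in> carrier F \<and> X = coset x)" for X
  have h: "h (coset x) = \<psi> x" if x: "x \<in> carrier F" for x
  proof -
    define y where "y = (SOME y. y \<in> carrier F \<and> coset x = coset y)"
    have "y \<in> carrier F \<and> coset x = coset y"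
      unfolding y_def using someI[of "\<lambda>y. y \<in> carrier F \<and> coset x = coset y" x] x by blast
    then have y: "y \<in> carrier F" "coset x = coset y" by auto
    then have "x \<ominus>\<^bsub>F\<^esub> y \<in> a_kernel F B \<psi>" using I x coset_eq_iff by blast
    then have "\<psi> x \<ominus>\<^bsub>B\<^esub> \<psi> y = \<zero>\<^bsub>B\<^esub>"
      unfolding a_kernel_def' diff[OF x y(1), symmetric] by blast
    then have "\<psi> x = \<psi> y"
      by (rule B.eq_if_minus_zero) (use x y(1) hom(1) in auto)
    then show ?thesis by (simp add: h_def y_def)
  qed
  have "nonunital_hom K U B h"
    unfolding nonunital_hom_def
    by (auto simp: carrier_U add_U mult_U smult_U h hom)
  then have "nonunital_hom K L B h"
    by (auto simp: nonunital_hom_def L_eq_corner)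
  then show thesis
    by (rule that) (auto simp: LV_def LE_def LG_def h word val_def)
qed

end


section \<open>Ghost paths are linearly independent\<close>

definition operator_algebra :: "('k, 'c) ring_scheme \<Rightarrow> ('k, ('x \<Rightarrow> 'k) \<Rightarrow> ('x \<Rightarrow> 'k)) module"
  where "operator_algebra K = (let V = UNIV \<rightarrow> carrier K in
    \<lparr>carrier = {\<phi> \<in> extensional V. \<phi> ` V \<subseteq> V \<and>
       (\<forall>g\<in>V. \<forall>h\<in>V. \<forall>x. \<phi> (\<lambda>x. g x \<oplus>\<^bsub>K\<^esub> h x) x = \<phi> g x \<oplus>\<^bsub>K\<^esub> \<phi> h x) \<and>
       (\<forall>a\<in>carrier K. \<forall>g\<in>V. \<forall>x. \<phi> (\<lambda>x. a \<otimes>\<^bsub>K\<^esub> g x) x = a \<otimes>\<^bsub>K\<^esub> \<phi> g x)},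
     mult = (\<lambda>\<phi> \<chi>. \<lambda>g\<in>V. \<phi> (\<chi> g)),
     one = (\<lambda>g\<in>V. g),
     zero = (\<lambda>g\<in>V. \<lambda>x. \<zero>\<^bsub>K\<^esub>),
     add = (\<lambda>\<phi> \<chi>. \<lambda>g\<in>V. \<lambda>x. \<phi> g x \<oplus>\<^bsub>K\<^esub> \<chi> g x),
     smult = (\<lambda>a \<phi>. \<lambda>g\<in>V. \<lambda>x. a \<otimes>\<^bsub>K\<^esub> \<phi> g x)\<rparr>)"

definition pull :: "('k, 'c) ring_scheme \<Rightarrow> ('x \<Rightarrow> 'x option) \<Rightarrow> ('x \<Rightarrow> 'k) \<Rightarrow> ('x \<Rightarrow> 'k)"
  where "pull K m = (\<lambda>g\<in>UNIV \<rightarrow> carrier K. \<lambda>x. case m x of None \<Rightarrow> \<zero>\<^bsub>K\<^esub> | Some y \<Rightarrow> g y)"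

context field
begin

abbreviation fns :: "('x \<Rightarrow> 'a) set" where "fns \<equiv> UNIV \<rightarrow> carrier R"

lemma operator_algebra_simps:
  "mult (operator_algebra R) = (\<lambda>\<phi> \<chi>. \<lambda>g\<in>fns. \<phi> (\<chi> g))"
  "one (operator_algebra R) = (\<lambda>g\<in>fns. g)"
  "zero (operator_algebra R) = (\<lambda>g\<in>fns. \<lambda>x. \<zero>)"
  "add (operator_algebra R) = (\<lambda>\<phi> \<chi>. \<lambda>g\<in>fns. \<lambda>x. \<phi> g x \<oplus> \<chi> g x)"
  "smult (operator_algebra R) = (\<lambda>a \<phi>. \<lambda>g\<in>fns. \<lambda>x. a \<otimes> \<phi> g x)"
  by (simp_all add: operator_algebra_def Let_def)

lemma operator_algebra_carrier:
  "\<phi> \<in> carrier (operator_algebra R) \<longleftrightarrow> \<phi> \<in> extensional fns \<and> (\<forall>g\<in>fns. \<forall>x. \<phi> g x \<in> carrier R) \<and>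
     (\<forall>g\<in>fns. \<forall>h\<in>fns. \<phi> (\<lambda>x. g x \<oplus> h x) = (\<lambda>x. \<phi> g x \<oplus> \<phi> h x)) \<and>
     (\<forall>a\<in>carrier R. \<forall>g\<in>fns. \<phi> (\<lambda>x. a \<otimes> g x) = (\<lambda>x. a \<otimes> \<phi> g x))"
  by (simp add: operator_algebra_def Let_def image_subset_iff Pi_iff fun_eq_iff)

lemma operator_eqI:
  assumes "\<phi> \<in> extensional fns" "\<chi> \<in> extensional fns" "\<And>g x. g \<in> fns \<Longrightarrow> \<phi> g x = \<chi> g x"
  shows "\<phi> = \<chi>"
  using assms by (intro extensionalityI[of _ fns]) auto

lemma operator_algebra_kalgebra:
  "kalgebra R (operator_algebra R :: ('a, ('x \<Rightarrow> 'a) \<Rightarrow> ('x \<Rightarrow> 'a)) module)" (is "kalgebra R ?A")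
proof (intro kalgebra.intro ringI kalgebra_axioms.intro)
  have fn: "\<phi> g \<in> fns" if "\<phi> \<in> carrier ?A" "g \<in> fns" for \<phi> g
    using that by (auto simp: operator_algebra_carrier)
  have val: "\<phi> g x \<in> carrier R" if "\<phi> \<in> carrier ?A" "g \<in> fns" for \<phi> g x
    using that by (auto simp: operator_algebra_carrier)
  have ext: "\<phi> \<in> extensional fns" if "\<phi> \<in> carrier ?A" for \<phi>
    using that by (auto simp: operator_algebra_carrier)
  have lin: "\<phi> (\<lambda>x. g x \<oplus> h x) = (\<lambda>x. \<phi> g x \<oplus> \<phi> h x)" if "\<phi> \<in> carrier ?A" "g \<in> fns" "h \<in> fns" for \<phi> g h
    using that by (auto simp: operator_algebra_carrier)
  have hom: "\<phi> (\<lambda>x. a \<otimes> g x) = (\<lambda>x. a \<otimes> \<phi> g x)" if "\<phi> \<in> carrier ?A" "g \<in> fns" "a \<in> carrier R" for \<phi> a g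
    using that by (auto simp: operator_algebra_carrier)
  have sumc: "(\<lambda>x. g x \<oplus> h x) \<in> fns" if "g \<in> fns" "h \<in> fns" for g h :: "'x \<Rightarrow> 'a"
    using that by auto
  have smc: "(\<lambda>x. a \<otimes> g x) \<in> fns" if "g \<in> fns" "a \<in> carrier R" for a and g :: "'x \<Rightarrow> 'a"
    using that by auto
  note simps = operator_algebra_simps fn val lin hom sumc smc
  have add_cl: "\<phi> \<oplus>\<^bsub>?A\<^esub> \<chi> \<in> carrier ?A" if "\<phi> \<in> carrier ?A" "\<chi> \<in> carrier ?A" for \<phi> \<chi>
    unfolding operator_algebra_carrier
    using that by (simp add: simps a_ac r_distr)
  have sm_cl: "a \<odot>\<^bsub>?A\<^esub> \<phi> \<in> carrier ?A" if "a \<in> carrier R" "\<phi> \<in> carrier ?A" for a \<phi>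
    unfolding operator_algebra_carrier
    using that by (simp add: simps r_distr m_lcomm)
  have mult_cl: "\<phi> \<otimes>\<^bsub>?A\<^esub> \<chi> \<in> carrier ?A" if "\<phi> \<in> carrier ?A" "\<chi> \<in> carrier ?A" for \<phi> \<chi>
    unfolding operator_algebra_carrier
    using that by (simp add: simps)
  have zero_cl: "\<zero>\<^bsub>?A\<^esub> \<in> carrier ?A"
    unfolding operator_algebra_carrier by (simp add: simps)
  have one_cl: "\<one>\<^bsub>?A\<^esub> \<in> carrier ?A"
    unfolding operator_algebra_carrier using sumc smc by (auto simp: operator_algebra_simps)
  have ex: "restrict f fns \<in> extensional fns" for f :: "('x \<Rightarrow> 'a) \<Rightarrow> ('x \<Rightarrow> 'a)" by simp
  show "abelian_group ?A"
  proof (rule abelian_groupI)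
    fix \<phi> assume p: "\<phi> \<in> carrier ?A"
    have "((\<ominus> \<one>) \<odot>\<^bsub>?A\<^esub> \<phi>) \<oplus>\<^bsub>?A\<^esub> \<phi> = \<zero>\<^bsub>?A\<^esub>"
      by (rule operator_eqI) (use p in \<open>simp_all add: simps l_minus l_neg\<close>)
    then show "\<exists>\<chi>\<in>carrier ?A. \<chi> \<oplus>\<^bsub>?A\<^esub> \<phi> = \<zero>\<^bsub>?A\<^esub>" using sm_cl p by blast
    show "\<zero>\<^bsub>?A\<^esub> \<oplus>\<^bsub>?A\<^esub> \<phi> = \<phi>"
      by (rule operator_eqI) (use p ext in \<open>simp_all add: simps\<close>)
    fix \<chi> assume q: "\<chi> \<in> carrier ?A"
    show "\<phi> \<oplus>\<^bsub>?A\<^esub> \<chi> = \<chi> \<oplus>\<^bsub>?A\<^esub> \<phi>"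
      by (rule operator_eqI) (use p q in \<open>simp_all add: simps a_comm\<close>)
    fix \<xi> assume "\<xi> \<in> carrier ?A"
    then show "\<phi> \<oplus>\<^bsub>?A\<^esub> \<chi> \<oplus>\<^bsub>?A\<^esub> \<xi> = \<phi> \<oplus>\<^bsub>?A\<^esub> (\<chi> \<oplus>\<^bsub>?A\<^esub> \<xi>)"
      by (intro operator_eqI) (use p q in \<open>simp_all add: simps a_assoc\<close>)
  qed (use add_cl zero_cl in auto)
  show "Group.monoid ?A"
  proof (rule monoidI)
    fix \<phi> assume p: "\<phi> \<in> carrier ?A"
    show "\<one>\<^bsub>?A\<^esub> \<otimes>\<^bsub>?A\<^esub> \<phi> = \<phi>"
      by (rule operator_eqI) (use p ext in \<open>simp_all add: simps\<close>)
    show "\<phi> \<otimes>\<^bsub>?A\<^esub> \<one>\<^bsub>?A\<^esub> = \<phi>"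
      by (rule operator_eqI) (use p ext in \<open>simp_all add: simps\<close>)
    fix \<chi> \<xi> assume "\<chi> \<in> carrier ?A" "\<xi> \<in> carrier ?A"
    then show "\<phi> \<otimes>\<^bsub>?A\<^esub> \<chi> \<otimes>\<^bsub>?A\<^esub> \<xi> = \<phi> \<otimes>\<^bsub>?A\<^esub> (\<chi> \<otimes>\<^bsub>?A\<^esub> \<xi>)"
      by (intro operator_eqI) (use p in \<open>simp_all add: simps\<close>)
  qed (use mult_cl one_cl in auto)
  fix \<phi> \<chi> assume p: "\<phi> \<in> carrier ?A" and q: "\<chi> \<in> carrier ?A"
  {
    fix \<xi> assume r: "\<xi> \<in> carrier ?A"
    show "(\<phi> \<oplus>\<^bsub>?A\<^esub> \<chi>) \<otimes>\<^bsub>?A\<^esub> \<xi> = \<phi> \<otimes>\<^bsub>?A\<^esub> \<xi> \<oplus>\<^bsub>?A\<^esub> \<chi> \<otimes>\<^bsub>?A\<^esub> \<xi>"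
      using p q r by (intro operator_eqI) (simp_all add: simps)
    show "\<xi> \<otimes>\<^bsub>?A\<^esub> (\<phi> \<oplus>\<^bsub>?A\<^esub> \<chi>) = \<xi> \<otimes>\<^bsub>?A\<^esub> \<phi> \<oplus>\<^bsub>?A\<^esub> \<xi> \<otimes>\<^bsub>?A\<^esub> \<chi>"
      using p q r by (intro operator_eqI) (simp_all add: simps)
  }
next
  show "field R" by (rule field_axioms)
qed (auto simp: operator_algebra_carrier operator_algebra_simps l_distr r_distr m_assoc m_lcomm
    a_ac Pi_iff intro!: operator_eqI)

lemma pull_closed: "pull R m \<in> carrier (operator_algebra R)"
  unfolding operator_algebra_carrier pull_def
  by (auto simp: fun_eq_iff Pi_iff split: option.split)

lemma pull_apply:
  "g \<in> fns \<Longrightarrow> pull R m g x = (case m x of None \<Rightarrow> \<zero> | Some y \<Rightarrow> g y)"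
  by (simp add: pull_def)

lemma pull_mult:
  fixes m m' :: "'x \<Rightarrow> 'x option"
  shows "pull R m \<otimes>\<^bsub>operator_algebra R\<^esub> pull R m' = pull R (\<lambda>x. Option.bind (m x) m')"
proof (rule operator_eqI)
  fix g :: "'x \<Rightarrow> 'a" and x assume g: "g \<in> fns"
  then have "(\<lambda>x. case m' x of None \<Rightarrow> \<zero> | Some y \<Rightarrow> g y) \<in> fns"
    by (simp add: Pi_iff split: option.split)
  with g show "(pull R m \<otimes>\<^bsub>operator_algebra R\<^esub> pull R m') g x = pull R (\<lambda>x. Option.bind (m x) m') g x"
    by (auto simp: pull_def operator_algebra_simps split: option.split)
qed (simp_all add: pull_def operator_algebra_simps)

lemma pull_None: "pull R (\<lambda>x. None) = \<zero>\<^bsub>operator_algebra R\<^esub>"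
  by (simp add: pull_def operator_algebra_simps)

end

text \<open>The out-arcs of a regular vertex, times \<open>\<nat>\<close>, form a countably infinite set.  So one copy of \<open>\<nat>\<close> at
  each vertex can be divided among the out-arcs of the vertex, each of which gets a whole copy again.\<close>

definition arc_code :: "('v, 'e) pre_digraph \<Rightarrow> 'e \<Rightarrow> nat \<Rightarrow> nat"
  where "arc_code E e k = to_nat_on (out_arcs E (tail E e) \<times> UNIV) (e, k)"

definition arc_decode :: "('v, 'e) pre_digraph \<Rightarrow> 'v \<Rightarrow> nat \<Rightarrow> 'e \<times> nat"
  where "arc_decode E v = from_nat_into (out_arcs E v \<times> UNIV)"

primrec path_code :: "('v, 'e) pre_digraph \<Rightarrow> 'e list \<Rightarrow> nat \<Rightarrow> nat" where
  "path_code E [] k = k"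
| "path_code E (e # u) k = path_code E u (arc_code E e k)"

context fin_digraph
begin

lemma arc_code:
  shows "e \<in> arcs G \<Longrightarrow> arc_decode G (tail G e) (arc_code G e k) = (e, k)"
    and "out_arcs G v \<noteq> {} \<Longrightarrow> fst (arc_decode G v k) \<in> out_arcs G v"
    and "out_arcs G v \<noteq> {} \<Longrightarrow> arc_code G (fst (arc_decode G v k)) (snd (arc_decode G v k)) = k"
proof -
  have c: "countable (out_arcs G v \<times> (UNIV :: nat set))" for v
    using finite_out_arcs[of v] by (auto intro: countable_finite)
  show "e \<in> arcs G \<Longrightarrow> arc_decode G (tail G e) (arc_code G e k) = (e, k)"
    using c unfolding arc_decode_def arc_code_def by (subst from_nat_into_to_nat_on) auto
  assume v: "out_arcs G v \<noteq> {}"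
  then have "arc_decode G v k \<in> out_arcs G v \<times> UNIV"
    unfolding arc_decode_def by (intro from_nat_into) auto
  then show *: "fst (arc_decode G v k) \<in> out_arcs G v" by auto
  have "infinite (out_arcs G v \<times> (UNIV :: nat set))"
    using v by (simp add: finite_cartesian_product_iff)
  then show "arc_code G (fst (arc_decode G v k)) (snd (arc_decode G v k)) = k"
    using * c unfolding arc_decode_def arc_code_def
    by (simp add: to_nat_on_from_nat_into_infinite)
qed

end

lemma ghost_path_start: "ghost_path E x u y \<Longrightarrow> ghost_path E x' u y \<Longrightarrow> x = x'"
  by (induct rule: ghost_path.induct) auto

lemma (in fin_digraph) path_code_inj:
  assumes "ghost_path G x u y" "ghost_path G x' u' y" "length u = length u'"
    "path_code G u k = path_code G u' k'"
  shows "u = u' \<and> k = k'"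
  using assms
proof (induct arbitrary: x' u' k k' rule: ghost_path.induct)
  case (Cons e u y)
  obtain e' v where u': "u' = e' # v" "e' \<in> arcs G" "ghost_path G (tail G e') v y"
    using Cons(4,5) by (cases u') auto
  have eq: "u = v" "arc_code G e k = arc_code G e' k'"
    using Cons(3)[of "tail G e'" v "arc_code G e k" "arc_code G e' k'"] u'(3) Cons(5,6)[unfolded u'(1)] by auto
  have "tail G e = tail G e'" using Cons(2) u'(3) unfolding eq by (rule ghost_path_start)
  then have "(e, k) = (e', k')" using arc_code(1) Cons(1) u'(2) eq(2) by metis
  then show ?case using eq u' by simp
qed simp

context leavitt_presentation
begin

abbreviation B :: "('k, ('v \<times> nat \<times> int \<Rightarrow> 'k) \<Rightarrow> ('v \<times> nat \<times> int \<Rightarrow> 'k)) module"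
  where "B \<equiv> operator_algebra K"

text \<open>The relations are realized by partial bijections of the set of triples \<open>(a, k, d)\<close>, where \<open>k\<close>
  belongs to the copy of \<open>\<nat>\<close> at the vertex \<open>a\<close>.  The integer \<open>d\<close> counts the edges that have been passed;
  it separates ghost paths of different lengths, which on the pairs \<open>(a, k)\<close> alone may act in the same
  way.\<close>

definition vertex_map :: "'v \<Rightarrow> 'v \<times> nat \<times> int \<Rightarrow> ('v \<times> nat \<times> int) option"
  where "vertex_map v = (\<lambda>(a, k, d). if a = v then Some (a, k, d) else None)"

definition ghost_map :: "'e \<Rightarrow> 'v \<times> nat \<times> int \<Rightarrow> ('v \<times> nat \<times> int) option"
  where "ghost_map e = (\<lambda>(a, k, d). if a = head E e then Some (tail E e, arc_code E e k, d + 1) else None)"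

definition edge_map :: "'e \<Rightarrow> 'v \<times> nat \<times> int \<Rightarrow> ('v \<times> nat \<times> int) option"
  where "edge_map e = (\<lambda>(a, k, d). if a = tail E e \<and> fst (arc_decode E a k) = e
    then Some (head E e, snd (arc_decode E a k), d - 1) else None)"

lemma operator_family:
  "leavitt_family K B E (\<lambda>v. pull K (vertex_map v)) (\<lambda>e. pull K (edge_map e)) (\<lambda>e. pull K (ghost_map e))"
proof -
  interpret B: kalgebra K B by (rule K.operator_algebra_kalgebra)
  show ?thesis
  proof unfold_locales
    fix v assume v: "v \<in> verts E" "out_arcs E v \<noteq> {}"
    define m where "m D = (\<lambda>(a, k, d :: int). if a = v \<and> fst (arc_decode E a k) \<in> D then Some (a, k, d) else None)"
      for D :: "'e set"
    have *: "(\<Oplus>\<^bsub>B\<^esub>e\<in>D. pull K (m {e})) = pull K (m D)" if "finite D" for D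
      using that
    proof induct
      case empty
      have "m {} = (\<lambda>x. None)" by (auto simp: m_def)
      then show ?case by (simp add: K.pull_None)
    next
      case (insert e D)
      have "pull K (m {e}) \<oplus>\<^bsub>B\<^esub> pull K (m D) = pull K (m (insert e D))"
        by (rule K.operator_eqI)
          (use insert(2) in \<open>auto simp: K.operator_algebra_simps pull_def m_def Pi_iff\<close>)
      then show ?case using insert by (simp add: K.pull_closed)
    qed
    have "(\<Oplus>\<^bsub>B\<^esub>e\<in>out_arcs E v. pull K (edge_map e) \<otimes>\<^bsub>B\<^esub> pull K (ghost_map e)) =
        (\<Oplus>\<^bsub>B\<^esub>e\<in>out_arcs E v. pull K (m {e}))"
    proof (rule B.finsum_cong')
      fix e assume e: "e \<in> out_arcs E v"
      have "arc_code E e (snd (arc_decode E v k)) = k" if "fst (arc_decode E v k) = e" for k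
        using E.arc_code(3)[OF v(2), of k] that by simp
      then have "(\<lambda>x. Option.bind (edge_map e x) (ghost_map e)) = m {e}"
        using e by (auto simp: edge_map_def ghost_map_def m_def fun_eq_iff)
      then show "pull K (edge_map e) \<otimes>\<^bsub>B\<^esub> pull K (ghost_map e) = pull K (m {e})"
        by (simp add: K.pull_mult)
    qed (auto simp: K.pull_closed)
    also have "\<dots> = pull K (m (out_arcs E v))" using E.finite_out_arcs by (rule *)
    also have "m (out_arcs E v) = vertex_map v"
      using E.arc_code(2)[OF v(2)] by (auto simp: m_def vertex_map_def fun_eq_iff)
    finally show "pull K (vertex_map v) =
        (\<Oplus>\<^bsub>B\<^esub>e\<in>out_arcs E v. pull K (edge_map e) \<otimes>\<^bsub>B\<^esub> pull K (ghost_map e))" by simp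
  next
    fix e f assume e: "e \<in> arcs E" and f: "f \<in> arcs E"
    have "(\<lambda>x. Option.bind (ghost_map e x) (edge_map f)) =
        (if e = f then vertex_map (head E e) else (\<lambda>x. None))"
      using E.arc_code(1)[OF e] by (auto simp: edge_map_def ghost_map_def vertex_map_def fun_eq_iff)
    then show "pull K (ghost_map e) \<otimes>\<^bsub>B\<^esub> pull K (edge_map f) =
      (if e = f then pull K (vertex_map (head E e)) else \<zero>\<^bsub>B\<^esub>)"
      by (simp add: K.pull_mult K.pull_None)
  next
    fix v w assume "v \<in> verts E" "w \<in> verts E"
    have "(\<lambda>x. Option.bind (vertex_map v x) (vertex_map w)) =
        (if v = w then vertex_map w else (\<lambda>x. None))"
      by (auto simp: vertex_map_def fun_eq_iff)
    then show "pull K (vertex_map v) \<otimes>\<^bsub>B\<^esub> pull K (vertex_map w) =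
      (if v = w then pull K (vertex_map w) else \<zero>\<^bsub>B\<^esub>)"
      by (simp add: K.pull_mult K.pull_None)
  next
    fix e assume "e \<in> arcs E"
    have pull_eqI: "pull K m \<otimes>\<^bsub>B\<^esub> pull K m' = pull K m''" if "\<And>x. Option.bind (m x) m' = m'' x"
      for m m' m'' :: "'v \<times> nat \<times> int \<Rightarrow> ('v \<times> nat \<times> int) option"
      using that by (simp add: K.pull_mult)
    note maps = edge_map_def ghost_map_def vertex_map_def
    show "pull K (vertex_map (tail E e)) \<otimes>\<^bsub>B\<^esub> pull K (edge_map e) = pull K (edge_map e)"
      by (rule pull_eqI) (auto simp: maps split: prod.split)
    show "pull K (edge_map e) \<otimes>\<^bsub>B\<^esub> pull K (vertex_map (head E e)) = pull K (edge_map e)"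
      by (rule pull_eqI) (auto simp: maps split: prod.split)
    show "pull K (vertex_map (head E e)) \<otimes>\<^bsub>B\<^esub> pull K (ghost_map e) = pull K (ghost_map e)"
      by (rule pull_eqI) (auto simp: maps split: prod.split)
    show "pull K (ghost_map e) \<otimes>\<^bsub>B\<^esub> pull K (vertex_map (tail E e)) = pull K (ghost_map e)"
      by (rule pull_eqI) (auto simp: maps split: prod.split)
  qed (simp_all add: K.pull_closed)
qed

interpretation O: leavitt_family K B E "\<lambda>v. pull K (vertex_map v)" "\<lambda>e. pull K (edge_map e)"
    "\<lambda>e. pull K (ghost_map e)"
  by (rule operator_family)

text \<open>If \<open>w0\<close> occurs in \<open>f\<close>, apply \<open>f\<close> to the indicator function of the point to which \<open>w0\<close> leads
  from \<open>(x, 0, 0)\<close>.  No other ghost path from \<open>x\<close> to \<open>y\<close> leads there, so the value at \<open>(x, 0, 0)\<close> is the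
  coefficient of \<open>w0\<close>.\<close>

lemma operator_faithful: "O.faithful"
  unfolding O.faithful_def
proof (intro ballI impI)
  let ?P = "\<lambda>v. pull K (vertex_map v)" and ?T = "\<lambda>e. pull K (ghost_map e)"
  fix x y f assume xy: "x \<in> verts E" "y \<in> verts E" and f: "f \<in> ghost_coeffs K E x y"
    and zero: "O.eval_ghost f \<otimes>\<^bsub>B\<^esub> ?P y = \<zero>\<^bsub>B\<^esub>"
  have ev: "(eval_word B ?T u \<otimes>\<^bsub>B\<^esub> ?P y) g (x', k, d) = g (y, path_code E u k, d + int (length u))"
    if "ghost_path E x' u y" "g \<in> UNIV \<rightarrow> carrier K" for x' u g k d
    using that
  proof (induct arbitrary: k d rule: ghost_path.induct)
    case (Nil z)
    then show ?case by (simp add: O.eval_word_Nil K.pull_closed) (simp add: pull_def vertex_map_def)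
  next
    case (Cons e u z)
    have c: "eval_word B ?T u \<in> carrier B" by (simp add: K.pull_closed)
    define r where "r = eval_word B ?T u \<otimes>\<^bsub>B\<^esub> pull K (vertex_map z)"
    have rc: "r \<in> carrier B" unfolding r_def using c by (simp add: K.pull_closed)
    then have rg: "r g \<in> UNIV \<rightarrow> carrier K" using Cons(4) by (auto simp: K.operator_algebra_carrier)
    have "(eval_word B ?T (e # u) \<otimes>\<^bsub>B\<^esub> pull K (vertex_map z)) = ?T e \<otimes>\<^bsub>B\<^esub> r"
      using c by (simp add: r_def O.m_assoc K.pull_closed)
    moreover have "(?T e \<otimes>\<^bsub>B\<^esub> r) g (head E e, k, d) = r g (tail E e, arc_code E e k, d + 1)"
      using Cons(4) rg by (simp add: K.operator_algebra_simps(1) K.pull_apply ghost_map_def)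
    ultimately have "(eval_word B ?T (e # u) \<otimes>\<^bsub>B\<^esub> pull K (vertex_map z)) g (head E e, k, d) =
        r g (tail E e, arc_code E e k, d + 1)" by simp
    then show ?case using Cons(3)[OF Cons(4)] by (simp add: r_def algebra_simps)
  qed
  show "f = \<zero>\<^bsub>free_algebra K (arcs E)\<^esub>"
  proof (rule ccontr)
    assume "f \<noteq> \<zero>\<^bsub>free_algebra K (arcs E)\<^esub>"
    then obtain w0 where w0: "f w0 \<noteq> \<zero>\<^bsub>K\<^esub>" by (auto simp: K.free_algebra_simps)
    let ?W = "{w. f w \<noteq> \<zero>\<^bsub>K\<^esub>}"
    have fc: "f \<in> carrier (free_algebra K (arcs E))" using f by (rule K.ghost_coeffs_carrier)
    have W: "finite ?W" using fc by (simp add: K.free_algebra_carrier)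
    have fw: "f w \<in> carrier K" for w using fc by simp
    define g :: "'v \<times> nat \<times> int \<Rightarrow> 'k" where
      "g z = (if z = (y, path_code E w0 0, int (length w0)) then \<one>\<^bsub>K\<^esub> else \<zero>\<^bsub>K\<^esub>)" for z
    have g: "g \<in> UNIV \<rightarrow> carrier K" by (auto simp: g_def)
    have c: "eval_word B ?T w \<in> carrier B" for w by (simp add: K.pull_closed)
    have "O.eval_ghost f \<otimes>\<^bsub>B\<^esub> ?P y = (\<Oplus>\<^bsub>B\<^esub>w\<in>?W. (f w \<odot>\<^bsub>B\<^esub> eval_word B ?T w) \<otimes>\<^bsub>B\<^esub> ?P y)"
      unfolding eval_free_def using W c fw by (intro O.finsum_ldistr) (auto simp: K.pull_closed)
    then have "(O.eval_ghost f \<otimes>\<^bsub>B\<^esub> ?P y) g (x, 0, 0) =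
        (\<Oplus>\<^bsub>B\<^esub>w\<in>?W. (f w \<odot>\<^bsub>B\<^esub> eval_word B ?T w) \<otimes>\<^bsub>B\<^esub> ?P y) g (x, 0, 0)" by simp
    also have "\<dots> = (\<Oplus>\<^bsub>K\<^esub>w\<in>?W. ((f w \<odot>\<^bsub>B\<^esub> eval_word B ?T w) \<otimes>\<^bsub>B\<^esub> ?P y) g (x, 0, 0))"
      using c fw g
      by (intro additive_finsum[where h = "\<lambda>\<phi>. \<phi> g (x, 0, 0)", OF O.is_abelian_group K.is_abelian_group])
        (auto simp: K.pull_closed, auto simp: K.operator_algebra_carrier K.operator_algebra_simps)
    also have "\<dots> = (\<Oplus>\<^bsub>K\<^esub>w\<in>?W. if w0 = w then f w else \<zero>\<^bsub>K\<^esub>)"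
    proof (rule K.finsum_cong')
      fix w assume w: "w \<in> ?W"
      then have p: "ghost_path E x w y" using K.ghost_coeffs_path[OF f] by simp
      have p0: "ghost_path E x w0 y" using K.ghost_coeffs_path[OF f w0] .
      have "((f w \<odot>\<^bsub>B\<^esub> eval_word B ?T w) \<otimes>\<^bsub>B\<^esub> ?P y) g (x, 0, 0) =
          f w \<otimes>\<^bsub>K\<^esub> (eval_word B ?T w \<otimes>\<^bsub>B\<^esub> ?P y) g (x, 0, 0)"
        using c fw g by (simp add: O.smult_mult_l K.pull_closed) (simp add: K.operator_algebra_simps)
      also have "\<dots> = f w \<otimes>\<^bsub>K\<^esub> g (y, path_code E w 0, int (length w))"
        using ev[OF p g] by simp
      also have "\<dots> = (if w0 = w then f w else \<zero>\<^bsub>K\<^esub>)"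
        using E.path_code_inj[OF p p0, of 0 0] fw by (auto simp: g_def)
      finally show "((f w \<odot>\<^bsub>B\<^esub> eval_word B ?T w) \<otimes>\<^bsub>B\<^esub> ?P y) g (x, 0, 0) = \<dots>" .
    qed (use fw in auto)
    also have "\<dots> = f w0" using w0 W fw by (intro K.finsum_singleton) auto
    finally have "f w0 = \<zero>\<^bsub>K\<^esub>"
      unfolding zero using g by (simp add: K.operator_algebra_simps)
    with w0 show False ..
  qed
qed

lemma L_faithful: "L.faithful"
  unfolding L.faithful_def
proof (intro ballI impI)
  let ?P = "\<lambda>v. pull K (vertex_map v)" and ?T = "\<lambda>e. pull K (ghost_map e)"
  fix x y f assume xy: "x \<in> verts E" "y \<in> verts E" and f: "f \<in> ghost_coeffs K E x y"
    and zero: "L.eval_ghost f \<otimes>\<^bsub>L\<^esub> LV y = \<zero>\<^bsub>L\<^esub>"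
  obtain h where h: "nonunital_hom K L B h" "\<And>v. v \<in> verts E \<Longrightarrow> h (LV v) = ?P v"
    "\<And>e. e \<in> arcs E \<Longrightarrow> h (LG e) = ?T e"
    using universal_property[OF operator_family] by metis
  note fc = K.ghost_coeffs_carrier[OF f]
  have "\<zero>\<^bsub>B\<^esub> = h (L.eval_ghost f \<otimes>\<^bsub>L\<^esub> LV y)"
    unfolding zero by (rule nonunital_hom_zero[OF L.kalgebra_axioms O.kalgebra_axioms h(1), symmetric])
  also have "\<dots> = eval_free K B (h \<circ> LG) f \<otimes>\<^bsub>B\<^esub> h (LV y)"
    using xy by (intro nonunital_hom_eval_free[OF L.kalgebra_axioms O.kalgebra_axioms h(1) fc]) auto
  also have "eval_free K B (h \<circ> LG) f = O.eval_ghost f"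
    using fc by (rule O.eval_free_cong) (auto simp: h(3) K.pull_closed)
  finally show "f = \<zero>\<^bsub>free_algebra K (arcs E)\<^esub>"
    using operator_faithful f xy unfolding O.faithful_def by (simp add: h(2))
qed

end


section \<open>Recognizing Leavitt path algebras\<close>

lemma algebra_isomorphicI:
  assumes "nonunital_hom K A B h" "h \<one>\<^bsub>A\<^esub> = \<one>\<^bsub>B\<^esub>" "bij_betw h (carrier A) (carrier B)"
  shows "algebra_isomorphic K A B"
  using assms unfolding algebra_isomorphic_def ring_iso_def ring_hom_def nonunital_hom_def
  by (intro bexI[of _ h]) auto

lemma algebra_isomorphic_sym:
  assumes A: "kalgebra K A" and iso: "algebra_isomorphic K A B"
  shows "algebra_isomorphic K B A"
proof -
  interpret A: kalgebra K A by fact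
  from iso obtain h where h: "h \<in> ring_hom A B" "bij_betw h (carrier A) (carrier B)"
    and sm: "\<And>a x. \<lbrakk>a \<in> carrier K; x \<in> carrier A\<rbrakk> \<Longrightarrow> h (a \<odot>\<^bsub>A\<^esub> x) = a \<odot>\<^bsub>B\<^esub> h x"
    unfolding algebra_isomorphic_def ring_iso_def by blast
  define g where "g = inv_into (carrier A) h"
  have g: "bij_betw g (carrier B) (carrier A)"
    unfolding g_def using h(2) by (rule bij_betw_inv_into)
  have gh: "g (h x) = x" if "x \<in> carrier A" for x
    unfolding g_def using h(2) that by (rule bij_betw_inv_into_left)
  have img: "\<exists>x\<in>carrier A. y = h x" if "y \<in> carrier B" for y
    using h(2) that by (auto simp: bij_betw_def)
  show ?thesis
  proof (rule algebra_isomorphicI[OF _ _ g])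
    show "nonunital_hom K B A g"
      unfolding nonunital_hom_def
    proof (intro conjI ballI)
      fix y assume y: "y \<in> carrier B"
      then obtain x where x: "x \<in> carrier A" "y = h x" using img by blast
      then show "g y \<in> carrier A" by (simp add: gh)
      { fix a assume "a \<in> carrier K"
        then show "g (a \<odot>\<^bsub>B\<^esub> y) = a \<odot>\<^bsub>A\<^esub> g y" using x by (simp add: gh flip: sm) }
      fix y' assume "y' \<in> carrier B"
      then obtain x' where x': "x' \<in> carrier A" "y' = h x'" using img by blast
      show "g (y \<oplus>\<^bsub>B\<^esub> y') = g y \<oplus>\<^bsub>A\<^esub> g y'"
        using x x' by (simp add: gh flip: ring_hom_add[OF h(1)])
      show "g (y \<otimes>\<^bsub>B\<^esub> y') = g y \<otimes>\<^bsub>A\<^esub> g y'"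
        using x x' by (simp add: gh flip: ring_hom_mult[OF h(1)])
    qed
    show "g \<one>\<^bsub>B\<^esub> = \<one>\<^bsub>A\<^esub>"
      using gh[OF A.one_closed] ring_hom_one[OF h(1)] by simp
  qed
qed

lemma algebra_isomorphic_trans:
  assumes "algebra_isomorphic K A B" "algebra_isomorphic K B C"
  shows "algebra_isomorphic K A C"
proof -
  from assms obtain h g where h: "h \<in> ring_iso A B" "g \<in> ring_iso B C"
    and sm: "\<forall>a\<in>carrier K. \<forall>x\<in>carrier A. h (a \<odot>\<^bsub>A\<^esub> x) = a \<odot>\<^bsub>B\<^esub> h x"
      "\<forall>a\<in>carrier K. \<forall>x\<in>carrier B. g (a \<odot>\<^bsub>B\<^esub> x) = a \<odot>\<^bsub>C\<^esub> g x"
    unfolding algebra_isomorphic_def by blast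
  have "h x \<in> carrier B" if "x \<in> carrier A" for x
    using h(1) that unfolding ring_iso_def by (auto dest: ring_hom_closed)
  then show ?thesis
    unfolding algebra_isomorphic_def
    by (intro bexI[OF _ ring_iso_set_trans[OF h]]) (use sm in auto)
qed

lemma (in leavitt_family) presentation: "leavitt_presentation K E"
  by unfold_locales

text \<open>Left multiplication by long enough products of the \<open>T e\<close> brings every element of the Leavitt path
  algebra into the span of the ghost paths, and only \<open>0\<close> is killed by all of them.  So a homomorphism
  that is injective on the span of the ghost paths is injective.\<close>

lemma (in leavitt_family) leavitt_embedding:
  assumes "faithful"
  obtains h where "nonunital_hom K (leavitt_path_algebra K E) A h"
    and "inj_on h (carrier (leavitt_path_algebra K E))"
    and "h ` carrier (leavitt_path_algebra K E) = generated"
    and "h \<one>\<^bsub>leavitt_path_algebra K E\<^esub> = unit"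
    and "\<forall>v\<in>verts E. h (leavitt_presentation.LV K E v) = P v"
proof -
  interpret X: leavitt_presentation K E by (rule presentation)
  obtain h where h: "nonunital_hom K X.L A h" and hP: "\<And>v. v \<in> verts E \<Longrightarrow> h (X.LV v) = P v"
    and hS: "\<And>e. e \<in> arcs E \<Longrightarrow> h (X.LE e) = S e" and hT: "\<And>e. e \<in> arcs E \<Longrightarrow> h (X.LG e) = T e"
    using X.universal_property[OF leavitt_family_axioms] by blast
  note hom = nonunital_homD[OF h] nonunital_hom_zero[OF X.L.kalgebra_axioms kalgebra_axioms h]
  have ker0: "a = \<zero>\<^bsub>X.L\<^esub>" if a: "a \<in> X.L.ghosts" "h a = \<zero>" for a
  proof -
    note ac = X.L.ghosts_carrier[OF a(1)]
    have z: "X.LV x \<otimes>\<^bsub>X.L\<^esub> (a \<otimes>\<^bsub>X.L\<^esub> X.LV y) = \<zero>\<^bsub>X.L\<^esub>" if xy: "x \<in> verts E" "y \<in> verts E" for x y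
    proof -
      obtain f where f: "f \<in> ghost_coeffs K E x y"
        "X.LV x \<otimes>\<^bsub>X.L\<^esub> (a \<otimes>\<^bsub>X.L\<^esub> X.LV y) = X.L.eval_ghost f \<otimes>\<^bsub>X.L\<^esub> X.LV y"
        using X.L.ghostsE[OF a(1) xy] by blast
      note fc = K.ghost_coeffs_carrier[OF f(1)]
      have "eval_ghost f \<otimes> P y = eval_free K A (h \<circ> X.LG) f \<otimes> P y"
        using eval_free_cong[OF fc T_funcset, of "h \<circ> X.LG"] hT by simp
      also have "\<dots> = h (X.L.eval_ghost f \<otimes>\<^bsub>X.L\<^esub> X.LV y)"
        using nonunital_hom_eval_free[OF X.L.kalgebra_axioms kalgebra_axioms h fc X.L.T_funcset
            X.L.P_closed[OF xy(2)]] hP[OF xy(2)] by simp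
      also have "\<dots> = \<zero>" unfolding f(2)[symmetric] using ac a(2) xy by (simp add: hom hP)
      finally have "f = \<zero>\<^bsub>free_algebra K (arcs E)\<^esub>" using assms f(1) xy unfolding faithful_def by blast
      then show ?thesis unfolding f(2) using xy by (simp add: X.L.eval_free_zero[OF X.L.T_funcset])
    qed
    have "X.LV x \<otimes>\<^bsub>X.L\<^esub> a = \<zero>\<^bsub>X.L\<^esub>" if x: "x \<in> verts E" for x
    proof -
      have "X.LV x \<otimes>\<^bsub>X.L\<^esub> a = (X.LV x \<otimes>\<^bsub>X.L\<^esub> a) \<otimes>\<^bsub>X.L\<^esub> X.L.unit"
        using X.L.ghosts_unit_right[OF a(1)] ac x by (simp add: X.L.m_assoc)
      also have "\<dots> = (\<Oplus>\<^bsub>X.L\<^esub>y\<in>verts E. (X.LV x \<otimes>\<^bsub>X.L\<^esub> a) \<otimes>\<^bsub>X.L\<^esub> X.LV y)"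
        using ac x by (intro X.L.unit_right) auto
      also have "\<dots> = \<zero>\<^bsub>X.L\<^esub>"
        using z[OF x] ac x by (intro X.L.add.finprod_one_eqI) (simp add: X.L.m_assoc)
      finally show ?thesis .
    qed
    then have "(\<Oplus>\<^bsub>X.L\<^esub>x\<in>verts E. X.LV x \<otimes>\<^bsub>X.L\<^esub> a) = \<zero>\<^bsub>X.L\<^esub>"
      by (intro X.L.add.finprod_one_eqI) auto
    then show ?thesis using X.L.unit_left[OF ac] X.L.ghosts_unit_left[OF a(1)] by simp
  qed
  have ker: "a = \<zero>\<^bsub>X.L\<^esub>" if "a \<in> X.L.reducible n" "h a = \<zero>" for a n
    using that
  proof (induct n arbitrary: a)
    case 0
    then show ?case using ker0 by simp
  next
    case (Suc n)
    then have ac: "a \<in> carrier X.L" by simp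
    show ?case
    proof (rule X.L.eq_zeroI[OF ac])
      show "X.L.unit \<otimes>\<^bsub>X.L\<^esub> a = a" using Suc(2) by simp
      show "X.LG e \<otimes>\<^bsub>X.L\<^esub> a = \<zero>\<^bsub>X.L\<^esub>" if "e \<in> arcs E" for e
        using Suc that ac by (auto simp: hom hT)
      show "X.LV w \<otimes>\<^bsub>X.L\<^esub> a = \<zero>\<^bsub>X.L\<^esub>" if "w \<in> verts E" "out_arcs E w = {}" for w
        using Suc(2,3) that ac by (intro ker0) (auto simp: hom hP)
    qed
  qed
  have inj: "inj_on h (carrier X.L)"
  proof (rule inj_onI)
    fix a b assume ab: "a \<in> carrier X.L" "b \<in> carrier X.L" "h a = h b"
    let ?d = "a \<oplus>\<^bsub>X.L\<^esub> (\<ominus>\<^bsub>K\<^esub> \<one>\<^bsub>K\<^esub>) \<odot>\<^bsub>X.L\<^esub> b"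
    have "h ?d = h b \<oplus> (\<ominus>\<^bsub>K\<^esub> \<one>\<^bsub>K\<^esub>) \<odot> h b" using ab by (simp add: hom)
    also have "\<dots> = \<zero>" using ab by (simp add: hom minus_one_smult r_neg)
    finally have "h ?d = \<zero>" .
    moreover have "?d \<in> X.L.generated" using ab by (intro X.L_generated) auto
    ultimately have "?d = \<zero>\<^bsub>X.L\<^esub>" using X.L.generated_imp_reducible ker by blast
    then have "a \<ominus>\<^bsub>X.L\<^esub> b = \<zero>\<^bsub>X.L\<^esub>" using ab by (simp add: X.L.minus_one_smult X.L.minus_eq)
    then show "a = b" using ab(1,2) by (rule X.L.eq_if_minus_zero)
  qed
  have "h a \<in> generated" if "a \<in> X.L.generated" for a
    using that
    by (induct rule: X.L.generated.induct)
      (auto simp: hom hP hS hT X.L.generated_carrier intro: generated.intros)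
  moreover have "b \<in> h ` carrier X.L" if "b \<in> generated" for b
    using that
  proof (induct rule: generated.induct)
    case zero
    then show ?case by (intro image_eqI[of _ _ "\<zero>\<^bsub>X.L\<^esub>"]) (auto simp: hom)
  next
    case (P v)
    then show ?case by (intro image_eqI[of _ _ "X.LV v"]) (auto simp: hP)
  next
    case (S e)
    then show ?case by (intro image_eqI[of _ _ "X.LE e"]) (auto simp: hS)
  next
    case (T e)
    then show ?case by (intro image_eqI[of _ _ "X.LG e"]) (auto simp: hT)
  next
    case (add x y)
    then obtain x' y' where "x' \<in> carrier X.L" "y' \<in> carrier X.L" "x = h x'" "y = h y'" by auto
    then show ?case by (intro image_eqI[of _ _ "x' \<oplus>\<^bsub>X.L\<^esub> y'"]) (auto simp: hom)
  next
    case (smult k x)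
    then obtain x' where "x' \<in> carrier X.L" "x = h x'" by auto
    then show ?case using smult by (intro image_eqI[of _ _ "k \<odot>\<^bsub>X.L\<^esub> x'"]) (auto simp: hom)
  next
    case (mult x y)
    then obtain x' y' where "x' \<in> carrier X.L" "y' \<in> carrier X.L" "x = h x'" "y = h y'" by auto
    then show ?case by (intro image_eqI[of _ _ "x' \<otimes>\<^bsub>X.L\<^esub> y'"]) (auto simp: hom)
  qed
  ultimately have img: "h ` carrier X.L = generated" using X.L_generated by blast
  have "h \<one>\<^bsub>X.L\<^esub> = (\<Oplus>v\<in>verts E. h (X.LV v))"
    unfolding X.unit_L[symmetric] X.L.unit_def
    by (intro nonunital_hom_finsum[OF X.L.kalgebra_axioms kalgebra_axioms h]) auto
  also have "\<dots> = unit" unfolding unit_def by (intro finsum_cong') (auto simp: hP)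
  finally have "h \<one>\<^bsub>X.L\<^esub> = unit" .
  moreover have "\<forall>v\<in>verts E. h (X.LV v) = P v" using hP by blast
  ultimately show thesis using h inj img by (intro that)
qed

lemma (in leavitt_family) corner_unit_isomorphic:
  assumes "faithful" "full"
  shows "algebra_isomorphic K (corner A unit) (leavitt_path_algebra K E)"
proof -
  interpret X: leavitt_presentation K E by (rule presentation)
  obtain h where h: "nonunital_hom K X.L A h" "inj_on h (carrier X.L)" "h ` carrier X.L = generated"
    "h \<one>\<^bsub>X.L\<^esub> = unit"
    using leavitt_embedding[OF assms(1)] by metis
  have c: "carrier (corner A unit) = generated"
    using assms(2) unfolding full_def
    by (auto simp: generated_carrier generated_unit_left generated_unit_right)
  have "nonunital_hom K X.L (corner A unit) h"
    using h(1,3) unfolding nonunital_hom_def c by auto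
  moreover have "bij_betw h (carrier X.L) (carrier (corner A unit))"
    unfolding c using h(2,3) by (simp add: bij_betw_def)
  ultimately have "algebra_isomorphic K X.L (corner A unit)"
    by (intro algebra_isomorphicI) (use h(4) in auto)
  then show ?thesis by (rule algebra_isomorphic_sym[OF X.L.kalgebra_axioms])
qed


section \<open>Subfamilies of hereditary subgraphs\<close>

text \<open>The image of \<open>G\<close> is a hereditary subgraph of \<open>E\<close>: every edge of \<open>E\<close> that starts in it belongs to it.
  The maps also serve to rename vertices and edges.\<close>

locale hereditary_embedding = leavitt_family K A E P S T + G: fin_digraph G
  for K :: "('k, 'c) ring_scheme" and A :: "('k, 'a, 'm) module_scheme" (structure)
    and E :: "('v, 'e) pre_digraph" and P :: "'v \<Rightarrow> 'a" and S T :: "'e \<Rightarrow> 'a"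
    and G :: "('w, 'f) pre_digraph" +
  fixes \<nu> :: "'w \<Rightarrow> 'v" and \<epsilon> :: "'f \<Rightarrow> 'e"
  assumes \<nu>_inj: "inj_on \<nu> (verts G)" and \<nu>_verts [simp]: "v \<in> verts G \<Longrightarrow> \<nu> v \<in> verts E"
    and \<epsilon>_inj: "inj_on \<epsilon> (arcs G)" and \<epsilon>_arcs [simp]: "e \<in> arcs G \<Longrightarrow> \<epsilon> e \<in> arcs E"
    and \<epsilon>_tail [simp]: "e \<in> arcs G \<Longrightarrow> tail E (\<epsilon> e) = \<nu> (tail G e)"
    and \<epsilon>_head [simp]: "e \<in> arcs G \<Longrightarrow> head E (\<epsilon> e) = \<nu> (head G e)"
    and out_arcs_lift: "\<lbrakk>v \<in> verts G; d \<in> arcs E; tail E d = \<nu> v\<rbrakk> \<Longrightarrow> d \<in> \<epsilon> ` arcs G"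
begin

lemma out_arcs_image: "v \<in> verts G \<Longrightarrow> out_arcs E (\<nu> v) = \<epsilon> ` out_arcs G v"
  using out_arcs_lift \<nu>_inj by (fastforce simp: out_arcs_def dest: inj_onD)

sublocale sub: leavitt_family K A G "\<lambda>v. P (\<nu> v)" "\<lambda>e. S (\<epsilon> e)" "\<lambda>e. T (\<epsilon> e)"
proof unfold_locales
  fix v assume v: "v \<in> verts G" "out_arcs G v \<noteq> {}"
  have "P (\<nu> v) = (\<Oplus>e\<in>out_arcs E (\<nu> v). S e \<otimes> T e)"
    using v by (intro sum_S_T) (auto simp: out_arcs_image simp del: in_out_arcs_conv)
  also have "\<dots> = (\<Oplus>e\<in>out_arcs G v. S (\<epsilon> e) \<otimes> T (\<epsilon> e))"
    unfolding out_arcs_image[OF v(1)]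
    by (intro finsum_reindex) (auto intro!: inj_on_subset[OF \<epsilon>_inj])
  finally show "P (\<nu> v) = (\<Oplus>e\<in>out_arcs G v. S (\<epsilon> e) \<otimes> T (\<epsilon> e))" .
qed (use \<nu>_inj \<epsilon>_inj in \<open>auto simp: rels inj_on_def\<close>)

lemma ghost_path_image: "ghost_path G x u y \<Longrightarrow> ghost_path E (\<nu> x) (map \<epsilon> u) (\<nu> y)"
proof (induct rule: ghost_path.induct)
  case (Cons e u y)
  then show ?case using ghost_path.Cons[of "\<epsilon> e" E "map \<epsilon> u" "\<nu> y"] by simp
qed auto

lemma sub_faithful: "faithful \<Longrightarrow> sub.faithful"
  unfolding sub.faithful_def
proof (intro ballI impI)
  assume faithful
  fix x y f assume xy: "x \<in> verts G" "y \<in> verts G" and f: "f \<in> ghost_coeffs K G x y"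
    and zero: "sub.eval_ghost f \<otimes> P (\<nu> y) = \<zero>"
  note fc = K.ghost_coeffs_carrier[OF f] and fp = K.ghost_coeffs_path[OF f]
  have arcs: "set w \<subseteq> arcs G" if "f w \<noteq> \<zero>\<^bsub>K\<^esub>" for w using fp[OF that] by (rule ghost_path_arcs)
  obtain g where g: "g \<in> carrier (free_algebra K (arcs E))"
    "\<And>z. g z \<noteq> \<zero>\<^bsub>K\<^esub> \<Longrightarrow> \<exists>w. z = map \<epsilon> w \<and> f w \<noteq> \<zero>\<^bsub>K\<^esub>"
    "sub.eval_ghost f \<otimes> P (\<nu> y) = \<one> \<otimes> (eval_ghost g \<otimes> P (\<nu> y))"
    "g = \<zero>\<^bsub>free_algebra K (arcs E)\<^esub> \<Longrightarrow> f = \<zero>\<^bsub>free_algebra K (arcs G)\<^esub>"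
  proof (rule eval_free_push[OF fc sub.T_funcset T_funcset])
    show "inj_on (map \<epsilon>) {w. f w \<noteq> \<zero>\<^bsub>K\<^esub>}"
      using arcs by (intro inj_on_mapI inj_on_subset[OF \<epsilon>_inj]) auto
    show "set (map \<epsilon> w) \<subseteq> arcs E" if "f w \<noteq> \<zero>\<^bsub>K\<^esub>" for w
      using arcs[OF that] by auto
    show "eval_word A (\<lambda>e. T (\<epsilon> e)) w \<otimes> P (\<nu> y) = \<one> \<otimes> (eval_word A T (map \<epsilon> w) \<otimes> P (\<nu> y))"
      if "f w \<noteq> \<zero>\<^bsub>K\<^esub>" for w
    proof -
      have "eval_word A (\<lambda>e. T (\<epsilon> e)) u = eval_word A T (map \<epsilon> u)" for u by (induct u) auto
      moreover have "eval_word A T (map \<epsilon> w) \<in> carrier A"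
        using arcs[OF that] by (intro eval_word_closed) auto
      ultimately show ?thesis using xy by simp
    qed
  qed (use xy in auto)
  have gE: "g \<in> ghost_coeffs K E (\<nu> x) (\<nu> y)"
    using g(1,2) fp ghost_path_image unfolding ghost_coeffs_def by blast
  moreover have "eval_ghost g \<otimes> P (\<nu> y) = \<zero>" using zero g(3) gE xy by simp
  ultimately have "g = \<zero>\<^bsub>free_algebra K (arcs E)\<^esub>"
    using \<open>faithful\<close> \<nu>_verts[OF xy(1)] \<nu>_verts[OF xy(2)] unfolding faithful_def by blast
  then show "f = \<zero>\<^bsub>free_algebra K (arcs G)\<^esub>" by (rule g(4))
qed

lemma sub_unit_unit: "sub.unit \<otimes> unit = sub.unit" "unit \<otimes> sub.unit = sub.unit"
proof -
  have "sub.unit \<otimes> unit = (\<Oplus>v\<in>verts G. P (\<nu> v) \<otimes> unit)"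
    unfolding sub.unit_def by (intro finsum_ldistr) auto
  also have "\<dots> = sub.unit" unfolding sub.unit_def by (intro finsum_cong') auto
  finally show "sub.unit \<otimes> unit = sub.unit" .
  have "unit \<otimes> sub.unit = (\<Oplus>v\<in>verts G. unit \<otimes> P (\<nu> v))"
    unfolding sub.unit_def by (intro finsum_rdistr) auto
  also have "\<dots> = sub.unit" unfolding sub.unit_def by (intro finsum_cong') auto
  finally show "unit \<otimes> sub.unit = sub.unit" .
qed

lemma ghost_path_generated:
  assumes "ghost_path E a u b" "b \<in> \<nu> ` verts G"
  shows "a \<in> \<nu> ` verts G \<and> eval_word A T u \<otimes> P b \<in> sub.generated"
  using assms
proof (induct rule: ghost_path.induct)
  case (Nil x)
  then show ?case using sub.generated.P by auto
next
  case (Cons e u y)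
  then obtain v where v: "v \<in> verts G" "tail E e = \<nu> v" by auto
  then obtain e' where e': "e' \<in> arcs G" "e = \<epsilon> e'" using out_arcs_lift Cons(1) by blast
  have "eval_word A T u \<in> carrier A"
    using ghost_path_arcs[OF Cons(2)] by (intro eval_word_closed) auto
  then have "eval_word A T (e # u) \<otimes> P y = T (\<epsilon> e') \<otimes> (eval_word A T u \<otimes> P y)"
    using Cons(1,4) e' ghost_path_end[OF Cons(2)] by (simp add: m_assoc)
  then show ?case using Cons e' sub.generated.T[OF e'(1)] by (auto intro: sub.generated.mult)
qed

text \<open>A path that starts in a hereditary set of vertices stays in it, so the ghost paths that end in it
  belong to the subgraph.\<close>

lemma sub_generated_ghosts:
  assumes x: "x \<in> ghosts" "sub.unit \<otimes> x = x"
  shows "x \<otimes> sub.unit \<in> sub.generated"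
proof -
  note xc = ghosts_carrier[OF x(1)]
  note closed = sub.generated.zero sub.generated.add subsetI[OF sub.generated_carrier]
  have 1: "P (\<nu> a) \<otimes> (x \<otimes> P (\<nu> b)) \<in> sub.generated" if ab: "a \<in> verts G" "b \<in> verts G" for a b
  proof -
    obtain f where f: "f \<in> ghost_coeffs K E (\<nu> a) (\<nu> b)"
      "P (\<nu> a) \<otimes> (x \<otimes> P (\<nu> b)) = eval_ghost f \<otimes> P (\<nu> b)"
      using ghostsE[OF x(1)] ab by (metis \<nu>_verts)
    have "eval_ghost f \<otimes> P (\<nu> b) \<in> sub.generated"
      using K.ghost_coeffs_carrier[OF f(1)]
    proof (induct rule: K.free_algebra_support_induct[where N = "\<lambda>w. ghost_path E (\<nu> a) w (\<nu> b)"])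
      case (support w)
      then show ?case by (rule K.ghost_coeffs_path[OF f(1)])
    next
      case zero
      then show ?case using ab sub.generated.zero by (simp add: eval_free_zero[OF T_funcset])
    next
      case (add k u g)
      note c = eval_free_closed[OF T_funcset] eval_word_in_carrier[OF T_funcset] K.word_closed
        K.free_algebra_smult_closed
      have "eval_word A T u \<otimes> P (\<nu> b) \<in> sub.generated"
        using ghost_path_generated[OF add(3)] ab by blast
      with add ab have "k \<odot> (eval_word A T u \<otimes> P (\<nu> b)) \<oplus> eval_ghost g \<otimes> P (\<nu> b) \<in> sub.generated"
        by (intro sub.generated.add sub.generated.smult)
      with add ab show ?case
        by (simp add: c eval_free_add[OF T_funcset] eval_free_smult[OF T_funcset]
            eval_free_word1[OF T_funcset] l_distr smult_mult_l)
    qed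
    then show ?thesis using f(2) by simp
  qed
  have 2: "P (\<nu> a) \<otimes> (x \<otimes> sub.unit) \<in> sub.generated" if a: "a \<in> verts G" for a
  proof -
    have "P (\<nu> a) \<otimes> (x \<otimes> sub.unit) = (\<Oplus>b\<in>verts G. (P (\<nu> a) \<otimes> x) \<otimes> P (\<nu> b))"
      using a xc sub.unit_right[of "P (\<nu> a) \<otimes> x"] by (simp add: m_assoc)
    then show ?thesis
      using 1[OF a] a xc by (auto simp: m_assoc intro!: finsum_in_subset[OF closed])
  qed
  have "x \<otimes> sub.unit = sub.unit \<otimes> (x \<otimes> sub.unit)"
    using x xc by (simp flip: m_assoc)
  also have "\<dots> = (\<Oplus>a\<in>verts G. P (\<nu> a) \<otimes> (x \<otimes> sub.unit))"
    using xc by (intro sub.unit_left) auto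
  also have "\<dots> \<in> sub.generated"
    using 2 by (intro finsum_in_subset[OF closed]) auto
  finally show ?thesis .
qed

lemma sub_generated_reducible:
  assumes "x \<in> reducible n" "sub.unit \<otimes> x = x"
  shows "x \<otimes> sub.unit \<in> sub.generated"
  using assms
proof (induct n arbitrary: x)
  case 0
  then show ?case using sub_generated_ghosts by simp
next
  case (Suc n)
  then have xc: "x \<in> carrier A" by simp
  show ?case
  proof (rule sub.in_subsetI[OF sub.generated.zero sub.generated.add subsetI[OF sub.generated_carrier]])
    show "x \<otimes> sub.unit \<in> carrier A" using xc by simp
    show "sub.unit \<otimes> (x \<otimes> sub.unit) = x \<otimes> sub.unit" using xc Suc(3) by (simp flip: m_assoc)
    fix e assume e: "e \<in> arcs G"
    have "sub.unit \<otimes> (T (\<epsilon> e) \<otimes> x) = T (\<epsilon> e) \<otimes> x" using e xc by (simp flip: m_assoc)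
    then have "(T (\<epsilon> e) \<otimes> x) \<otimes> sub.unit \<in> sub.generated"
      using Suc e by simp
    then have "S (\<epsilon> e) \<otimes> ((T (\<epsilon> e) \<otimes> x) \<otimes> sub.unit) \<in> sub.generated"
      by (rule sub.generated.mult[OF sub.generated.S[OF e]])
    then show "S (\<epsilon> e) \<otimes> (T (\<epsilon> e) \<otimes> (x \<otimes> sub.unit)) \<in> sub.generated"
      using e xc by (simp add: m_assoc)
  next
    fix w assume w: "w \<in> verts G" "out_arcs G w = {}"
    then have "out_arcs E (\<nu> w) = {}" by (simp add: out_arcs_image)
    then have "P (\<nu> w) \<otimes> x \<in> ghosts" using Suc(2) w by simp
    moreover have "sub.unit \<otimes> (P (\<nu> w) \<otimes> x) = P (\<nu> w) \<otimes> x" using w xc by (simp flip: m_assoc)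
    ultimately have "(P (\<nu> w) \<otimes> x) \<otimes> sub.unit \<in> sub.generated" by (rule sub_generated_ghosts)
    then show "P (\<nu> w) \<otimes> (x \<otimes> sub.unit) \<in> sub.generated" using w xc by (simp add: m_assoc)
  qed
qed

lemma sub_full: "full \<Longrightarrow> sub.full"
  unfolding sub.full_def
proof (intro ballI impI)
  assume full
  fix x assume x: "x \<in> carrier A" "sub.unit \<otimes> (x \<otimes> sub.unit) = x"
  then have x': "sub.unit \<otimes> x = x" "x \<otimes> sub.unit = x" by (simp_all add: corner_iff)
  have "unit \<otimes> x = x"
    using x' x(1) sub_unit_unit m_assoc[of unit sub.unit x] by simp
  moreover have "x \<otimes> unit = x"
    using x' x(1) sub_unit_unit m_assoc[of x sub.unit unit] by simp
  ultimately have "x \<in> generated" using \<open>full\<close> x(1) unfolding full_def by simp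
  then obtain n where "x \<in> reducible n" using generated_imp_reducible by blast
  then show "x \<in> sub.generated" using sub_generated_reducible x' by fastforce
qed

end


section \<open>Splitting off an edge\<close>

text \<open>The edge \<open>f\<close> is deleted, and for every edge \<open>g\<close> into the source \<open>u\<close> of \<open>f\<close> there is a new edge, the path
  \<open>g f\<close>, which is named \<open>g + m\<close>; here \<open>m\<close> exceeds all edges.  If \<open>u\<close> emits only \<open>f\<close>, it is deleted
  together with the edges that enter it.\<close>

definition splice :: "('v, nat) pre_digraph \<Rightarrow> nat \<Rightarrow> nat \<Rightarrow> ('v, nat) pre_digraph"
  where "splice E f m = (let V = verts E - (if out_arcs E (tail E f) = {f} then {tail E f} else {}) in
    \<lparr>verts = V,
     arcs = {g \<in> arcs E. g \<noteq> f \<and> head E g \<in> V} \<union> (\<lambda>g. g + m) ` {g \<in> arcs E. head E g = tail E f},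
     tail = (\<lambda>x. tail E (if x < m then x else x - m)),
     head = (\<lambda>x. if x < m then head E x else head E f)\<rparr>)"

text \<open>The family of the spliced graph: \<open>u\<close> becomes the idempotent \<open>P u - q\<close>, where \<open>q = S f \<otimes> T f\<close> is
  equivalent to \<open>P v\<close>.  If \<open>u\<close> emits only \<open>f\<close>, this idempotent is zero, which is why \<open>u\<close> is deleted then.\<close>

locale splitting = leavitt_family K A E P S T
  for K :: "('k, 'c) ring_scheme" and A :: "('k, 'a, 'm) module_scheme" (structure)
    and E :: "('v, nat) pre_digraph" and P :: "'v \<Rightarrow> 'a" and S T :: "nat \<Rightarrow> 'a" +
  fixes f m :: nat
  assumes f_arc [simp]: "f \<in> arcs E" and not_loop: "tail E f \<noteq> head E f"
    and arcs_less: "g \<in> arcs E \<Longrightarrow> g < m"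
begin

abbreviation u where "u \<equiv> tail E f"
abbreviation v where "v \<equiv> head E f"
abbreviation F where "F \<equiv> splice E f m"

definition q where "q = S f \<otimes> T f"
definition P' where "P' w = (if w = u then P u \<oplus> \<ominus> q else P w)"
definition S' where "S' x = (if x < m then S x \<otimes> P' (head E x) else S (x - m) \<otimes> S f)"
definition T' where "T' x = (if x < m then P' (head E x) \<otimes> T x else T f \<otimes> T (x - m))"

lemma verts_F: "verts F = verts E - (if out_arcs E u = {f} then {u} else {})"
  and arcs_F: "arcs F = {g \<in> arcs E. g \<noteq> f \<and> head E g \<in> verts F} \<union> (\<lambda>g. g + m) ` {g \<in> arcs E. head E g = u}"
  and tail_F: "tail F x = tail E (if x < m then x else x - m)"
  and head_F: "head F x = (if x < m then head E x else v)"
  by (simp_all add: splice_def Let_def)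

lemma v_F [simp]: "v \<in> verts F"
  using not_loop by (simp add: verts_F)

lemma verts_F_E: "w \<in> verts F \<Longrightarrow> w \<in> verts E"
  by (simp add: verts_F)

lemma tail_in_F: "\<lbrakk>g \<in> arcs E; g \<noteq> f\<rbrakk> \<Longrightarrow> tail E g \<in> verts F"
proof -
  assume g: "g \<in> arcs E" "g \<noteq> f"
  then have "g \<in> out_arcs E (tail E g)" by simp
  then have "\<not> (tail E g = u \<and> out_arcs E u = {f})" using g(2) by (metis singletonD)
  then show ?thesis using g(1) unfolding verts_F by (simp, blast)
qed

lemma arcs_F_cases:
  assumes "x \<in> arcs F"
  obtains (old) "x < m" "x \<in> arcs E" "x \<noteq> f" "head E x \<in> verts F"
    | (new) g where "x = g + m" "g \<in> arcs E" "g \<noteq> f" "head E g = u"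
proof -
  from assms consider "x \<in> arcs E" "x \<noteq> f" "head E x \<in> verts F"
    | g where "x = g + m" "g \<in> arcs E" "head E g = u"
    unfolding arcs_F by blast
  then show thesis
  proof cases
    case 1
    then show thesis using old arcs_less by blast
  next
    case (2 g)
    then have "g \<noteq> f" using not_loop by auto
    then show thesis using new 2 by blast
  qed
qed

lemma not_less [simp]: "\<not> g + m < m" by simp

lemma fin_digraph_F: "fin_digraph F"
proof
  show "finite (verts F)" by (simp add: verts_F)
  show "finite (arcs F)" by (simp add: arcs_F)
  fix x assume "x \<in> arcs F"
  then show "tail F x \<in> verts F" "head F x \<in> verts F"
    by (cases rule: arcs_F_cases; simp add: tail_F head_F tail_in_F)+
qed

lemma q_closed [simp]: "q \<in> carrier A" by (simp add: q_def)

lemma q_rels: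
  "P u \<otimes> q = q" "q \<otimes> P u = q" "q \<otimes> q = q" "q \<otimes> S f = S f" "T f \<otimes> q = T f"
  "unit \<otimes> q = q" "q \<otimes> unit = q"
  by (simp_all add: q_def rels m_assoc) (simp add: rels flip: m_assoc)+

lemma q_rels0:
  "\<lbrakk>w \<in> verts E; w \<noteq> u\<rbrakk> \<Longrightarrow> P w \<otimes> q = \<zero>" "\<lbrakk>w \<in> verts E; w \<noteq> u\<rbrakk> \<Longrightarrow> q \<otimes> P w = \<zero>"
  "\<lbrakk>g \<in> arcs E; g \<noteq> f\<rbrakk> \<Longrightarrow> q \<otimes> S g = \<zero>" "\<lbrakk>g \<in> arcs E; g \<noteq> f\<rbrakk> \<Longrightarrow> T g \<otimes> q = \<zero>"
  by (simp_all add: q_def rels m_assoc)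

lemma P'_closed [simp]: "w \<in> verts E \<Longrightarrow> P' w \<in> carrier A"
  by (simp add: P'_def)

lemma P'_v [simp]: "P' v = P v"
  using not_loop by (simp add: P'_def)

lemma P'_removed: "\<lbrakk>w \<in> verts E; w \<notin> verts F\<rbrakk> \<Longrightarrow> P' w = \<zero>"
proof -
  assume "w \<in> verts E" "w \<notin> verts F"
  then have w: "w = u" "out_arcs E u = {f}" by (auto simp: verts_F split: if_splits)
  then have "P u = (\<Oplus>e\<in>{f}. S e \<otimes> T e)" by (subst sum_S_T) auto
  also have "\<dots> = q" by (simp add: q_def)
  finally show ?thesis using w by (simp add: P'_def r_neg)
qed

lemma P'_P: "\<lbrakk>w \<in> verts E; z \<in> verts E\<rbrakk> \<Longrightarrow> P' w \<otimes> P z = (if w = z then P' w else \<zero>)"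
  and P_P': "\<lbrakk>w \<in> verts E; z \<in> verts E\<rbrakk> \<Longrightarrow> P z \<otimes> P' w = (if w = z then P' w else \<zero>)"
  by (auto simp: P'_def P_P l_distr r_distr l_minus r_minus q_rels q_rels0)

lemma P'_q: "w \<in> verts E \<Longrightarrow> P' w \<otimes> q = \<zero>" and q_P': "w \<in> verts E \<Longrightarrow> q \<otimes> P' w = \<zero>"
  by (auto simp: P'_def l_distr r_distr l_minus r_minus q_rels q_rels0 r_neg)

lemma P'_P': "\<lbrakk>w \<in> verts E; z \<in> verts E\<rbrakk> \<Longrightarrow> P' w \<otimes> P' z = (if w = z then P' w else \<zero>)"
proof -
  assume wz: "w \<in> verts E" "z \<in> verts E"
  have "P' w \<otimes> P' z = P' w \<otimes> P z"
    using wz P'_q[OF wz(1)] by (simp add: P'_def[of z] r_distr r_minus)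
  then show ?thesis using wz by (simp add: P'_P)
qed

lemma P'_S: "\<lbrakk>w \<in> verts E; g \<in> arcs E; g \<noteq> f\<rbrakk> \<Longrightarrow> P' w \<otimes> S g = (if w = tail E g then S g else \<zero>)"
  by (auto simp: P'_def l_distr l_minus q_rels0 P_S)

lemma P'_Sf: "w \<in> verts E \<Longrightarrow> P' w \<otimes> S f = \<zero>"
  by (auto simp: P'_def l_distr l_minus q_rels P_S r_neg)

lemma T_P': "\<lbrakk>w \<in> verts E; g \<in> arcs E; g \<noteq> f\<rbrakk> \<Longrightarrow> T g \<otimes> P' w = (if w = tail E g then T g else \<zero>)"
  by (auto simp: P'_def r_distr r_minus q_rels0 T_P)

lemma Tf_P': "w \<in> verts E \<Longrightarrow> T f \<otimes> P' w = \<zero>"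
  by (auto simp: P'_def r_distr r_minus q_rels T_P r_neg)

lemma S'_simps [simp]:
  "g \<in> arcs E \<Longrightarrow> S' g = S g \<otimes> P' (head E g)" "S' (g + m) = S g \<otimes> S f"
  "g \<in> arcs E \<Longrightarrow> T' g = P' (head E g) \<otimes> T g" "T' (g + m) = T f \<otimes> T g"
  using arcs_less by (simp_all add: S'_def T'_def)

lemma P'_assoc:
  assumes "x \<in> carrier A"
  shows "\<lbrakk>w \<in> verts E; z \<in> verts E\<rbrakk> \<Longrightarrow> P' w \<otimes> (P' z \<otimes> x) = (if w = z then P' w \<otimes> x else \<zero>)"
    and "\<lbrakk>w \<in> verts E; z \<in> verts E\<rbrakk> \<Longrightarrow> P' w \<otimes> (P z \<otimes> x) = (if w = z then P' w \<otimes> x else \<zero>)"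
    and "\<lbrakk>w \<in> verts E; z \<in> verts E\<rbrakk> \<Longrightarrow> P z \<otimes> (P' w \<otimes> x) = (if w = z then P' w \<otimes> x else \<zero>)"
    and "\<lbrakk>w \<in> verts E; g \<in> arcs E; g \<noteq> f\<rbrakk> \<Longrightarrow> P' w \<otimes> (S g \<otimes> x) = (if w = tail E g then S g \<otimes> x else \<zero>)"
    and "\<lbrakk>w \<in> verts E; g \<in> arcs E; g \<noteq> f\<rbrakk> \<Longrightarrow> T g \<otimes> (P' w \<otimes> x) = (if w = tail E g then T g \<otimes> x else \<zero>)"
    and "w \<in> verts E \<Longrightarrow> P' w \<otimes> (S f \<otimes> x) = \<zero>" and "w \<in> verts E \<Longrightarrow> T f \<otimes> (P' w \<otimes> x) = \<zero>"
  using assms by (simp_all add: P'_P' P'_P P_P' P'_S T_P' P'_Sf Tf_P' flip: m_assoc)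

text \<open>An edge \<open>g\<close> into \<open>u\<close> contributes \<open>S g \<otimes> P u \<otimes> T g\<close> to the relation at its source; the summands
  \<open>P u - q\<close> and \<open>q\<close> of \<open>P u\<close> give the contributions of the edges \<open>g\<close> and \<open>g + m\<close> of the new graph.\<close>

lemma S'_T'_sum:
  assumes w: "w \<in> verts F" "out_arcs F w \<noteq> {}"
  shows "P' w = (\<Oplus>x\<in>out_arcs F w. S' x \<otimes> T' x)"
proof -
  let ?D = "out_arcs E w - {f}"
  let ?D1 = "{g \<in> ?D. head E g \<in> verts F}" and ?D2 = "{g \<in> ?D. head E g = u}"
  have fin: "finite ?D" by auto
  have wE: "w \<in> verts E" using w(1) by (rule verts_F_E)
  have S: "out_arcs F w = ?D1 \<union> (\<lambda>g. g + m) ` ?D2"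
  proof (intro equalityI subsetI)
    fix x assume "x \<in> out_arcs F w"
    then have x: "x \<in> arcs F" "tail F x = w" by auto
    from x(1) show "x \<in> ?D1 \<union> (\<lambda>g. g + m) ` ?D2"
    proof (cases rule: arcs_F_cases)
      case old
      then show ?thesis using x(2) by (simp add: tail_F)
    next
      case (new g)
      then have "g \<in> ?D2" using x(2) by (simp add: tail_F)
      then show ?thesis using new(1) by blast
    qed
  next
    fix x assume "x \<in> ?D1 \<union> (\<lambda>g. g + m) ` ?D2"
    then consider "x \<in> ?D1" | g where "x = g + m" "g \<in> ?D2" by blast
    then show "x \<in> out_arcs F w"
    proof cases
      case 1
      then have "x \<in> arcs F" unfolding arcs_F by auto
      then show ?thesis using 1 arcs_less by (simp add: tail_F)
    next
      case (2 g)
      then have "x \<in> arcs F" unfolding arcs_F by auto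
      then show ?thesis using 2 by (simp add: tail_F)
    qed
  qed
  have disj: "?D1 \<inter> (\<lambda>g. g + m) ` ?D2 = {}" using arcs_less by auto
  have cl: "S' x \<otimes> T' x \<in> carrier A" if "x \<in> ?D1 \<union> (\<lambda>g. g + m) ` ?D2" for x
    using that verts_F_E by auto
  have hE: "head E g \<in> verts E" if "g \<in> ?D" for g using that by auto
  have "(\<Oplus>x\<in>out_arcs F w. S' x \<otimes> T' x) =
      (\<Oplus>x\<in>?D1. S' x \<otimes> T' x) \<oplus> (\<Oplus>x\<in>(\<lambda>g. g + m) ` ?D2. S' x \<otimes> T' x)"
    unfolding S using fin disj cl by (intro finsum_Un_disjoint) auto
  also have "(\<Oplus>x\<in>(\<lambda>g. g + m) ` ?D2. S' x \<otimes> T' x) = (\<Oplus>g\<in>?D2. S' (g + m) \<otimes> T' (g + m))"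
    using cl by (intro finsum_reindex) (auto simp: inj_on_def)
  also have "\<dots> = (\<Oplus>g\<in>?D. if head E g = u then S g \<otimes> (q \<otimes> T g) else \<zero>)"
    using fin by (intro add.finprod_mono_neutral_cong_left) (auto simp: q_def m_assoc)
  also have "(\<Oplus>x\<in>?D1. S' x \<otimes> T' x) = (\<Oplus>g\<in>?D. S g \<otimes> (P' (head E g) \<otimes> T g))"
    using fin hE by (intro add.finprod_mono_neutral_cong_left) (auto simp: P'_removed m_assoc P'_assoc)
  also have "\<dots> \<oplus> (\<Oplus>g\<in>?D. if head E g = u then S g \<otimes> (q \<otimes> T g) else \<zero>) =
      (\<Oplus>g\<in>?D. S g \<otimes> (P' (head E g) \<otimes> T g) \<oplus> (if head E g = u then S g \<otimes> (q \<otimes> T g) else \<zero>))"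
    by (intro finsum_addf[symmetric]) auto
  also have "\<dots> = (\<Oplus>g\<in>?D. S g \<otimes> T g)"
  proof (rule finsum_cong')
    fix g assume g: "g \<in> ?D"
    have "P' (head E g) \<otimes> T g \<oplus> (if head E g = u then q \<otimes> T g else \<zero>) = T g"
    proof (cases "head E g = u")
      case True
      have "(P u \<oplus> \<ominus> q) \<oplus> q = P u" by (simp add: a_assoc l_neg)
      then have "(P u \<oplus> \<ominus> q) \<otimes> T g \<oplus> q \<otimes> T g = P u \<otimes> T g"
        using g by (simp flip: l_distr)
      then show ?thesis using True g by (simp add: P'_def P_T)
    next
      case False
      then show ?thesis using g by (simp add: P'_def P_T)
    qed
    then have "S g \<otimes> (P' (head E g) \<otimes> T g \<oplus> (if head E g = u then q \<otimes> T g else \<zero>)) = S g \<otimes> T g"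
      by simp
    then show "S g \<otimes> (P' (head E g) \<otimes> T g) \<oplus> (if head E g = u then S g \<otimes> (q \<otimes> T g) else \<zero>) = S g \<otimes> T g"
      using g by (simp add: r_distr split: if_splits)
  qed auto
  also have "\<dots> = P' w"
  proof (cases "w = u")
    case False
    then have D: "?D = out_arcs E w" by auto
    have "?D \<noteq> {}" using w(2) unfolding S by auto
    then show ?thesis using sum_S_T[OF wE] False unfolding D by (simp add: P'_def)
  next
    case True
    have "f \<in> out_arcs E u" by simp
    then have "insert f ?D = out_arcs E u" "out_arcs E u \<noteq> {}" using True by blast+
    then have "P u = (\<Oplus>g\<in>insert f ?D. S g \<otimes> T g)"
      using sum_S_T[of u] by simp
    also have "\<dots> = q \<oplus> (\<Oplus>g\<in>?D. S g \<otimes> T g)"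
      unfolding q_def using fin by (intro finsum_insert) auto
    finally have "P u \<oplus> \<ominus> q = (\<Oplus>g\<in>?D. S g \<otimes> T g)"
      using r_neg1[OF q_closed, of "\<Oplus>g\<in>?D. S g \<otimes> T g"] by (simp add: a_comm)
    then show ?thesis using True by (simp add: P'_def)
  qed
  finally show ?thesis by simp
qed

sublocale F: leavitt_family K A F P' S' T'
proof (intro leavitt_family.intro fin_digraph_F kalgebra_axioms leavitt_family_axioms.intro S'_T'_sum)
  show "P' w \<in> carrier A" if "w \<in> verts F" for w using that verts_F_E by simp
  show "P' w \<otimes> P' z = (if w = z then P' z else \<zero>)" if "w \<in> verts F" "z \<in> verts F" for w z
    using that verts_F_E by (simp add: P'_P')
  fix x assume "x \<in> arcs F"
  then show "S' x \<in> carrier A" "T' x \<in> carrier A" "P' (tail F x) \<otimes> S' x = S' x"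
    "S' x \<otimes> P' (head F x) = S' x" "P' (head F x) \<otimes> T' x = T' x" "T' x \<otimes> P' (tail F x) = T' x"
    by (cases rule: arcs_F_cases; simp add: tail_F head_F m_assoc P'_assoc P'_P' T_P' rels)+
next
  fix x y assume x: "x \<in> arcs F" and y: "y \<in> arcs F"
  show "T' x \<otimes> S' y = (if x = y then P' (head F x) else \<zero>)"
    using x
  proof (cases rule: arcs_F_cases)
    case old
    note x = old
    show ?thesis using y
    proof (cases rule: arcs_F_cases)
      case old
      then show ?thesis using x
        by (simp add: head_F m_assoc rels P'_P' P'_assoc P_P')
    next
      case (new g)
      then show ?thesis using x
        by (auto simp: head_F m_assoc rels P'_assoc P'_Sf)
    qed
  next
    case (new g)
    note x = new
    show ?thesis using y
    proof (cases rule: arcs_F_cases)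
      case old
      then show ?thesis using x
        by (auto simp: head_F m_assoc rels P'_assoc Tf_P' P_P')
    next
      case (new g')
      then show ?thesis using x
        by (simp add: head_F m_assoc rels)
    qed
  qed
qed

text \<open>A new edge is the path \<open>g f\<close>, so its ghost is \<open>f\<^sup>* g\<^sup>*\<close>.\<close>

definition expand :: "nat list \<Rightarrow> nat list"
  where "expand w = concat (map (\<lambda>x. if x < m then [x] else [f, x - m]) w)"

lemma expand_simps [simp]:
  "expand [] = []" "expand (x # w) = (if x < m then [x] else [f, x - m]) @ expand w"
  by (simp_all add: expand_def)

text \<open>The letter \<open>f\<close> occurs only at the beginning of the expansion of a new edge, so the expansion can be
  read off from left to right.\<close>

lemma expand_inj:
  "\<lbrakk>set w \<subseteq> arcs F; set w' \<subseteq> arcs F; expand w = expand w'\<rbrakk> \<Longrightarrow> w = w'"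
proof (induct w arbitrary: w')
  case Nil
  then show ?case by (cases w') (auto split: if_splits)
next
  case (Cons x w)
  then obtain y z where w': "w' = y # z" by (cases w') (auto split: if_splits)
  have "x \<in> arcs F" "y \<in> arcs F" using Cons w' by auto
  then have "x = y \<and> expand w = expand z"
    using Cons(4) unfolding w' by (elim arcs_F_cases) auto
  then show ?case using Cons w' by auto
qed

lemma ghost_path_expand: "ghost_path F x w y \<Longrightarrow> ghost_path E x (expand w) y"
proof (induct rule: ghost_path.induct)
  case (Nil x)
  then show ?case using verts_F_E by simp
next
  case (Cons x w y)
  from Cons(1) show ?case
    by (cases rule: arcs_F_cases) (use Cons(3) in \<open>auto simp: head_F tail_F\<close>)
qed

lemma eval_expand:
  "ghost_path F x w y \<Longrightarrow> eval_word A T' w \<otimes> P' y = P' x \<otimes> (eval_word A T (expand w) \<otimes> P y)"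
proof (induct rule: ghost_path.induct)
  case (Nil x)
  then show ?case using verts_F_E by (simp add: P'_P)
next
  case (Cons x w y)
  have y: "y \<in> verts E" using ghost_path_end[OF Cons(2)] by (rule verts_F_E)
  have c: "eval_word A T (expand w) \<in> carrier A"
    using ghost_path_arcs[OF ghost_path_expand[OF Cons(2)]] by (intro eval_word_closed) auto
  have c': "eval_word A T' w \<in> carrier A"
    using ghost_path_arcs[OF Cons(2)] by (intro eval_word_closed) auto
  have "eval_word A T' (x # w) \<otimes> P' y = T' x \<otimes> (P' (tail F x) \<otimes> (eval_word A T (expand w) \<otimes> P y))"
    using Cons(1,3) c' y by (simp add: m_assoc)
  also have "\<dots> = P' (head F x) \<otimes> (eval_word A T (expand (x # w)) \<otimes> P y)"
    using Cons(1) by (cases rule: arcs_F_cases)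
      (use c y in \<open>simp_all add: head_F tail_F m_assoc P'_assoc rels\<close>)
  finally show ?case .
qed

text \<open>The ghost paths of the new graph are those of the old one, up to the factor \<open>P' x\<close> on the left.  For
  \<open>x = u\<close> this factor is removed by an edge \<open>h \<noteq> f\<close> that starts at \<open>u\<close>, since \<open>T h \<otimes> P' u = T h\<close>.\<close>

lemma F_faithful: "faithful \<Longrightarrow> F.faithful"
  unfolding F.faithful_def
proof (intro ballI impI)
  assume faithful
  fix x y c assume xy: "x \<in> verts F" "y \<in> verts F" and c: "c \<in> ghost_coeffs K F x y"
    and zero: "F.eval_ghost c \<otimes> P' y = \<zero>"
  have xyE: "x \<in> verts E" "y \<in> verts E" using xy verts_F_E by auto
  note cc = K.ghost_coeffs_carrier[OF c] and cp = K.ghost_coeffs_path[OF c]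
  obtain g where g: "g \<in> carrier (free_algebra K (arcs E))"
    "\<And>z. g z \<noteq> \<zero>\<^bsub>K\<^esub> \<Longrightarrow> \<exists>w. z = expand w \<and> c w \<noteq> \<zero>\<^bsub>K\<^esub>"
    "F.eval_ghost c \<otimes> P' y = P' x \<otimes> (eval_ghost g \<otimes> P y)"
    "g = \<zero>\<^bsub>free_algebra K (arcs E)\<^esub> \<Longrightarrow> c = \<zero>\<^bsub>free_algebra K (arcs F)\<^esub>"
  proof (rule eval_free_push[OF cc F.T_funcset T_funcset])
    show "inj_on expand {w. c w \<noteq> \<zero>\<^bsub>K\<^esub>}"
      using expand_inj ghost_path_arcs[OF cp] by (intro inj_onI) auto
    show "set (expand w) \<subseteq> arcs E" if "c w \<noteq> \<zero>\<^bsub>K\<^esub>" for w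
      using ghost_path_arcs[OF ghost_path_expand[OF cp[OF that]]] .
    show "eval_word A T' w \<otimes> P' y = P' x \<otimes> (eval_word A T (expand w) \<otimes> P y)"
      if "c w \<noteq> \<zero>\<^bsub>K\<^esub>" for w
      using eval_expand[OF cp[OF that]] .
  qed (use xyE in auto)
  have gE: "g \<in> ghost_coeffs K E x y"
    using g(1,2) cp ghost_path_expand unfolding ghost_coeffs_def by blast
  have z: "P' x \<otimes> (eval_ghost g \<otimes> P y) = \<zero>" using zero g(3) by simp
  have "g = \<zero>\<^bsub>free_algebra K (arcs E)\<^esub>"
  proof (cases "x = u")
    case False
    then have "eval_ghost g \<otimes> P y = \<zero>" using z P_eval_ghost[OF gE xyE(1) xyE(2)] by (simp add: P'_def)
    then show ?thesis using \<open>faithful\<close> gE xyE unfolding faithful_def by blast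
  next
    case True
    then have "out_arcs E u \<noteq> {f}" using xy(1) by (auto simp: verts_F split: if_splits)
    moreover have "f \<in> out_arcs E u" by simp
    ultimately obtain h where "h \<in> out_arcs E u" "h \<noteq> f" by blast
    then have h: "h \<in> arcs E" "tail E h = u" "h \<noteq> f" by auto
    have w: "word K [h] \<in> ghost_coeffs K E (head E h) x"
      using h True by (intro K.ghost_coeffs_word) auto
    note wc = K.ghost_coeffs_carrier[OF w]
    let ?g = "word K [h] \<otimes>\<^bsub>free_algebra K (arcs E)\<^esub> g"
    have "T h \<otimes> (P' x \<otimes> (eval_ghost g \<otimes> P y)) = T h \<otimes> (eval_ghost g \<otimes> P y)"
      using h True xyE gE by (simp add: P'_assoc)
    then have "eval_ghost ?g \<otimes> P y = \<zero>"
      using z h gE xyE g(1) wc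
      by (simp add: eval_free_mult[OF T_funcset] eval_free_word1[OF T_funcset] m_assoc)
    then have "?g = \<zero>\<^bsub>free_algebra K (arcs E)\<^esub>"
      using \<open>faithful\<close> K.ghost_coeffs_mult[OF w gE] xyE E.head_in_verts[OF h(1)]
      unfolding faithful_def by blast
    then have "?g (h # z) = \<zero>\<^bsub>K\<^esub>" for z by (simp add: K.free_algebra_simps)
    then have "g z = \<zero>\<^bsub>K\<^esub>" for z using K.word_mult[OF g(1), of "[h]" "h # z"] by simp
    then show ?thesis by (auto simp: K.free_algebra_simps)
  qed
  then show "c = \<zero>\<^bsub>free_algebra K (arcs F)\<^esub>" by (rule g(4))
qed

definition e where "e = unit \<oplus> \<ominus> q"

lemma e_closed [simp]: "e \<in> carrier A" by (simp add: e_def)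

lemma e_rels:
  "e \<otimes> e = e" "e \<otimes> S f = \<zero>" "T f \<otimes> e = \<zero>"
  "w \<in> verts E \<Longrightarrow> e \<otimes> P w = P' w" "w \<in> verts E \<Longrightarrow> P w \<otimes> e = P' w"
  "\<lbrakk>g \<in> arcs E; g \<noteq> f\<rbrakk> \<Longrightarrow> e \<otimes> S g = S g" "\<lbrakk>g \<in> arcs E; g \<noteq> f\<rbrakk> \<Longrightarrow> T g \<otimes> e = T g"
  "unit \<otimes> e = e" "e \<otimes> unit = e"
  by (auto simp: e_def P'_def l_distr r_distr l_minus r_minus q_rels q_rels0 r_neg minus_add a_ac)

lemma e_P': "w \<in> verts E \<Longrightarrow> e \<otimes> P' w = P' w"
  using m_assoc[of e e "P w"] by (simp add: e_rels)

lemma S_e: "g \<in> arcs E \<Longrightarrow> S g \<otimes> e = S g \<otimes> P' (head E g)"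
  using m_assoc[of "S g" "P (head E g)" e] by (simp add: e_rels)

lemma e_T: "g \<in> arcs E \<Longrightarrow> e \<otimes> T g = P' (head E g) \<otimes> T g"
  using m_assoc[of e "P (head E g)" "T g"] by (simp add: e_rels)

lemma sum_P':
  assumes "I \<subseteq> verts E" "u \<in> I"
  shows "(\<Oplus>w\<in>I. P' w) = (\<Oplus>w\<in>I. P w) \<oplus> \<ominus> q"
proof -
  have fin: "finite I" using assms(1) by (rule finite_subset) simp
  have I: "I = insert u (I - {u})" using assms(2) by auto
  have c: "P \<in> I - {u} \<rightarrow> carrier A" using assms(1) by auto
  have eq: "(\<Oplus>w\<in>I - {u}. P' w) = (\<Oplus>w\<in>I - {u}. P w)"
    using assms(1) by (intro finsum_cong') (auto simp: P'_def)
  have s: "(\<Oplus>w\<in>I - {u}. P w) \<in> carrier A" using c by (rule finsum_closed)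
  have "(\<Oplus>w\<in>I. P' w) = P' u \<oplus> (\<Oplus>w\<in>I - {u}. P' w)"
    using fin assms(1) by (subst I, subst finsum_insert) auto
  also have "\<dots> = P u \<oplus> (\<Oplus>w\<in>I - {u}. P w) \<oplus> \<ominus> q"
    unfolding eq using s by (simp add: P'_def a_ac)
  also have "P u \<oplus> (\<Oplus>w\<in>I - {u}. P w) = (\<Oplus>w\<in>I. P w)"
    using fin assms(1) c by (subst (2) I, subst finsum_insert) auto
  finally show ?thesis .
qed

lemma unit_F: "F.unit = e"
proof -
  have "F.unit = (\<Oplus>w\<in>verts E. P' w)"
    unfolding F.unit_def using verts_F_E P'_removed
    by (intro add.finprod_mono_neutral_cong_left) auto
  then show ?thesis by (simp add: sum_P' e_def unit_def)
qed

lemma P'_generated: "w \<in> verts E \<Longrightarrow> P' w \<in> F.generated"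
  using F.generated.P F.generated.zero P'_removed by (cases "w \<in> verts F") auto

lemma S_generated: "\<lbrakk>g \<in> arcs E; g \<noteq> f\<rbrakk> \<Longrightarrow> S g \<otimes> P' (head E g) \<in> F.generated"
  using F.generated.S[of g] F.generated.zero P'_removed[of "head E g"]
  by (cases "head E g \<in> verts F") (auto simp: arcs_F)

lemma T_generated: "\<lbrakk>g \<in> arcs E; g \<noteq> f\<rbrakk> \<Longrightarrow> P' (head E g) \<otimes> T g \<in> F.generated"
  using F.generated.T[of g] F.generated.zero P'_removed[of "head E g"]
  by (cases "head E g \<in> verts F") (auto simp: arcs_F)

lemma new_arc_F: "\<lbrakk>g \<in> arcs E; head E g = u\<rbrakk> \<Longrightarrow> g + m \<in> arcs F"
  unfolding arcs_F by blast

lemma S_Sf_generated: "g \<in> arcs E \<Longrightarrow> S g \<otimes> S f \<in> F.generated"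
proof (cases "head E g = u")
  case True
  assume "g \<in> arcs E"
  then show ?thesis using F.generated.S[OF new_arc_F[OF _ True]] by simp
next
  case False
  assume "g \<in> arcs E"
  then have "S g \<otimes> (P u \<otimes> S f) = \<zero>" using False by (subst left_assoc) auto
  then show ?thesis using F.generated.zero by simp
qed

lemma Tf_T_generated: "g \<in> arcs E \<Longrightarrow> T f \<otimes> T g \<in> F.generated"
proof (cases "head E g = u")
  case True
  assume "g \<in> arcs E"
  then show ?thesis using F.generated.T[OF new_arc_F[OF _ True]] by simp
next
  case False
  assume "g \<in> arcs E"
  then have "T f \<otimes> (P u \<otimes> T g) = \<zero>" using False by (simp add: P_T)
  then show ?thesis using F.generated.zero \<open>g \<in> arcs E\<close> by (simp add: left_assoc)
qed

text \<open>The four blocks of an element of the corner at \<open>unit\<close>, with respect to the decomposition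
  \<open>unit = e + q\<close>, where the block at \<open>q\<close> is moved to the equivalent idempotent \<open>P v\<close>.\<close>

definition blocks :: "'a set"
  where "blocks = {x \<in> carrier A. \<forall>a\<in>{e, T f}. \<forall>b\<in>{e, S f}. a \<otimes> (x \<otimes> b) \<in> F.generated}"

lemma blocksD: "\<lbrakk>x \<in> blocks; a \<in> {e, T f}; b \<in> {e, S f}\<rbrakk> \<Longrightarrow> a \<otimes> (x \<otimes> b) \<in> F.generated"
  by (auto simp: blocks_def)

lemma generated_blocks: "x \<in> generated \<Longrightarrow> x \<in> blocks"
proof (induct rule: generated.induct)
  case zero
  then show ?case using F.generated.zero by (auto simp: blocks_def)
next
  case (P w)
  then show ?case using P'_generated[of w] P'_generated[of v] F.generated.zero not_loop
    by (auto simp: blocks_def e_rels e_P' P_P' rels P'_P Tf_P' P'_Sf)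
next
  case (S g)
  show ?case
  proof (cases "g = f")
    case True
    then show ?thesis
      using P'_generated[of v] F.generated.zero not_loop
      by (auto simp: blocks_def e_rels S_e rels P'_assoc P_P' P'_P simp flip: m_assoc)
  next
    case False
    then show ?thesis
      using S S_generated[of g] S_Sf_generated[of g] F.generated.zero
      by (auto simp: blocks_def e_rels S_e rels simp flip: m_assoc)
  qed
next
  case (T g)
  show ?case
  proof (cases "g = f")
    case True
    then show ?thesis
      using P'_generated[of v] F.generated.zero not_loop
      by (auto simp: blocks_def e_rels rels P_P' P'_P)
  next
    case False
    then show ?thesis
      using T T_generated[of g] Tf_T_generated[of g] F.generated.zero
      by (auto simp: blocks_def e_rels e_T rels)
  qed
next
  case (add x y)
  then show ?case using F.generated.add by (auto simp: blocks_def l_distr r_distr)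
next
  case (smult k x)
  then show ?case using F.generated.smult by (auto simp: blocks_def smult_mult_l smult_mult_r)
next
  case (mult x y)
  have c: "x \<in> carrier A" "y \<in> carrier A" using mult(1,3) by (auto intro: generated_carrier)
  have "a \<otimes> ((x \<otimes> y) \<otimes> b) \<in> F.generated" if ab: "a \<in> {e, T f}" "b \<in> {e, S f}" for a b
  proof -
    have abc: "a \<in> carrier A" "b \<in> carrier A" using ab by auto
    have "e \<oplus> q = unit" by (simp add: e_def a_assoc l_neg)
    then have eq: "y = (e \<oplus> q) \<otimes> y" using generated_unit_left[OF mult(3)] by simp
    have "a \<otimes> ((x \<otimes> y) \<otimes> b) = a \<otimes> (x \<otimes> (((e \<oplus> q) \<otimes> y) \<otimes> b))"
      using c abc eq by (simp add: m_assoc)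
    also have "\<dots> = a \<otimes> (x \<otimes> ((e \<otimes> e) \<otimes> (y \<otimes> b))) \<oplus> a \<otimes> (x \<otimes> (q \<otimes> (y \<otimes> b)))"
      using c abc by (simp add: e_rels l_distr r_distr m_assoc)
    also have "\<dots> = (a \<otimes> (x \<otimes> e)) \<otimes> (e \<otimes> (y \<otimes> b)) \<oplus> (a \<otimes> (x \<otimes> S f)) \<otimes> (T f \<otimes> (y \<otimes> b))"
      using c abc by (simp add: q_def m_assoc)
    also have "\<dots> \<in> F.generated"
      by (rule F.generated.add[OF F.generated.mult[OF blocksD[OF mult(2)] blocksD[OF mult(4)]]
            F.generated.mult[OF blocksD[OF mult(2)] blocksD[OF mult(4)]]]) (use ab in auto)
    finally show ?thesis .
  qed
  then show ?case using c by (simp add: blocks_def)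
qed

lemma F_full: "full \<Longrightarrow> F.full"
  unfolding F.full_def unit_F
proof (intro ballI impI)
  assume full
  fix x assume x: "x \<in> carrier A" "e \<otimes> (x \<otimes> e) = x"
  have "unit \<otimes> (x \<otimes> unit) = unit \<otimes> ((e \<otimes> (x \<otimes> e)) \<otimes> unit)" using x by simp
  also have "\<dots> = (unit \<otimes> e) \<otimes> (x \<otimes> (e \<otimes> unit))" using x(1) by (simp add: m_assoc)
  also have "\<dots> = x" using x by (simp add: e_rels)
  finally have "x \<in> generated" using \<open>full\<close> x(1) unfolding full_def by blast
  then have "e \<otimes> (x \<otimes> e) \<in> F.generated" using generated_blocks by (auto simp: blocks_def)
  then show "x \<in> F.generated" using x by simp
qed

end

text \<open>Corners at equivalent idempotents are isomorphic, by \<open>x \<mapsto> \<tau> x \<sigma>\<close>.\<close>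

lemma (in kalgebra) corner_isomorphic_conj:
  assumes c: "\<sigma> \<in> carrier A" "\<tau> \<in> carrier A"
    and eq: "\<sigma> \<otimes> \<tau> = p" "\<tau> \<otimes> \<sigma> = r" and idem: "p \<otimes> p = p" "r \<otimes> r = r"
  shows "algebra_isomorphic K (corner A p) (corner A r)"
proof -
  have pr: "p \<in> carrier A" "r \<in> carrier A" using c eq by auto
  have 1: "\<sigma> \<otimes> (\<tau> \<otimes> x) = p \<otimes> x" "\<tau> \<otimes> (\<sigma> \<otimes> x) = r \<otimes> x" if "x \<in> carrier A" for x
    using c that by (simp_all add: eq flip: m_assoc)
  have 2: "p \<otimes> (p \<otimes> x) = p \<otimes> x" "r \<otimes> (r \<otimes> x) = r \<otimes> x" if "x \<in> carrier A" for x
    using pr that by (simp_all add: idem flip: m_assoc)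
  note cp = corner_iff[OF pr(1) idem(1)] and cr = corner_iff[OF pr(2) idem(2)]
  have left: "\<tau> \<otimes> (x \<otimes> \<sigma>) \<in> carrier (corner A r)" if "x \<in> carrier (corner A p)" for x
  proof -
    have x: "x \<in> carrier A" "p \<otimes> x = x" "x \<otimes> p = x" using that cp by auto
    have "r \<otimes> (\<tau> \<otimes> (x \<otimes> \<sigma>)) = \<tau> \<otimes> ((p \<otimes> x) \<otimes> \<sigma>)"
      using c pr x(1) by (simp add: m_assoc flip: eq)
    moreover have "(\<tau> \<otimes> (x \<otimes> \<sigma>)) \<otimes> r = \<tau> \<otimes> ((x \<otimes> p) \<otimes> \<sigma>)"
      using c pr x(1) by (simp add: m_assoc flip: eq)
    ultimately show ?thesis using x c by (simp add: cr)
  qed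
  have right: "\<sigma> \<otimes> (x \<otimes> \<tau>) \<in> carrier (corner A p)" if "x \<in> carrier (corner A r)" for x
  proof -
    have x: "x \<in> carrier A" "r \<otimes> x = x" "x \<otimes> r = x" using that cr by auto
    have "p \<otimes> (\<sigma> \<otimes> (x \<otimes> \<tau>)) = \<sigma> \<otimes> ((r \<otimes> x) \<otimes> \<tau>)"
      using c pr x(1) by (simp add: m_assoc flip: eq)
    moreover have "(\<sigma> \<otimes> (x \<otimes> \<tau>)) \<otimes> p = \<sigma> \<otimes> ((x \<otimes> r) \<otimes> \<tau>)"
      using c pr x(1) by (simp add: m_assoc flip: eq)
    ultimately show ?thesis using x c by (simp add: cp)
  qed
  show ?thesis
  proof (rule algebra_isomorphicI[where h = "\<lambda>x. \<tau> \<otimes> (x \<otimes> \<sigma>)"])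
    show "nonunital_hom K (corner A p) (corner A r) (\<lambda>x. \<tau> \<otimes> (x \<otimes> \<sigma>))"
      unfolding nonunital_hom_def
    proof (intro conjI ballI)
      fix x assume "x \<in> carrier (corner A p)"
      then have x: "x \<in> carrier A" "p \<otimes> x = x" "x \<otimes> p = x" using cp by auto
      { fix a assume "a \<in> carrier K"
        then show "\<tau> \<otimes> ((a \<odot>\<^bsub>corner A p\<^esub> x) \<otimes> \<sigma>) = a \<odot>\<^bsub>corner A r\<^esub> (\<tau> \<otimes> (x \<otimes> \<sigma>))"
          using x c by (simp add: smult_mult_l smult_mult_r) }
      fix y assume "y \<in> carrier (corner A p)"
      then have y: "y \<in> carrier A" "p \<otimes> y = y" "y \<otimes> p = y" using cp by auto
      show "\<tau> \<otimes> ((x \<oplus>\<^bsub>corner A p\<^esub> y) \<otimes> \<sigma>) = \<tau> \<otimes> (x \<otimes> \<sigma>) \<oplus>\<^bsub>corner A r\<^esub> \<tau> \<otimes> (y \<otimes> \<sigma>)"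
        using x y c by (simp add: l_distr r_distr)
      have "(\<tau> \<otimes> (x \<otimes> \<sigma>)) \<otimes> (\<tau> \<otimes> (y \<otimes> \<sigma>)) = \<tau> \<otimes> (x \<otimes> ((p \<otimes> y) \<otimes> \<sigma>))"
        using x(1) y(1) c by (simp add: m_assoc flip: eq)
      then show "\<tau> \<otimes> ((x \<otimes>\<^bsub>corner A p\<^esub> y) \<otimes> \<sigma>) = (\<tau> \<otimes> (x \<otimes> \<sigma>)) \<otimes>\<^bsub>corner A r\<^esub> (\<tau> \<otimes> (y \<otimes> \<sigma>))"
        using x y c by (simp add: m_assoc)
    qed (rule left)
    have "\<tau> \<otimes> (p \<otimes> \<sigma>) = r \<otimes> r" using c by (simp add: m_assoc flip: eq)
    then show "\<tau> \<otimes> (\<one>\<^bsub>corner A p\<^esub> \<otimes> \<sigma>) = \<one>\<^bsub>corner A r\<^esub>" by (simp add: idem)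
    show "bij_betw (\<lambda>x. \<tau> \<otimes> (x \<otimes> \<sigma>)) (carrier (corner A p)) (carrier (corner A r))"
    proof (rule bij_betw_byWitness[where f' = "\<lambda>x. \<sigma> \<otimes> (x \<otimes> \<tau>)"])
      show "\<forall>x\<in>carrier (corner A p). \<sigma> \<otimes> ((\<tau> \<otimes> (x \<otimes> \<sigma>)) \<otimes> \<tau>) = x"
      proof
        fix x assume "x \<in> carrier (corner A p)"
        then have x: "x \<in> carrier A" "p \<otimes> x = x" "x \<otimes> p = x" using cp by auto
        have "\<sigma> \<otimes> ((\<tau> \<otimes> (x \<otimes> \<sigma>)) \<otimes> \<tau>) = p \<otimes> (x \<otimes> p)"
          using x(1) c by (simp add: m_assoc flip: eq)
        then show "\<sigma> \<otimes> ((\<tau> \<otimes> (x \<otimes> \<sigma>)) \<otimes> \<tau>) = x" using x by simp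
      qed
      show "\<forall>x\<in>carrier (corner A r). \<tau> \<otimes> ((\<sigma> \<otimes> (x \<otimes> \<tau>)) \<otimes> \<sigma>) = x"
      proof
        fix x assume "x \<in> carrier (corner A r)"
        then have x: "x \<in> carrier A" "r \<otimes> x = x" "x \<otimes> r = x" using cr by auto
        have "\<tau> \<otimes> ((\<sigma> \<otimes> (x \<otimes> \<tau>)) \<otimes> \<sigma>) = r \<otimes> (x \<otimes> r)"
          using x(1) c by (simp add: m_assoc flip: eq)
        then show "\<tau> \<otimes> ((\<sigma> \<otimes> (x \<otimes> \<tau>)) \<otimes> \<sigma>) = x" using x by simp
      qed
    qed (use left right in auto)
  qed
qed

lemma (in leavitt_family) sum_P_rels:
  assumes I: "I \<subseteq> verts E"
  shows "(\<Oplus>w\<in>I. P w) \<in> carrier A"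
    and "(\<Oplus>w\<in>I. P w) \<otimes> (\<Oplus>w\<in>I. P w) = (\<Oplus>w\<in>I. P w)"
    and "z \<in> verts E \<Longrightarrow> (\<Oplus>w\<in>I. P w) \<otimes> P z = (if z \<in> I then P z else \<zero>)"
    and "z \<in> verts E \<Longrightarrow> P z \<otimes> (\<Oplus>w\<in>I. P w) = (if z \<in> I then P z else \<zero>)"
proof -
  have fin: "finite I" using I by (rule finite_subset) simp
  have c: "P w \<in> carrier A" if "w \<in> I" for w using I that by auto
  have Pc: "P \<in> I \<rightarrow> carrier A" using c by auto
  show s: "(\<Oplus>w\<in>I. P w) \<in> carrier A" using Pc by (rule finsum_closed)
  have l: "(\<Oplus>w\<in>I. P w) \<otimes> P z = (if z \<in> I then P z else \<zero>)" if z: "z \<in> verts E" for z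
  proof -
    have "(\<Oplus>w\<in>I. P w) \<otimes> P z = (\<Oplus>w\<in>I. P w \<otimes> P z)"
      using fin z Pc by (intro finsum_ldistr) auto
    also have "\<dots> = (\<Oplus>w\<in>I. if z = w then P w else \<zero>)"
      using I c z by (intro finsum_cong') (auto simp: P_P subset_iff)
    also have "\<dots> = (if z \<in> I then P z else \<zero>)"
    proof (cases "z \<in> I")
      case True
      then show ?thesis using fin Pc by (subst finsum_singleton) auto
    next
      case False
      then show ?thesis by (auto intro!: add.finprod_one_eqI)
    qed
    finally show ?thesis .
  qed
  then show "z \<in> verts E \<Longrightarrow> (\<Oplus>w\<in>I. P w) \<otimes> P z = (if z \<in> I then P z else \<zero>)" by blast
  show "z \<in> verts E \<Longrightarrow> P z \<otimes> (\<Oplus>w\<in>I. P w) = (if z \<in> I then P z else \<zero>)"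
  proof -
    assume z: "z \<in> verts E"
    have "P z \<otimes> (\<Oplus>w\<in>I. P w) = (\<Oplus>w\<in>I. P z \<otimes> P w)"
      using fin z Pc by (intro finsum_rdistr) auto
    also have "\<dots> = (\<Oplus>w\<in>I. if z = w then P w else \<zero>)"
      using I c z by (intro finsum_cong') (auto simp: P_P subset_iff)
    also have "\<dots> = (if z \<in> I then P z else \<zero>)"
    proof (cases "z \<in> I")
      case True
      then show ?thesis using fin Pc by (subst finsum_singleton) auto
    next
      case False
      then show ?thesis by (auto intro!: add.finprod_one_eqI)
    qed
    finally show ?thesis .
  qed
  have "(\<Oplus>w\<in>I. P w) \<otimes> (\<Oplus>w\<in>I. P w) = (\<Oplus>w\<in>I. (\<Oplus>w\<in>I. P w) \<otimes> P w)"
    using fin s Pc by (intro finsum_rdistr) auto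
  also have "\<dots> = (\<Oplus>w\<in>I. P w)" using I c l by (intro finsum_cong') (auto simp: subset_iff)
  finally show "(\<Oplus>w\<in>I. P w) \<otimes> (\<Oplus>w\<in>I. P w) = (\<Oplus>w\<in>I. P w)" .
qed

text \<open>With \<open>s = (\<Sum>w\<in>I. P w) - q\<close>, the two idempotents are \<open>s + q\<close> and \<open>s + P v\<close>; the equivalence of \<open>q\<close>
  and \<open>P v\<close> by \<open>S f\<close> and \<open>T f\<close> extends by the identity on \<open>s\<close>.\<close>

lemma (in splitting) corner_splitting:
  assumes I: "I \<subseteq> verts E" "u \<in> I" "v \<notin> I"
  shows "algebra_isomorphic K (corner A (\<Oplus>w\<in>I. P w)) (corner A (\<Oplus>w\<in>insert v I \<inter> verts F. P' w))"
proof -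
  define p where "p = (\<Oplus>w\<in>I. P w)"
  define s where "s = p \<oplus> \<ominus> q"
  note p = sum_P_rels[OF I(1), folded p_def]
  have vE: "v \<in> verts E" "u \<in> verts E" by auto
  have sc [simp]: "s \<in> carrier A" "p \<in> carrier A" using p by (auto simp: s_def)
  have pS: "p \<otimes> S f = S f" using m_assoc[of p "P u" "S f"] p(3)[OF vE(2)] I by simp
  have Tp: "T f \<otimes> p = T f" using m_assoc[of "T f" "P u" p] p(4)[OF vE(2)] I by simp
  have pT: "p \<otimes> T f = \<zero>" using m_assoc[of p "P v" "T f"] p(3)[OF vE(1)] I by simp
  have Sp: "S f \<otimes> p = \<zero>" using m_assoc[of "S f" "P v" p] p(4)[OF vE(1)] I by simp
  have pq: "p \<otimes> q = q" "q \<otimes> p = q"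
    unfolding q_def using pS Tp by (simp flip: m_assoc) (simp add: m_assoc Tp)
  have TT: "T f \<otimes> T f = \<zero>" "S f \<otimes> S f = \<zero>"
    using not_loop m_assoc[of "T f" "P u" "T f"] m_assoc[of "S f" "P v" "S f"]
    by (auto simp: rels)
  have qT: "q \<otimes> T f = \<zero>" "S f \<otimes> q = \<zero>"
    unfolding q_def using TT by (simp add: m_assoc) (simp add: TT flip: m_assoc)
  have ss: "s \<otimes> s = s" "s \<otimes> S f = \<zero>" "T f \<otimes> s = \<zero>" "s \<otimes> T f = \<zero>" "S f \<otimes> s = \<zero>"
    by (simp_all add: s_def l_distr r_distr l_minus r_minus p(2) pq pS Tp pT Sp qT q_rels r_neg)
  have Ps: "P v \<otimes> s = \<zero>" "s \<otimes> P v = \<zero>"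
    using p(3,4)[OF vE(1)] I(3) not_loop by (simp_all add: s_def l_distr r_distr l_minus r_minus q_rels0)
  have "(\<Oplus>w\<in>insert v I \<inter> verts F. P' w) = (\<Oplus>w\<in>insert v I. P' w)"
    using I(1) P'_removed finite_subset[OF I(1)]
    by (intro add.finprod_mono_neutral_cong_left) auto
  also have "\<dots> = P v \<oplus> s"
    using I finite_subset[OF I(1)] sum_P'[OF I(1,2)]
    by (subst finsum_insert) (auto simp: s_def p_def)
  finally have r: "(\<Oplus>w\<in>insert v I \<inter> verts F. P' w) = P v \<oplus> s" .
  show ?thesis unfolding r unfolding p_def[symmetric]
  proof (rule corner_isomorphic_conj[of "s \<oplus> S f" "s \<oplus> T f"])
    show "(s \<oplus> S f) \<otimes> (s \<oplus> T f) = p"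
      by (simp add: l_distr r_distr ss flip: q_def) (simp add: s_def a_assoc l_neg)
    show "(s \<oplus> T f) \<otimes> (s \<oplus> S f) = P v \<oplus> s"
      by (simp add: l_distr r_distr ss T_S a_comm)
    show "(P v \<oplus> s) \<otimes> (P v \<oplus> s) = P v \<oplus> s"
      by (simp add: l_distr r_distr ss Ps P_P)
  qed (use p in auto)
qed

text \<open>If an edge leaves the set \<open>I\<close>, splitting it off moves its range into the set, and the number of
  vertices outside decreases.  If none does, \<open>I\<close> is hereditary, and the corner is the Leavitt path
  algebra of the subgraph on \<open>I\<close>.\<close>

lemma corner_leavitt:
  fixes E :: "(nat, nat) pre_digraph"
  assumes "leavitt_family K A E P S T" "leavitt_family.faithful K A E P T"
    "leavitt_family.full K A E P S T" "I \<subseteq> verts E" "I \<noteq> {}"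
  shows "\<exists>G :: (nat, nat) pre_digraph. finite_graph G \<and>
    algebra_isomorphic K (corner A (\<Oplus>\<^bsub>A\<^esub>w\<in>I. P w)) (leavitt_path_algebra K G)"
  using assms
proof (induct "card (verts E - I)" arbitrary: E P S T I rule: less_induct)
  case less
  interpret E: leavitt_family K A E P S T by (rule less(2))
  show ?case
  proof (cases "\<exists>f\<in>arcs E. tail E f \<in> I \<and> head E f \<notin> I")
    case True
    then obtain f where f: "f \<in> arcs E" "tail E f \<in> I" "head E f \<notin> I" by blast
    interpret splitting K A E P S T f "Suc (Max (arcs E))"
      by unfold_locales (use f in \<open>auto simp: less_Suc_eq_le\<close>)
    have vE: "head E f \<in> verts E" using f by auto
    have "verts F - (insert (head E f) I \<inter> verts F) \<subset> verts E - I"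
      using verts_F_E vE f(3) by auto
    then have "card (verts F - (insert (head E f) I \<inter> verts F)) < card (verts E - I)"
      by (intro psubset_card_mono) auto
    then obtain G :: "(nat, nat) pre_digraph" where "finite_graph G"
      "algebra_isomorphic K (corner A (\<Oplus>\<^bsub>A\<^esub>w\<in>insert (head E f) I \<inter> verts F. P' w)) (leavitt_path_algebra K G)"
      using less(1)[OF _ F.leavitt_family_axioms F_faithful[OF less(3)] F_full[OF less(4)],
          of "insert (head E f) I \<inter> verts F"] v_F by blast
    then show ?thesis
      using algebra_isomorphic_trans[OF corner_splitting[OF less(5) f(2,3)]] by blast
  next
    case False
    let ?G = "E\<lparr>verts := I, arcs := {e \<in> arcs E. tail E e \<in> I}\<rparr>"
    have fin: "finite I" using less(5) by (rule finite_subset) simp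
    have G: "fin_digraph ?G"
      by unfold_locales (use fin False in auto)
    have vG: "verts ?G = I" and fG: "finite_graph ?G"
      using G less(6) by (simp_all add: finite_graph_def)
    interpret H: hereditary_embedding K A E P S T ?G "\<lambda>v. v" "\<lambda>e. e"
      by (intro hereditary_embedding.intro G less(2) hereditary_embedding_axioms.intro)
        (use less(5) in auto)
    have unit: "H.sub.unit = (\<Oplus>\<^bsub>A\<^esub>w\<in>I. P w)" unfolding H.sub.unit_def vG ..
    have "algebra_isomorphic K (corner A H.sub.unit) (leavitt_path_algebra K ?G)"
      using H.sub.corner_unit_isomorphic H.sub_faithful[OF less(3)] H.sub_full[OF less(4)] by blast
    then show ?thesis using fG unfolding unit by blast
  qed
qed

text \<open>Splitting needs names for new edges, so the vertices and edges are renamed to numbers first.\<close>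

lemma (in leavitt_family) corner_vertices_leavitt:
  assumes faithful full and I: "I \<subseteq> verts E" "I \<noteq> {}"
  shows "\<exists>G :: (nat, nat) pre_digraph. finite_graph G \<and>
    algebra_isomorphic K (corner A (\<Oplus>w\<in>I. P w)) (leavitt_path_algebra K G)"
proof -
  obtain \<nu> where \<nu>: "bij_betw \<nu> {0..<card (verts E)} (verts E)"
    using ex_bij_betw_nat_finite[OF E.finite_verts] by blast
  obtain \<epsilon> where \<epsilon>: "bij_betw \<epsilon> {0..<card (arcs E)} (arcs E)"
    using ex_bij_betw_nat_finite[OF E.finite_arcs] by blast
  let ?V = "{0..<card (verts E)}" and ?A = "{0..<card (arcs E)}"
  define n where "n = inv_into ?V \<nu>"
  have n: "n v \<in> ?V" "\<nu> (n v) = v" if "v \<in> verts E" for v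
    using that \<nu> unfolding n_def bij_betw_def by (auto intro: inv_into_into f_inv_into_f simp del: atLeastLessThan_iff)
  have \<nu>V: "\<nu> i \<in> verts E" if "i \<in> ?V" for i using \<nu> that by (auto simp: bij_betw_def)
  have \<epsilon>A: "\<epsilon> i \<in> arcs E" if "i \<in> ?A" for i using \<epsilon> that by (auto simp: bij_betw_def)
  define G where "G = \<lparr>verts = ?V, arcs = ?A, tail = (\<lambda>i. n (tail E (\<epsilon> i))), head = (\<lambda>i. n (head E (\<epsilon> i)))\<rparr>"
  have G: "fin_digraph G"
    by unfold_locales (use n(1) \<epsilon>A in \<open>auto simp: G_def simp del: atLeastLessThan_iff\<close>)
  have VG: "verts G = ?V" by (simp add: G_def)
  interpret H: hereditary_embedding K A E P S T G \<nu> \<epsilon>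
  proof (intro hereditary_embedding.intro G leavitt_family_axioms hereditary_embedding_axioms.intro)
    show "inj_on \<nu> (verts G)" "inj_on \<epsilon> (arcs G)" using \<nu> \<epsilon> by (simp_all add: G_def bij_betw_def)
    show "\<And>v. v \<in> verts G \<Longrightarrow> \<nu> v \<in> verts E" using \<nu>V by (simp add: G_def)
    show "\<And>e. e \<in> arcs G \<Longrightarrow> \<epsilon> e \<in> arcs E" using \<epsilon>A by (simp add: G_def)
    show "\<And>e. e \<in> arcs G \<Longrightarrow> tail E (\<epsilon> e) = \<nu> (tail G e)" using \<epsilon>A n(2) by (simp add: G_def)
    show "\<And>e. e \<in> arcs G \<Longrightarrow> head E (\<epsilon> e) = \<nu> (head G e)" using \<epsilon>A n(2) by (simp add: G_def)
    show "\<And>v d. d \<in> arcs E \<Longrightarrow> d \<in> \<epsilon> ` arcs G" using \<epsilon> by (simp add: G_def bij_betw_def)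
  qed
  let ?I = "{i \<in> ?V. \<nu> i \<in> I}"
  have I_eq: "\<nu> ` ?I = I" 
  proof (intro equalityI subsetI)
    fix x assume x: "x \<in> I"
    then have "n x \<in> ?I" "x = \<nu> (n x)" using n[of x] I(1) by auto
    then show "x \<in> \<nu> ` ?I" by (rule image_eqI[rotated])
  qed auto
  have "(\<Oplus>w\<in>\<nu> ` ?I. P w) = (\<Oplus>i\<in>?I. P (\<nu> i))"
  proof (rule finsum_reindex)
    show "P \<in> \<nu> ` ?I \<rightarrow> carrier A" using I(1) I_eq by auto
    show "inj_on \<nu> ?I" by (rule inj_on_subset[OF bij_betw_imp_inj_on[OF \<nu>]]) blast
  qed
  then have eq: "(\<Oplus>w\<in>I. P w) = (\<Oplus>i\<in>?I. P (\<nu> i))" by (simp only: I_eq)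
  have "?I \<subseteq> verts G" unfolding VG by blast
  moreover have "?I \<noteq> {}" using I(2) I_eq by blast
  ultimately show ?thesis
    unfolding eq
    by (rule corner_leavitt[OF H.sub.leavitt_family_axioms H.sub_faithful[OF assms(1)]
          H.sub_full[OF assms(2)]])
qed


section \<open>Left modules\<close>

context left_module
begin

lemma smult_l_null [simp]: "x \<in> carrier M \<Longrightarrow> \<zero>\<^bsub>R\<^esub> \<odot>\<^bsub>M\<^esub> x = \<zero>\<^bsub>M\<^esub>"
  by (metis M.add.l_cancel_one' R.l_zero R.zero_closed smult_closed smult_l_distr)

lemma smult_r_null [simp]: "a \<in> carrier R \<Longrightarrow> a \<odot>\<^bsub>M\<^esub> \<zero>\<^bsub>M\<^esub> = \<zero>\<^bsub>M\<^esub>"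
  by (metis M.add.l_cancel_one' M.l_zero M.zero_closed smult_closed smult_r_distr)

lemma smult_l_minus:
  assumes "a \<in> carrier R" "x \<in> carrier M"
  shows "(\<ominus>\<^bsub>R\<^esub> a) \<odot>\<^bsub>M\<^esub> x = \<ominus>\<^bsub>M\<^esub> (a \<odot>\<^bsub>M\<^esub> x)"
proof -
  have "(\<ominus>\<^bsub>R\<^esub> a) \<odot>\<^bsub>M\<^esub> x \<oplus>\<^bsub>M\<^esub> a \<odot>\<^bsub>M\<^esub> x = (\<ominus>\<^bsub>R\<^esub> a \<oplus>\<^bsub>R\<^esub> a) \<odot>\<^bsub>M\<^esub> x"
    using assms by (intro smult_l_distr[symmetric]) auto
  also have "\<dots> = \<zero>\<^bsub>M\<^esub>" using assms by (simp add: R.l_neg)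
  finally show ?thesis using assms by (intro M.minus_equality[symmetric]) auto
qed

lemma finsum_smult_l:
  assumes "f \<in> B \<rightarrow> carrier R" "x \<in> carrier M"
  shows "(\<Oplus>\<^bsub>R\<^esub>i\<in>B. f i) \<odot>\<^bsub>M\<^esub> x = (\<Oplus>\<^bsub>M\<^esub>i\<in>B. f i \<odot>\<^bsub>M\<^esub> x)"
  using assms
  by (intro additive_finsum[where h = "\<lambda>a. a \<odot>\<^bsub>M\<^esub> x", OF R.is_abelian_group M.abelian_group_axioms])
    (auto simp: smult_l_distr)

lemma finsum_smult_r:
  assumes "f \<in> B \<rightarrow> carrier M" "a \<in> carrier R"
  shows "a \<odot>\<^bsub>M\<^esub> (\<Oplus>\<^bsub>M\<^esub>i\<in>B. f i) = (\<Oplus>\<^bsub>M\<^esub>i\<in>B. a \<odot>\<^bsub>M\<^esub> f i)"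
  using assms
  by (intro additive_finsum[where h = "\<lambda>x. a \<odot>\<^bsub>M\<^esub> x", OF M.abelian_group_axioms M.abelian_group_axioms])
    (auto simp: smult_r_distr)

lemma submoduleI:
  assumes "N \<subseteq> carrier M" "\<zero>\<^bsub>M\<^esub> \<in> N" "\<And>x y. \<lbrakk>x \<in> N; y \<in> N\<rbrakk> \<Longrightarrow> x \<oplus>\<^bsub>M\<^esub> y \<in> N"
    "\<And>a x. \<lbrakk>a \<in> carrier R; x \<in> N\<rbrakk> \<Longrightarrow> a \<odot>\<^bsub>M\<^esub> x \<in> N"
  shows "submodule N R M"
proof
  fix x assume x: "x \<in> N"
  then have "\<ominus>\<^bsub>M\<^esub> x = (\<ominus>\<^bsub>R\<^esub> \<one>\<^bsub>R\<^esub>) \<odot>\<^bsub>M\<^esub> x" using assms(1) by (auto simp: smult_l_minus)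
  then have "\<ominus>\<^bsub>M\<^esub> x \<in> N" using x assms(4) by simp
  then show "inv\<^bsub>add_monoid M\<^esub> x \<in> N" by (simp add: a_inv_def)
qed (use assms in auto)

lemma submoduleD:
  assumes "submodule N R M"
  shows "N \<subseteq> carrier M" "\<zero>\<^bsub>M\<^esub> \<in> N" "\<lbrakk>x \<in> N; y \<in> N\<rbrakk> \<Longrightarrow> x \<oplus>\<^bsub>M\<^esub> y \<in> N"
    "\<lbrakk>a \<in> carrier R; x \<in> N\<rbrakk> \<Longrightarrow> a \<odot>\<^bsub>M\<^esub> x \<in> N" "x \<in> N \<Longrightarrow> \<ominus>\<^bsub>M\<^esub> x \<in> N"
proof -
  interpret N: submodule N R M by fact
  show "N \<subseteq> carrier M" using N.subset by simp
  show "\<zero>\<^bsub>M\<^esub> \<in> N" using N.one_closed by simp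
  show "\<lbrakk>x \<in> N; y \<in> N\<rbrakk> \<Longrightarrow> x \<oplus>\<^bsub>M\<^esub> y \<in> N" using N.m_closed by simp
  show "\<lbrakk>a \<in> carrier R; x \<in> N\<rbrakk> \<Longrightarrow> a \<odot>\<^bsub>M\<^esub> x \<in> N" by (rule N.smult_closed)
  show "x \<in> N \<Longrightarrow> \<ominus>\<^bsub>M\<^esub> x \<in> N" using N.m_inv_closed[of x] by (simp add: a_inv_def)
qed

lemma finsum_in_submodule:
  assumes N: "submodule N R M" and f: "f \<in> B \<rightarrow> N"
  shows "(\<Oplus>\<^bsub>M\<^esub>i\<in>B. f i) \<in> N"
  using f
proof (induct B rule: infinite_finite_induct)
  case (insert i B)
  then have "f \<in> B \<rightarrow> carrier M" "f i \<in> carrier M" using submoduleD(1)[OF N] by auto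
  with insert show ?case using submoduleD(3)[OF N] by simp
qed (use submoduleD(2)[OF N] in auto)

text \<open>All that is kept of projectivity is an embedding into a free module.\<close>

lemma projective_coordinates:
  assumes "projective R M"
  obtains \<phi> :: "'c \<Rightarrow> 'c \<Rightarrow> 'a" where
    "\<And>i x. x \<in> carrier M \<Longrightarrow> \<phi> i x \<in> carrier R"
    "\<And>i x y. \<lbrakk>x \<in> carrier M; y \<in> carrier M\<rbrakk> \<Longrightarrow> \<phi> i (x \<oplus>\<^bsub>M\<^esub> y) = \<phi> i x \<oplus>\<^bsub>R\<^esub> \<phi> i y"
    "\<And>i a x. \<lbrakk>a \<in> carrier R; x \<in> carrier M\<rbrakk> \<Longrightarrow> \<phi> i (a \<odot>\<^bsub>M\<^esub> x) = a \<otimes>\<^bsub>R\<^esub> \<phi> i x"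
    "\<And>x. x \<in> carrier M \<Longrightarrow> finite {i. \<phi> i x \<noteq> \<zero>\<^bsub>R\<^esub>}"
    "\<And>x. \<lbrakk>x \<in> carrier M; \<And>i. \<phi> i x = \<zero>\<^bsub>R\<^esub>\<rbrakk> \<Longrightarrow> x = \<zero>\<^bsub>M\<^esub>"
proof -
  from assms obtain I :: "'c set" and A B h where
    A: "submodule A R (free_left_module R I)" and
    h: "h \<in> left_module_hom R M ((free_left_module R I)\<lparr>carrier := A\<rparr>)" "bij_betw h (carrier M) A"
    unfolding projective_def Let_def by blast
  interpret A: submodule A R "free_left_module R I" by fact
  have sub: "A \<subseteq> carrier (free_left_module R I)" using A.subset by simp
  have hA: "h x \<in> A" if "x \<in> carrier M" for x using h(1) that by (auto simp: left_module_hom_def)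
  have hc: "h x \<in> carrier (free_left_module R I)" if "x \<in> carrier M" for x
    using hA[OF that] sub by blast
  have hadd: "h (x \<oplus>\<^bsub>M\<^esub> y) = (\<lambda>i. h x i \<oplus>\<^bsub>R\<^esub> h y i)" if "x \<in> carrier M" "y \<in> carrier M" for x y
    using h(1) that by (auto simp: left_module_hom_def free_left_module_def)
  have hsm: "h (a \<odot>\<^bsub>M\<^esub> x) = (\<lambda>i. a \<otimes>\<^bsub>R\<^esub> h x i)" if "a \<in> carrier R" "x \<in> carrier M" for a x
    using h(1) that by (auto simp: left_module_hom_def free_left_module_def)
  have cl: "h x i \<in> carrier R" if "x \<in> carrier M" for x i
    using hc[OF that] by (auto simp: free_left_module_def)
  show thesis
  proof (rule that[where \<phi> = "\<lambda>i x. h x i"])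
    show "finite {i. h x i \<noteq> \<zero>\<^bsub>R\<^esub>}" if "x \<in> carrier M" for x
      using hc[OF that] by (auto simp: free_left_module_def)
    fix x assume x: "x \<in> carrier M" "\<And>i. h x i = \<zero>\<^bsub>R\<^esub>"
    have "h \<zero>\<^bsub>M\<^esub> = (\<lambda>i. \<zero>\<^bsub>R\<^esub> \<otimes>\<^bsub>R\<^esub> h x i)"
      using hsm[OF R.zero_closed x(1)] x(1) by simp
    also have "\<dots> = h x" using x(2) by auto
    finally show "x = \<zero>\<^bsub>M\<^esub>"
      using h(2) x(1) by (metis M.zero_closed bij_betw_imp_inj_on inj_onD)
  qed (use cl hadd hsm in auto)
qed

end


section \<open>Finitely generated projective modules are sums of vertex modules\<close>

text \<open>A left module over a Leavitt path algebra, with linear functionals \<open>\<phi> i\<close> that embed it into a free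
  module.\<close>

locale family_module = leavitt_family K A E P S T + Q: left_module A Q
  for K :: "('k, 'c) ring_scheme" and A :: "('k, 'a, 'm) module_scheme" (structure)
    and E :: "('v, 'e) pre_digraph" and P :: "'v \<Rightarrow> 'a" and S T :: "'e \<Rightarrow> 'a"
    and Q :: "('a, 'q, 'd) module_scheme" +
  fixes \<phi> :: "'i \<Rightarrow> 'q \<Rightarrow> 'a"
  assumes unit_one: "unit = \<one>"
    and carrier_generated: "carrier A \<subseteq> generated"
    and faithful: faithful
    and \<phi>_closed [simp]: "x \<in> carrier Q \<Longrightarrow> \<phi> i x \<in> carrier A"
    and \<phi>_add: "\<lbrakk>x \<in> carrier Q; y \<in> carrier Q\<rbrakk> \<Longrightarrow> \<phi> i (x \<oplus>\<^bsub>Q\<^esub> y) = \<phi> i x \<oplus> \<phi> i y"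
    and \<phi>_smult: "\<lbrakk>a \<in> carrier A; x \<in> carrier Q\<rbrakk> \<Longrightarrow> \<phi> i (a \<odot>\<^bsub>Q\<^esub> x) = a \<otimes> \<phi> i x"
    and \<phi>_finite: "x \<in> carrier Q \<Longrightarrow> finite {i. \<phi> i x \<noteq> \<zero>}"
    and \<phi>_inj: "\<lbrakk>x \<in> carrier Q; \<And>i. \<phi> i x = \<zero>\<rbrakk> \<Longrightarrow> x = \<zero>\<^bsub>Q\<^esub>"
begin

lemma \<phi>_finsum:
  "f \<in> B \<rightarrow> carrier Q \<Longrightarrow> \<phi> i (\<Oplus>\<^bsub>Q\<^esub>j\<in>B. f j) = (\<Oplus>j\<in>B. \<phi> i (f j))"
  by (rule additive_finsum[where h = "\<phi> i", OF Q.M.abelian_group_axioms is_abelian_group])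
    (auto simp: \<phi>_add)

lemma \<phi>_zero: "\<phi> i \<zero>\<^bsub>Q\<^esub> = \<zero>"
  using \<phi>_smult[of \<zero> "\<zero>\<^bsub>Q\<^esub>" i] by simp

lemma in_submoduleI:
  assumes N: "submodule N A Q" and x: "x \<in> carrier Q"
    and arcs: "\<And>e. e \<in> arcs E \<Longrightarrow> T e \<odot>\<^bsub>Q\<^esub> x \<in> N"
    and sinks: "\<And>w. \<lbrakk>w \<in> verts E; out_arcs E w = {}\<rbrakk> \<Longrightarrow> P w \<odot>\<^bsub>Q\<^esub> x \<in> N"
  shows "x \<in> N"
proof -
  have "P v \<odot>\<^bsub>Q\<^esub> x \<in> N" if v: "v \<in> verts E" for v
  proof (cases "out_arcs E v = {}")
    case False
    have "P v \<odot>\<^bsub>Q\<^esub> x = (\<Oplus>\<^bsub>Q\<^esub>e\<in>out_arcs E v. (S e \<otimes> T e) \<odot>\<^bsub>Q\<^esub> x)"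
      unfolding sum_S_T[OF v False] using x by (intro Q.finsum_smult_l) auto
    also have "\<dots> \<in> N"
      using arcs x Q.submoduleD(4)[OF N] by (intro Q.finsum_in_submodule[OF N]) (auto simp: Q.smult_assoc1)
    finally show ?thesis .
  qed (use sinks v in auto)
  then have "(\<Oplus>\<^bsub>Q\<^esub>v\<in>verts E. P v \<odot>\<^bsub>Q\<^esub> x) \<in> N"
    by (intro Q.finsum_in_submodule[OF N]) auto
  also have "(\<Oplus>\<^bsub>Q\<^esub>v\<in>verts E. P v \<odot>\<^bsub>Q\<^esub> x) = unit \<odot>\<^bsub>Q\<^esub> x"
    unfolding unit_def using x by (intro Q.finsum_smult_l[symmetric]) auto
  finally show ?thesis using x by (simp add: unit_one)
qed

definition ghost_generators :: "'q set \<Rightarrow> 'q \<Rightarrow> bool"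
  where "ghost_generators Y x \<longleftrightarrow> finite Y \<and> Y \<subseteq> carrier Q \<and> (\<forall>y\<in>Y. \<forall>i. \<phi> i y \<in> ghosts) \<and>
    (\<forall>N. submodule N A Q \<and> Y \<subseteq> N \<longrightarrow> x \<in> N)"

lemma ex_ghost_generators:
  assumes "x \<in> carrier Q" "\<And>i. \<phi> i x \<in> reducible n"
  shows "\<exists>Y. ghost_generators Y x"
  using assms
proof (induct n arbitrary: x)
  case 0
  then show ?case by (intro exI[of _ "{x}"]) (auto simp: ghost_generators_def)
next
  case (Suc n)
  have "\<exists>Y. ghost_generators Y (T e \<odot>\<^bsub>Q\<^esub> x)" if e: "e \<in> arcs E" for e
  proof (rule Suc(1))
    show "\<phi> i (T e \<odot>\<^bsub>Q\<^esub> x) \<in> reducible n" for i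
      using Suc(2,3) e by (simp add: \<phi>_smult)
  qed (use Suc(2) e in auto)
  then obtain Y where Y: "\<And>e. e \<in> arcs E \<Longrightarrow> ghost_generators (Y e) (T e \<odot>\<^bsub>Q\<^esub> x)" by metis
  let ?W = "{w \<in> verts E. out_arcs E w = {}}"
  let ?Y = "(\<Union>e\<in>arcs E. Y e) \<union> (\<lambda>w. P w \<odot>\<^bsub>Q\<^esub> x) ` ?W"
  have "\<phi> i (P w \<odot>\<^bsub>Q\<^esub> x) \<in> ghosts" if "w \<in> ?W" for w i
    using that Suc(2) Suc(3)[of i] by (simp add: \<phi>_smult)
  moreover have "x \<in> N" if N: "submodule N A Q" and sub: "?Y \<subseteq> N" for N
  proof (rule in_submoduleI[OF N Suc(2)])
    show "T e \<odot>\<^bsub>Q\<^esub> x \<in> N" if "e \<in> arcs E" for e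
      using Y[OF that] that N sub unfolding ghost_generators_def by blast
  qed (use sub in auto)
  moreover have "finite (Y e)" "Y e \<subseteq> carrier Q" "\<forall>y\<in>Y e. \<forall>i. \<phi> i y \<in> ghosts" if "e \<in> arcs E" for e
    using Y[OF that] unfolding ghost_generators_def by blast+
  moreover have "?Y \<subseteq> carrier Q"
    using Y Suc(2) unfolding ghost_generators_def by (auto simp: subset_iff)
  ultimately have "ghost_generators ?Y x"
    unfolding ghost_generators_def by auto
  then show ?case ..
qed

text \<open>\<open>bounded v d x\<close>: all coordinates of \<open>x = P v \<odot> x\<close> are combinations of ghost paths of
  length less than \<open>d\<close>.\<close>

definition bounded :: "'v \<Rightarrow> nat \<Rightarrow> 'q \<Rightarrow> bool"
  where "bounded v d x \<longleftrightarrow> v \<in> verts E \<and> x \<in> carrier Q \<and> P v \<odot>\<^bsub>Q\<^esub> x = x \<and>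
    (\<forall>i. \<forall>y\<in>verts E. \<exists>c\<in>ghost_coeffs K E v y.
      (\<forall>w. c w \<noteq> \<zero>\<^bsub>K\<^esub> \<longrightarrow> length w < d) \<and> \<phi> i x \<otimes> P y = eval_ghost c \<otimes> P y)"

lemma ghost_bounded:
  assumes v: "v \<in> verts E" and x: "x \<in> carrier Q" "P v \<odot>\<^bsub>Q\<^esub> x = x" "\<And>i. \<phi> i x \<in> ghosts"
  shows "\<exists>d. bounded v d x"
proof -
  let ?X = "{i. \<phi> i x \<noteq> \<zero>} \<times> verts E"
  have "\<exists>c. c \<in> ghost_coeffs K E v y \<and> \<phi> i x \<otimes> P y = eval_ghost c \<otimes> P y" if y: "y \<in> verts E" for i y
  proof -
    obtain c where "c \<in> ghost_coeffs K E v y" "P v \<otimes> (\<phi> i x \<otimes> P y) = eval_ghost c \<otimes> P y"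
      using ghostsE[OF x(3) v y] by metis
    moreover have "P v \<otimes> (\<phi> i x \<otimes> P y) = \<phi> i x \<otimes> P y"
      using \<phi>_smult[of "P v" x i] v x y by (simp flip: m_assoc)
    ultimately show ?thesis by auto
  qed
  then have "\<forall>i y. \<exists>c. y \<in> verts E \<longrightarrow>
      c \<in> ghost_coeffs K E v y \<and> \<phi> i x \<otimes> P y = eval_ghost c \<otimes> P y" by blast
  then obtain c where "\<forall>i y. y \<in> verts E \<longrightarrow>
      c i y \<in> ghost_coeffs K E v y \<and> \<phi> i x \<otimes> P y = eval_ghost (c i y) \<otimes> P y" by metis
  then have c: "\<And>i y. y \<in> verts E \<Longrightarrow> c i y \<in> ghost_coeffs K E v y"
    "\<And>i y. y \<in> verts E \<Longrightarrow> \<phi> i x \<otimes> P y = eval_ghost (c i y) \<otimes> P y" by blast+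
  have fin: "finite (\<Union>(i, y)\<in>?X. {w. c i y w \<noteq> \<zero>\<^bsub>K\<^esub>})" (is "finite ?U")
    using \<phi>_finite[OF x(1)] K.ghost_coeffs_carrier[OF c(1)]
    by (intro finite_UN_I) (auto simp: K.free_algebra_carrier)
  then obtain d where d: "\<And>w. w \<in> ?U \<Longrightarrow> length w < d"
    using finite_nat_set_iff_bounded[of "length ` ?U"] by auto
  have "\<exists>c\<in>ghost_coeffs K E v y. (\<forall>w. c w \<noteq> \<zero>\<^bsub>K\<^esub> \<longrightarrow> length w < d) \<and> \<phi> i x \<otimes> P y = eval_ghost c \<otimes> P y"
    if y: "y \<in> verts E" for i y
  proof (cases "\<phi> i x = \<zero>")
    case True
    then show ?thesis using y
      by (intro bexI[OF _ K.ghost_coeffs_zero])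
        (simp add: eval_free_zero[OF T_funcset], simp add: K.free_algebra_simps)
  next
    case False
    have "length w < d" if "c i y w \<noteq> \<zero>\<^bsub>K\<^esub>" for w
    proof (rule d)
      show "w \<in> ?U" using that False y by blast
    qed
    then show ?thesis using y c by (intro bexI[OF _ c(1)]) auto
  qed
  then show ?thesis using v x unfolding bounded_def by blast
qed

definition spanning :: "nat set \<Rightarrow> (nat \<Rightarrow> 'q) \<Rightarrow> bool"
  where "spanning J b \<longleftrightarrow> (\<forall>N. submodule N A Q \<and> b ` J \<subseteq> N \<longrightarrow> carrier Q \<subseteq> N)"

definition independent :: "nat set \<Rightarrow> (nat \<Rightarrow> 'v) \<Rightarrow> (nat \<Rightarrow> 'q) \<Rightarrow> bool"
  where "independent J \<nu> b \<longleftrightarrow> (\<forall>x\<in>verts E. \<forall>\<alpha>. (\<forall>k\<in>J. \<alpha> k \<in> ghost_coeffs K E x (\<nu> k)) \<and>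
    (\<Oplus>\<^bsub>Q\<^esub>k\<in>J. eval_ghost (\<alpha> k) \<odot>\<^bsub>Q\<^esub> b k) = \<zero>\<^bsub>Q\<^esub> \<longrightarrow>
    (\<forall>k\<in>J. \<alpha> k = \<zero>\<^bsub>free_algebra K (arcs E)\<^esub>))"

text \<open>Every coordinate of a generator is reducible, and only finitely many are nonzero.  So finitely many
  products of the generators with ghost paths generate the module and have all their coordinates in the
  span of the ghost paths.\<close>

lemma ex_bounded_spanning:
  assumes "finitely_generated A Q"
  shows "\<exists>J b \<nu> d. finite J \<and> spanning J b \<and> (\<forall>j\<in>J. bounded (\<nu> j) (d j) (b j))"
proof -
  from assms obtain Z where Z: "finite Z" "Z \<subseteq> carrier Q" "\<Inter>{N. submodule N A Q \<and> Z \<subseteq> N} = carrier Q"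
    unfolding finitely_generated_def by blast
  have "\<exists>Y. ghost_generators Y z" if "z \<in> Z" for z
  proof -
    from that have z: "z \<in> carrier Q" using Z(2) by auto
    have "\<exists>n. \<phi> i z \<in> reducible n" for i
      using carrier_generated z \<phi>_closed generated_imp_reducible by blast
    then obtain n where n: "\<And>i. \<phi> i z \<in> reducible (n i)" by metis
    obtain m where m: "\<And>i. \<phi> i z \<noteq> \<zero> \<Longrightarrow> n i < m"
      using finite_nat_set_iff_bounded[of "n ` {i. \<phi> i z \<noteq> \<zero>}"] \<phi>_finite[OF z] by auto
    have "\<phi> i z \<in> reducible m" for i
    proof (cases "\<phi> i z = \<zero>")
      case True
      then show ?thesis using reducible_zero by simp
    next
      case False
      then show ?thesis using m n reducible_mono[of "n i" m] by (simp add: less_imp_le)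
    qed
    then show ?thesis using z by (intro ex_ghost_generators)
  qed
  then obtain Y where "\<And>z. z \<in> Z \<Longrightarrow> ghost_generators (Y z) z" by metis
  then have Y: "\<And>z. z \<in> Z \<Longrightarrow> finite (Y z)"
    "\<And>z. z \<in> Z \<Longrightarrow> Y z \<subseteq> carrier Q" "\<And>z y i. z \<in> Z \<Longrightarrow> y \<in> Y z \<Longrightarrow> \<phi> i y \<in> ghosts"
    "\<And>z N. \<lbrakk>z \<in> Z; submodule N A Q; Y z \<subseteq> N\<rbrakk> \<Longrightarrow> z \<in> N"
    unfolding ghost_generators_def by blast+
  let ?Y = "\<Union>z\<in>Z. Y z"
  define X where "X = (\<lambda>(y, w). (P w \<odot>\<^bsub>Q\<^esub> y, w)) ` (?Y \<times> verts E)"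
  have "finite X" unfolding X_def using Z(1) Y(1) by auto
  then obtain g where g: "bij_betw g {0..<card X} X" using ex_bij_betw_nat_finite by blast
  let ?J = "{0..<card X}"
  define b \<nu> where "b j = fst (g j)" and "\<nu> j = snd (g j)" for j
  have "\<exists>d. bounded (\<nu> j) d (b j)" if "j \<in> ?J" for j
  proof -
    have "g j \<in> X" using g that by (auto simp: bij_betw_def)
    then obtain z y w where *: "z \<in> Z" "y \<in> Y z" "w \<in> verts E" "g j = (P w \<odot>\<^bsub>Q\<^esub> y, w)"
      unfolding X_def by auto
    then have "y \<in> carrier Q" "\<And>i. \<phi> i y \<in> ghosts" using Y by auto
    then show ?thesis using *
      by (intro ghost_bounded)
        (auto simp: b_def \<nu>_def \<phi>_smult ghosts_P P_P simp flip: Q.smult_assoc1)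
  qed
  then obtain d where "\<And>j. j \<in> ?J \<Longrightarrow> bounded (\<nu> j) (d j) (b j)" by metis
  moreover have "spanning ?J b"
    unfolding spanning_def
  proof (intro allI impI; elim conjE)
    fix N assume N: "submodule N A Q" and bN: "b ` ?J \<subseteq> N"
    have "b ` ?J = fst ` X" using g by (auto simp: b_def bij_betw_def image_image[symmetric])
    then have PN: "P w \<odot>\<^bsub>Q\<^esub> y \<in> N" if "y \<in> ?Y" "w \<in> verts E" for y w
      using that bN unfolding X_def by force
    have "y \<in> N" if y: "y \<in> ?Y" for y
    proof (rule in_submoduleI[OF N])
      show yc: "y \<in> carrier Q" using y Y(2) by auto
      fix e assume e: "e \<in> arcs E"
      have "T e \<odot>\<^bsub>Q\<^esub> (P (tail E e) \<odot>\<^bsub>Q\<^esub> y) \<in> N"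
        using e y PN Q.submoduleD(4)[OF N] by auto
      then show "T e \<odot>\<^bsub>Q\<^esub> y \<in> N" using e yc by (simp flip: Q.smult_assoc1)
    qed (use PN y in auto)
    then have "Z \<subseteq> N" using Y(4)[OF _ N] by blast
    then show "carrier Q \<subseteq> N" using Z(3) N by blast
  qed
  ultimately show ?thesis by blast
qed

lemma bounded_zero:
  assumes "bounded v 0 x"
  shows "x = \<zero>\<^bsub>Q\<^esub>"
proof (rule \<phi>_inj)
  show x: "x \<in> carrier Q" using assms by (simp add: bounded_def)
  fix i
  have "\<phi> i x \<otimes> P y = \<zero>" if y: "y \<in> verts E" for y
  proof -
    obtain c where c: "c \<in> ghost_coeffs K E v y" "\<And>w. \<not> c w \<noteq> \<zero>\<^bsub>K\<^esub>" "\<phi> i x \<otimes> P y = eval_ghost c \<otimes> P y"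
      using assms y unfolding bounded_def by (metis less_nat_zero_code)
    have "c = \<zero>\<^bsub>free_algebra K (arcs E)\<^esub>" using c(2) by (auto simp: K.free_algebra_simps)
    then show ?thesis using c(3) y by (simp add: eval_free_zero[OF T_funcset])
  qed
  then have "(\<Oplus>y\<in>verts E. \<phi> i x \<otimes> P y) = \<zero>" by (intro add.finprod_one_eqI)
  then show "\<phi> i x = \<zero>" using unit_right[of "\<phi> i x"] x by (simp add: unit_one)
qed

lemma ghost_coeffs_finsum:
  assumes "\<And>k. k \<in> J \<Longrightarrow> g k \<in> ghost_coeffs K E x y"
  shows "(\<Oplus>\<^bsub>free_algebra K (arcs E)\<^esub>k\<in>J. g k) \<in> ghost_coeffs K E x y"
proof -
  interpret F: kalgebra K "free_algebra K (arcs E)" by (rule K.free_algebra_kalgebra)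
  show ?thesis using assms
  proof (induct J rule: infinite_finite_induct)
    case (insert k J)
    have "g i \<in> carrier (free_algebra K (arcs E))" if "i \<in> insert k J" for i
      using insert(4)[OF that] by (rule K.ghost_coeffs_carrier)
    then have "g \<in> J \<rightarrow> carrier (free_algebra K (arcs E))" "g k \<in> carrier (free_algebra K (arcs E))"
      by auto
    with insert show ?case by (simp add: K.ghost_coeffs_add)
  qed (simp_all add: K.ghost_coeffs_zero)
qed

lemma finsum_coeff:
  assumes "\<And>k. k \<in> J \<Longrightarrow> g k \<in> carrier (free_algebra K X)"
  shows "(\<Oplus>\<^bsub>free_algebra K X\<^esub>k\<in>J. g k) z = (\<Oplus>\<^bsub>K\<^esub>k\<in>J. g k z)"
proof -
  interpret F: kalgebra K "free_algebra K X" by (rule K.free_algebra_kalgebra)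
  show ?thesis
    by (rule additive_finsum[where h = "\<lambda>f. f z", OF F.is_abelian_group K.is_abelian_group])
      (use assms in \<open>auto simp: K.free_algebra_simps(4)\<close>)
qed

lemma eval_ghost_combination:
  assumes b: "\<And>k. k \<in> J \<Longrightarrow> b k \<in> carrier Q"
    and \<gamma>: "\<And>k. k \<in> J \<Longrightarrow> \<gamma> k \<in> ghost_coeffs K E x (\<nu> k)"
    and c: "\<And>k. k \<in> J \<Longrightarrow> c k \<in> ghost_coeffs K E (\<nu> k) y"
      "\<And>k. k \<in> J \<Longrightarrow> \<phi> i (b k) \<otimes> P y = eval_ghost (c k) \<otimes> P y"
    and y: "y \<in> verts E" and J: "finite J"
  shows "\<phi> i (\<Oplus>\<^bsub>Q\<^esub>k\<in>J. eval_ghost (\<gamma> k) \<odot>\<^bsub>Q\<^esub> b k) \<otimes> P y =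
    eval_ghost (\<Oplus>\<^bsub>free_algebra K (arcs E)\<^esub>k\<in>J. \<gamma> k \<otimes>\<^bsub>free_algebra K (arcs E)\<^esub> c k) \<otimes> P y"
proof -
  let ?F = "free_algebra K (arcs E)"
  interpret F: kalgebra K ?F by (rule K.free_algebra_kalgebra)
  have cl: "\<gamma> k \<in> carrier ?F" "c k \<in> carrier ?F" "eval_ghost (\<gamma> k) \<in> carrier A" "eval_ghost (c k) \<in> carrier A"
    if "k \<in> J" for k
    using \<gamma>[OF that] c(1)[OF that] by (auto simp: K.ghost_coeffs_carrier)
  have "\<phi> i (\<Oplus>\<^bsub>Q\<^esub>k\<in>J. eval_ghost (\<gamma> k) \<odot>\<^bsub>Q\<^esub> b k) = (\<Oplus>k\<in>J. \<phi> i (eval_ghost (\<gamma> k) \<odot>\<^bsub>Q\<^esub> b k))"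
    using b cl by (intro \<phi>_finsum) auto
  also have "\<dots> = (\<Oplus>k\<in>J. eval_ghost (\<gamma> k) \<otimes> \<phi> i (b k))"
    using b cl by (intro finsum_cong') (auto simp: \<phi>_smult)
  also have "\<dots> \<otimes> P y = (\<Oplus>k\<in>J. (eval_ghost (\<gamma> k) \<otimes> \<phi> i (b k)) \<otimes> P y)"
    using b cl y J by (intro finsum_ldistr) auto
  also have "\<dots> = (\<Oplus>k\<in>J. eval_ghost (\<gamma> k \<otimes>\<^bsub>?F\<^esub> c k) \<otimes> P y)"
    using b cl c(2) y by (intro finsum_cong') (auto simp: m_assoc eval_free_mult[OF T_funcset])
  also have "\<dots> = (\<Oplus>k\<in>J. eval_ghost (\<gamma> k \<otimes>\<^bsub>?F\<^esub> c k)) \<otimes> P y"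
    using cl y J by (intro finsum_ldistr[symmetric]) (auto simp: eval_free_mult[OF T_funcset])
  also have "(\<Oplus>k\<in>J. eval_ghost (\<gamma> k \<otimes>\<^bsub>?F\<^esub> c k)) = eval_ghost (\<Oplus>\<^bsub>?F\<^esub>k\<in>J. \<gamma> k \<otimes>\<^bsub>?F\<^esub> c k)"
    by (rule additive_finsum[where h = eval_ghost, OF F.is_abelian_group is_abelian_group, symmetric])
      (use cl in \<open>auto simp: eval_free_closed[OF T_funcset] eval_free_add[OF T_funcset]\<close>)
  finally show ?thesis .
qed

text \<open>This is the weak algorithm of free algebras, for ghost paths.  Take a relation
  \<open>\<Sum>k. \<alpha> k \<odot> b k = 0\<close> with ghost coefficients \<open>\<alpha> k\<close>, among the terms with \<open>deg (\<alpha> k) + d k\<close>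
  largest let \<open>j\<close> have \<open>d j\<close> largest, and let \<open>w\<close> be a longest word of \<open>\<alpha> j\<close>.  Let \<open>\<beta> k\<close> consist of the
  words of \<open>\<alpha> k\<close> that begin with \<open>w\<close>, with this \<open>w\<close> removed.  Then \<open>\<beta> j\<close> is a nonzero scalar, so
  \<open>b' = \<Sum>k. \<beta> k \<odot> b k\<close> can replace \<open>b j\<close>.  The coordinates of \<open>b'\<close> have smaller degree: the part of
  the relation in words that begin with \<open>w\<close> vanishes, and what distinguishes it from \<open>b'\<close> comes
  from words of the \<open>\<alpha> k\<close> that are shorter than \<open>w\<close>, which by the choice of \<open>j\<close> contribute only words of
  low degree.\<close>

lemma reduce_dependent:
  assumes J: "finite J" and sp: "spanning J b" and bd: "\<And>j. j \<in> J \<Longrightarrow> bounded (\<nu> j) (d j) (b j)"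
    and dep: "\<not> independent J \<nu> b"
  shows "\<exists>j b'. j \<in> J \<and> spanning J (b(j := b')) \<and> (b' = \<zero>\<^bsub>Q\<^esub> \<or> 0 < d j \<and> bounded (\<nu> j) (d j - 1) b')"
proof -
  let ?F = "free_algebra K (arcs E)"
  interpret F: kalgebra K ?F by (rule K.free_algebra_kalgebra)
  from dep obtain x \<alpha> where x: "x \<in> verts E" and \<alpha>: "\<And>k. k \<in> J \<Longrightarrow> \<alpha> k \<in> ghost_coeffs K E x (\<nu> k)"
    and sum: "(\<Oplus>\<^bsub>Q\<^esub>k\<in>J. eval_ghost (\<alpha> k) \<odot>\<^bsub>Q\<^esub> b k) = \<zero>\<^bsub>Q\<^esub>"
    and nz: "\<exists>k\<in>J. \<alpha> k \<noteq> \<zero>\<^bsub>?F\<^esub>"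
    unfolding independent_def by blast
  have b: "b k \<in> carrier Q" "P (\<nu> k) \<odot>\<^bsub>Q\<^esub> b k = b k" "\<nu> k \<in> verts E" if "k \<in> J" for k
    using bd[OF that] by (auto simp: bounded_def)
  define J' where "J' = {k \<in> J. \<exists>w. \<alpha> k w \<noteq> \<zero>\<^bsub>K\<^esub>}"
  have J': "finite J'" "J' \<noteq> {}"
    using J nz by (auto simp: J'_def K.free_algebra_simps fun_eq_iff)
  define deg where "deg k = Max (length ` {w. \<alpha> k w \<noteq> \<zero>\<^bsub>K\<^esub>})" for k
  have fin: "finite {w. \<alpha> k w \<noteq> \<zero>\<^bsub>K\<^esub>}" if "k \<in> J" for k
    using K.ghost_coeffs_carrier[OF \<alpha>[OF that]] by (simp add: K.free_algebra_carrier)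
  have deg_le: "length w \<le> deg k" if "k \<in> J" "\<alpha> k w \<noteq> \<zero>\<^bsub>K\<^esub>" for k w
    unfolding deg_def using fin[OF that(1)] that(2) by (intro Max_ge) auto
  define D where "D = Max ((\<lambda>k. deg k + d k) ` J')"
  have D_ge: "deg k + d k \<le> D" if "k \<in> J'" for k
    unfolding D_def using J' that by (intro Max_ge) auto
  let ?J'' = "{k \<in> J'. deg k + d k = D}"
  have "D \<in> (\<lambda>k. deg k + d k) ` J'" unfolding D_def using J' by (intro Max_in) auto
  then have J'': "finite ?J''" "?J'' \<noteq> {}" using J' by auto
  then have "Max (d ` ?J'') \<in> d ` ?J''" by (intro Max_in) auto
  then obtain j where j: "j \<in> J'" "deg j + d j = D" and dj: "d j = Max (d ` ?J'')" by auto
  have d_max: "d k \<le> d j" if "k \<in> J'" "deg k + d k = D" for k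
    unfolding dj using J'' that by (intro Max_ge) auto
  have jJ: "j \<in> J" using j(1) by (simp add: J'_def)
  have "deg j \<in> length ` {w. \<alpha> j w \<noteq> \<zero>\<^bsub>K\<^esub>}"
    unfolding deg_def using fin[OF jJ] j(1) by (intro Max_in) (auto simp: J'_def)
  then obtain w where w: "\<alpha> j w \<noteq> \<zero>\<^bsub>K\<^esub>" "length w = deg j" by auto
  have wp: "ghost_path E x w (\<nu> j)" using K.ghost_coeffs_path[OF \<alpha>[OF jJ] w(1)] .
  \<comment> \<open>The ghost path \<open>w\<close> ends at \<open>\<nu> j\<close>, so the remainders of words that begin with \<open>w\<close> start there.\<close>
  define \<beta> where "\<beta> k z = \<alpha> k (w @ z)" for k z
  have \<beta>: "\<beta> k \<in> ghost_coeffs K E (\<nu> j) (\<nu> k)" if k: "k \<in> J" for k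
  proof -
    have path: "ghost_path E (\<nu> j) z (\<nu> k)" if "\<beta> k z \<noteq> \<zero>\<^bsub>K\<^esub>" for z
      using K.ghost_coeffs_path[OF \<alpha>[OF k], of "w @ z"] that
      by (intro ghost_path_suffix[OF wp]) (simp add: \<beta>_def)
    have "finite ((\<lambda>z. w @ z) -` {w. \<alpha> k w \<noteq> \<zero>\<^bsub>K\<^esub>})"
      using fin[OF k] by (rule finite_vimageI) (simp add: inj_on_def)
    then have "finite {z. \<beta> k z \<noteq> \<zero>\<^bsub>K\<^esub>}" by (simp add: vimage_def \<beta>_def)
    moreover have "\<beta> k z \<in> carrier K" for z
      using K.ghost_coeffs_carrier[OF \<alpha>[OF k]] by (simp add: \<beta>_def)
    ultimately have "\<beta> k \<in> carrier ?F"
      using ghost_path_arcs[OF path] by (simp add: K.free_algebra_carrier)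
    then show ?thesis using path by (simp add: ghost_coeffs_def)
  qed
  define b' where "b' = (\<Oplus>\<^bsub>Q\<^esub>k\<in>J. eval_ghost (\<beta> k) \<odot>\<^bsub>Q\<^esub> b k)"
  have \<beta>c: "eval_ghost (\<beta> k) \<in> carrier A" if "k \<in> J" for k using \<beta>[OF that] by simp
  have b'c: "b' \<in> carrier Q" unfolding b'_def using b \<beta>c by (intro Q.M.finsum_closed) auto
  have Pb': "P (\<nu> j) \<odot>\<^bsub>Q\<^esub> b' = b'"
  proof -
    have "P (\<nu> j) \<odot>\<^bsub>Q\<^esub> b' = (\<Oplus>\<^bsub>Q\<^esub>k\<in>J. P (\<nu> j) \<odot>\<^bsub>Q\<^esub> (eval_ghost (\<beta> k) \<odot>\<^bsub>Q\<^esub> b k))"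
      unfolding b'_def using b \<beta>c jJ by (intro Q.finsum_smult_r) auto
    also have "\<dots> = b'" unfolding b'_def
    proof (rule Q.M.finsum_cong')
      fix k assume k: "k \<in> J"
      have "P (\<nu> j) \<odot>\<^bsub>Q\<^esub> (eval_ghost (\<beta> k) \<odot>\<^bsub>Q\<^esub> (P (\<nu> k) \<odot>\<^bsub>Q\<^esub> b k)) =
          (P (\<nu> j) \<otimes> (eval_ghost (\<beta> k) \<otimes> P (\<nu> k))) \<odot>\<^bsub>Q\<^esub> b k"
        using k jJ b \<beta>c by (simp add: Q.smult_assoc1)
      also have "\<dots> = (eval_ghost (\<beta> k) \<otimes> P (\<nu> k)) \<odot>\<^bsub>Q\<^esub> b k"
        using P_eval_ghost[OF \<beta>[OF k] b(3)[OF jJ] b(3)[OF k]] by simp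
      also have "\<dots> = eval_ghost (\<beta> k) \<odot>\<^bsub>Q\<^esub> (P (\<nu> k) \<odot>\<^bsub>Q\<^esub> b k)"
        using k b \<beta>c by (simp add: Q.smult_assoc1)
      finally show "P (\<nu> j) \<odot>\<^bsub>Q\<^esub> (eval_ghost (\<beta> k) \<odot>\<^bsub>Q\<^esub> b k) = eval_ghost (\<beta> k) \<odot>\<^bsub>Q\<^esub> b k"
        using b(2)[OF k] by simp
    qed (use b \<beta>c in auto)
    finally show ?thesis .
  qed
  have spanning': "spanning J (b(j := b'))"
    unfolding spanning_def
  proof (intro allI impI; elim conjE)
    fix N assume N: "submodule N A Q" and bN: "(b(j := b')) ` J \<subseteq> N"
    have b'N: "b' \<in> N" and bkN: "\<And>k. k \<in> J - {j} \<Longrightarrow> b k \<in> N" using bN jJ by auto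
    have r: "(\<Oplus>\<^bsub>Q\<^esub>k\<in>J - {j}. eval_ghost (\<beta> k) \<odot>\<^bsub>Q\<^esub> b k) \<in> N" (is "?r \<in> N")
      using bkN \<beta>c Q.submoduleD(4)[OF N] by (intro Q.finsum_in_submodule[OF N]) auto
    have rc: "?r \<in> carrier Q" using r Q.submoduleD(1)[OF N] by blast
    define a where "a = \<alpha> j w"
    have a: "a \<in> carrier K" "a \<noteq> \<zero>\<^bsub>K\<^esub>"
      using K.ghost_coeffs_carrier[OF \<alpha>[OF jJ]] w(1) by (auto simp: a_def)
    have "\<beta> j = a \<odot>\<^bsub>?F\<^esub> word K []"
    proof
      fix z
      have "\<alpha> j (w @ z) = \<zero>\<^bsub>K\<^esub>" if "z \<noteq> []"
        using deg_le[OF jJ, of "w @ z"] w(2) that by auto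
      then show "\<beta> j z = (a \<odot>\<^bsub>?F\<^esub> word K []) z"
        using a by (auto simp: \<beta>_def a_def word_def K.free_algebra_simps)
    qed
    then have ev: "eval_ghost (\<beta> j) = a \<odot> \<one>"
      using eval_free_word[OF T_funcset a(1), of "[]"] by simp
    have "b' = (\<Oplus>\<^bsub>Q\<^esub>k\<in>insert j (J - {j}). eval_ghost (\<beta> k) \<odot>\<^bsub>Q\<^esub> b k)"
      unfolding b'_def using jJ by (simp add: insert_absorb)
    also have "\<dots> = (a \<odot> \<one>) \<odot>\<^bsub>Q\<^esub> b j \<oplus>\<^bsub>Q\<^esub> ?r"
      using J b \<beta>c jJ a by (subst Q.M.finsum_insert) (auto simp: ev)
    finally have "b' = (a \<odot> \<one>) \<odot>\<^bsub>Q\<^esub> b j \<oplus>\<^bsub>Q\<^esub> ?r" .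
    then have "(a \<odot> \<one>) \<odot>\<^bsub>Q\<^esub> b j = b' \<oplus>\<^bsub>Q\<^esub> \<ominus>\<^bsub>Q\<^esub> ?r"
      using a rc b[OF jJ] by (simp add: Q.M.a_assoc Q.M.r_neg)
    then have "(a \<odot> \<one>) \<odot>\<^bsub>Q\<^esub> b j \<in> N"
      using b'N r Q.submoduleD(3,5)[OF N] by simp
    then have "(inv\<^bsub>K\<^esub> a \<odot> \<one>) \<odot>\<^bsub>Q\<^esub> ((a \<odot> \<one>) \<odot>\<^bsub>Q\<^esub> b j) \<in> N"
      using Q.submoduleD(4)[OF N] a K.field_Units by auto
    also have "(inv\<^bsub>K\<^esub> a \<odot> \<one>) \<odot>\<^bsub>Q\<^esub> ((a \<odot> \<one>) \<odot>\<^bsub>Q\<^esub> b j) = b j"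
    proof -
      have i: "inv\<^bsub>K\<^esub> a \<in> carrier K" "inv\<^bsub>K\<^esub> a \<otimes>\<^bsub>K\<^esub> a = \<one>\<^bsub>K\<^esub>"
        using a K.field_Units by auto
      have "(inv\<^bsub>K\<^esub> a \<odot> \<one>) \<otimes> (a \<odot> \<one>) = \<one>"
        using a i by (simp add: smult_mult_l flip: smult_assoc1)
      then show ?thesis using a i b[OF jJ] by (simp flip: Q.smult_assoc1)
    qed
    finally have "b j \<in> N" .
    then have "b ` J \<subseteq> N" using bkN by auto
    then show "carrier Q \<subseteq> N" using sp N unfolding spanning_def by blast
  qed
  show ?thesis
  proof (cases "d j = 0")
    case True
    have "bounded (\<nu> j) 0 (b j)" using bd[OF jJ] True by simp
    then have "b j = \<zero>\<^bsub>Q\<^esub>" by (rule bounded_zero)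
    then have "b(j := \<zero>\<^bsub>Q\<^esub>) = b" by auto
    then show ?thesis using jJ sp by (intro exI[of _ j] exI[of _ "\<zero>\<^bsub>Q\<^esub>"]) auto
  next
    case False
    have "\<exists>c\<in>ghost_coeffs K E (\<nu> j) y. (\<forall>z. c z \<noteq> \<zero>\<^bsub>K\<^esub> \<longrightarrow> length z < d j - 1) \<and>
        \<phi> i b' \<otimes> P y = eval_ghost c \<otimes> P y" if y: "y \<in> verts E" for i y
    proof -
      have "\<forall>k\<in>J. \<exists>c. c \<in> ghost_coeffs K E (\<nu> k) y \<and> (\<forall>w. c w \<noteq> \<zero>\<^bsub>K\<^esub> \<longrightarrow> length w < d k) \<and>
          \<phi> i (b k) \<otimes> P y = eval_ghost c \<otimes> P y"
        using bd y unfolding bounded_def by blast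
      from bchoice[OF this] obtain c where c: "\<And>k. k \<in> J \<Longrightarrow> c k \<in> ghost_coeffs K E (\<nu> k) y"
        "\<And>k z. k \<in> J \<Longrightarrow> c k z \<noteq> \<zero>\<^bsub>K\<^esub> \<Longrightarrow> length z < d k"
        "\<And>k. k \<in> J \<Longrightarrow> \<phi> i (b k) \<otimes> P y = eval_ghost (c k) \<otimes> P y" by metis
      have cl: "\<alpha> k \<in> carrier ?F" "\<beta> k \<in> carrier ?F" "c k \<in> carrier ?F" if "k \<in> J" for k
        using K.ghost_coeffs_carrier[OF \<alpha>[OF that]] K.ghost_coeffs_carrier[OF \<beta>[OF that]]
          K.ghost_coeffs_carrier[OF c(1)[OF that]] by auto
      let ?r = "\<Oplus>\<^bsub>?F\<^esub>k\<in>J. \<beta> k \<otimes>\<^bsub>?F\<^esub> c k" and ?s = "\<Oplus>\<^bsub>?F\<^esub>k\<in>J. \<alpha> k \<otimes>\<^bsub>?F\<^esub> c k"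
      have rG: "?r \<in> ghost_coeffs K E (\<nu> j) y"
        using \<beta> c(1) by (intro ghost_coeffs_finsum K.ghost_coeffs_mult) auto
      have sG: "?s \<in> ghost_coeffs K E x y"
        using \<alpha> c(1) by (intro ghost_coeffs_finsum K.ghost_coeffs_mult) auto
      have rb: "\<phi> i b' \<otimes> P y = eval_ghost ?r \<otimes> P y"
        unfolding b'_def by (rule eval_ghost_combination[OF b(1) \<beta> c(1,3) y J])
      have "eval_ghost ?s \<otimes> P y = \<phi> i (\<Oplus>\<^bsub>Q\<^esub>k\<in>J. eval_ghost (\<alpha> k) \<odot>\<^bsub>Q\<^esub> b k) \<otimes> P y"
        by (rule eval_ghost_combination[OF b(1) \<alpha> c(1,3) y J, symmetric])
      also have "\<dots> = \<zero>" using y by (simp add: sum \<phi>_zero)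
      finally have s0: "?s = \<zero>\<^bsub>?F\<^esub>" using faithful sG x y unfolding faithful_def by blast
      have "?r z = \<zero>\<^bsub>K\<^esub>" if z: "\<not> length z < d j - 1" for z
      proof -
        \<comment> \<open>In the convolution at \<open>w @ z\<close> only those splittings contribute in which \<open>\<alpha> k\<close> gets all of \<open>w\<close>.\<close>
        have eq: "(\<alpha> k \<otimes>\<^bsub>?F\<^esub> c k) (w @ z) = (\<beta> k \<otimes>\<^bsub>?F\<^esub> c k) z" if k: "k \<in> J" for k
        proof -
          let ?t = "\<lambda>n. \<alpha> k (take n (w @ z)) \<otimes>\<^bsub>K\<^esub> c k (drop n (w @ z))"
          let ?h = "\<lambda>n. n + length w"
          have tc: "?t n \<in> carrier K" for n using cl[OF k] by simp
          have small: "?t n = \<zero>\<^bsub>K\<^esub>" if n: "n < length w" for n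
          proof (rule ccontr)
            assume "?t n \<noteq> \<zero>\<^bsub>K\<^esub>"
            then have 1: "\<alpha> k (take n w) \<noteq> \<zero>\<^bsub>K\<^esub>" "c k (drop n w @ z) \<noteq> \<zero>\<^bsub>K\<^esub>"
              using n cl[OF k] by auto
            have "k \<in> J'" using 1(1) k by (auto simp: J'_def)
            then have 2: "deg k + d k \<le> D" "deg k + d k = D \<Longrightarrow> d k \<le> d j"
              using D_ge d_max by blast+
            have "n \<le> deg k" using deg_le[OF k 1(1)] n by simp
            moreover have "length w - n + length z < d k" using c(2)[OF k 1(2)] n by simp
            ultimately show False using 2 z n False j(2) w(2) by linarith
          qed
          have "(\<alpha> k \<otimes>\<^bsub>?F\<^esub> c k) (w @ z) = (\<Oplus>\<^bsub>K\<^esub>n\<in>{..length (w @ z)}. ?t n)"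
            by (simp add: K.free_algebra_simps)
          also have "\<dots> = (\<Oplus>\<^bsub>K\<^esub>n\<in>?h ` {..length z}. ?t n)"
          proof (rule K.add.finprod_mono_neutral_cong_right)
            show "?h ` {..length z} \<subseteq> {..length (w @ z)}" by auto
            fix n assume n: "n \<in> {..length (w @ z)} - ?h ` {..length z}"
            have "n < length w"
            proof (rule ccontr)
              assume "\<not> n < length w"
              then have "n = ?h (n - length w)" "n - length w \<in> {..length z}" using n by auto
              then show False using n by blast
            qed
            then show "?t n = \<zero>\<^bsub>K\<^esub>" by (rule small)
          qed (use tc in auto)
          also have "\<dots> = (\<Oplus>\<^bsub>K\<^esub>n\<in>{..length z}. ?t (?h n))"
            using tc by (intro K.finsum_reindex) (auto simp: inj_on_def)
          also have "\<dots> = (\<beta> k \<otimes>\<^bsub>?F\<^esub> c k) z"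
            by (simp add: K.free_algebra_simps \<beta>_def)
          finally show ?thesis .
        qed
        have "?r z = (\<Oplus>\<^bsub>K\<^esub>k\<in>J. (\<beta> k \<otimes>\<^bsub>?F\<^esub> c k) z)"
          using cl by (intro finsum_coeff) auto
        also have "\<dots> = (\<Oplus>\<^bsub>K\<^esub>k\<in>J. (\<alpha> k \<otimes>\<^bsub>?F\<^esub> c k) (w @ z))"
          using eq K.free_algebra_coeff[OF F.m_closed[OF cl(2,3)]] by (intro K.finsum_cong') auto
        also have "\<dots> = ?s (w @ z)"
          using cl by (intro finsum_coeff[symmetric]) auto
        also have "\<dots> = \<zero>\<^bsub>K\<^esub>" unfolding s0 by (simp add: K.free_algebra_simps)
        finally show ?thesis .
      qed
      then show ?thesis using rG rb by blast
    qed
    then have "bounded (\<nu> j) (d j - 1) b'"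
      using b'c Pb' b(3)[OF jJ] unfolding bounded_def by blast
    then show ?thesis using jJ spanning' False by auto
  qed
qed

text \<open>Each reduction step lowers a degree bound or removes an element, which makes the sum of the
  \<open>Suc (d j)\<close> smaller.\<close>

lemma ex_bounded_basis:
  assumes "finite J" "spanning J b" "\<And>j. j \<in> J \<Longrightarrow> bounded (\<nu> j) (d j) (b j)"
  shows "\<exists>J b d. finite J \<and> spanning J b \<and> independent J \<nu> b \<and> (\<forall>j\<in>J. bounded (\<nu> j) (d j) (b j))"
  using assms
proof (induct "\<Sum>j\<in>J. Suc (d j)" arbitrary: J b d rule: less_induct)
  case less
  show ?case
  proof (cases "independent J \<nu> b")
    case True
    then show ?thesis using less by blast
  next
    case False
    then obtain j b' where j: "j \<in> J" and sp: "spanning J (b(j := b'))" and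
      b': "b' = \<zero>\<^bsub>Q\<^esub> \<or> 0 < d j \<and> bounded (\<nu> j) (d j - 1) b'"
      using reduce_dependent[OF less(2-4)] by blast
    from b' show ?thesis
    proof (elim disjE conjE)
      assume zero: "b' = \<zero>\<^bsub>Q\<^esub>"
      show ?thesis
      proof (rule less(1))
        show "(\<Sum>j\<in>J - {j}. Suc (d j)) < (\<Sum>j\<in>J. Suc (d j))"
          using less(2) j by (subst sum.remove[of J j]) auto
        show "spanning (J - {j}) b"
          unfolding spanning_def
        proof (intro allI impI; elim conjE)
          fix N assume N: "submodule N A Q" and bN: "b ` (J - {j}) \<subseteq> N"
          then have "(b(j := b')) ` J \<subseteq> N" using zero Q.submoduleD(2)[OF N] by auto
          then show "carrier Q \<subseteq> N" using sp N unfolding spanning_def by blast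
        qed
      qed (use less in auto)
    next
      assume d: "0 < d j" "bounded (\<nu> j) (d j - 1) b'"
      show ?thesis
      proof (rule less(1))
        let ?d = "d(j := d j - 1)"
        have "(\<Sum>i\<in>J - {j}. Suc (?d i)) = (\<Sum>i\<in>J - {j}. Suc (d i))" by (rule sum.cong) auto
        then show "(\<Sum>j\<in>J. Suc (?d j)) < (\<Sum>j\<in>J. Suc (d j))"
          using less(2) j d(1) by (simp add: sum.remove[of J j])
        show "bounded (\<nu> k) (?d k) ((b(j := b')) k)" if "k \<in> J" for k
          using less(4)[OF that] d by simp
        show "spanning J (b(j := b'))" by (rule sp)
      qed (rule less(2))
    qed
  qed
qed

text \<open>A relation over the whole algebra can be multiplied from the left by \<open>T e\<close> and by sinks until its
  coefficients lie in the span of the ghost paths.\<close>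

lemma independent_over_algebra:
  assumes J: "finite J" and ind: "independent J \<nu> b"
    and b: "\<And>k. k \<in> J \<Longrightarrow> b k \<in> carrier Q" "\<And>k. k \<in> J \<Longrightarrow> P (\<nu> k) \<odot>\<^bsub>Q\<^esub> b k = b k"
      "\<And>k. k \<in> J \<Longrightarrow> \<nu> k \<in> verts E"
    and l: "\<And>k. k \<in> J \<Longrightarrow> l k \<in> reducible n" "\<And>k. k \<in> J \<Longrightarrow> l k \<otimes> P (\<nu> k) = l k"
    and zero: "(\<Oplus>\<^bsub>Q\<^esub>k\<in>J. l k \<odot>\<^bsub>Q\<^esub> b k) = \<zero>\<^bsub>Q\<^esub>" and k: "k \<in> J"
  shows "l k = \<zero>"
proof -
  have base: "l k = \<zero>" if l: "\<And>k. k \<in> J \<Longrightarrow> l k \<in> ghosts" "\<And>k. k \<in> J \<Longrightarrow> l k \<otimes> P (\<nu> k) = l k"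
    and zero: "(\<Oplus>\<^bsub>Q\<^esub>k\<in>J. l k \<odot>\<^bsub>Q\<^esub> b k) = \<zero>\<^bsub>Q\<^esub>" and k: "k \<in> J" for l k
  proof -
    have lc: "l k \<in> carrier A" if "k \<in> J" for k using l(1)[OF that] by (rule ghosts_carrier)
    have "P x \<otimes> l k = \<zero>" if x: "x \<in> verts E" for x
    proof -
      have "\<forall>k\<in>J. \<exists>c. c \<in> ghost_coeffs K E x (\<nu> k) \<and> P x \<otimes> l k = eval_ghost c \<otimes> P (\<nu> k)"
      proof
        fix k assume "k \<in> J"
        then show "\<exists>c. c \<in> ghost_coeffs K E x (\<nu> k) \<and> P x \<otimes> l k = eval_ghost c \<otimes> P (\<nu> k)"
          using ghostsE[OF l(1) x b(3)] l(2) by metis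
      qed
      from bchoice[OF this] obtain \<alpha> where \<alpha>: "\<And>k. k \<in> J \<Longrightarrow> \<alpha> k \<in> ghost_coeffs K E x (\<nu> k)"
        "\<And>k. k \<in> J \<Longrightarrow> P x \<otimes> l k = eval_ghost (\<alpha> k) \<otimes> P (\<nu> k)" by metis
      have "(\<Oplus>\<^bsub>Q\<^esub>k\<in>J. eval_ghost (\<alpha> k) \<odot>\<^bsub>Q\<^esub> b k) = (\<Oplus>\<^bsub>Q\<^esub>k\<in>J. P x \<odot>\<^bsub>Q\<^esub> (l k \<odot>\<^bsub>Q\<^esub> b k))"
      proof (rule Q.M.finsum_cong')
        fix k assume k: "k \<in> J"
        have ec: "eval_ghost (\<alpha> k) \<in> carrier A" using \<alpha>(1)[OF k] by simp
        have "eval_ghost (\<alpha> k) \<odot>\<^bsub>Q\<^esub> b k = (eval_ghost (\<alpha> k) \<otimes> P (\<nu> k)) \<odot>\<^bsub>Q\<^esub> b k"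
          using k b ec by (simp add: Q.smult_assoc1)
        also have "\<dots> = P x \<odot>\<^bsub>Q\<^esub> (l k \<odot>\<^bsub>Q\<^esub> b k)"
          unfolding \<alpha>(2)[OF k, symmetric] using k b lc x by (simp add: Q.smult_assoc1)
        finally show "eval_ghost (\<alpha> k) \<odot>\<^bsub>Q\<^esub> b k = P x \<odot>\<^bsub>Q\<^esub> (l k \<odot>\<^bsub>Q\<^esub> b k)" .
      qed (use b lc x in auto)
      also have "\<dots> = P x \<odot>\<^bsub>Q\<^esub> (\<Oplus>\<^bsub>Q\<^esub>k\<in>J. l k \<odot>\<^bsub>Q\<^esub> b k)"
        using b lc x by (intro Q.finsum_smult_r[symmetric]) auto
      also have "\<dots> = \<zero>\<^bsub>Q\<^esub>" using x by (simp add: zero)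
      finally have "\<alpha> k = \<zero>\<^bsub>free_algebra K (arcs E)\<^esub>"
        using ind \<alpha>(1) x k unfolding independent_def by blast
      then show ?thesis using \<alpha>(2)[OF k] b(3)[OF k] by (simp add: eval_free_zero[OF T_funcset])
    qed
    then have "(\<Oplus>x\<in>verts E. P x \<otimes> l k) = \<zero>" by (intro add.finprod_one_eqI)
    then show ?thesis using unit_left[OF lc[OF k]] lc[OF k] by (simp add: unit_one)
  qed
  show ?thesis using l zero k
  proof (induct n arbitrary: l k)
    case 0
    then show ?case using base[of l k] by simp
  next
    case (Suc n)
    have lc: "l k \<in> carrier A" if "k \<in> J" for k using Suc(2)[OF that] by simp
    have mult: "(\<Oplus>\<^bsub>Q\<^esub>k\<in>J. (a \<otimes> l k) \<odot>\<^bsub>Q\<^esub> b k) = \<zero>\<^bsub>Q\<^esub>" if a: "a \<in> carrier A" for a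
    proof -
      have "(\<Oplus>\<^bsub>Q\<^esub>k\<in>J. (a \<otimes> l k) \<odot>\<^bsub>Q\<^esub> b k) = (\<Oplus>\<^bsub>Q\<^esub>k\<in>J. a \<odot>\<^bsub>Q\<^esub> (l k \<odot>\<^bsub>Q\<^esub> b k))"
        using a lc b by (intro Q.M.finsum_cong') (auto simp: Q.smult_assoc1)
      also have "\<dots> = a \<odot>\<^bsub>Q\<^esub> (\<Oplus>\<^bsub>Q\<^esub>k\<in>J. l k \<odot>\<^bsub>Q\<^esub> b k)"
        using a lc b by (intro Q.finsum_smult_r[symmetric]) auto
      finally show ?thesis using a Suc(4) by simp
    qed
    show ?case
    proof (rule eq_zeroI[OF lc[OF Suc(5)]])
      show "unit \<otimes> l k = l k" using lc[OF Suc(5)] by (simp add: unit_one)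
      show "T e \<otimes> l k = \<zero>" if e: "e \<in> arcs E" for e
        using Suc(1)[of "\<lambda>k. T e \<otimes> l k" k] Suc(2,3,5) e mult[of "T e"] b(3) lc by (simp add: m_assoc)
      show "P w \<otimes> l k = \<zero>" if w: "w \<in> verts E" "out_arcs E w = {}" for w
        using base[of "\<lambda>k. P w \<otimes> l k" k] Suc(2,3,5) w mult[of "P w"] b(3) lc by (simp add: m_assoc)
    qed
  qed
qed

theorem vertex_basis:
  assumes "finitely_generated A Q"
  obtains J :: "nat set" and b \<nu> where "finite J" "spanning J b"
    "\<And>j. j \<in> J \<Longrightarrow> b j \<in> carrier Q" "\<And>j. j \<in> J \<Longrightarrow> \<nu> j \<in> verts E"
    "\<And>j. j \<in> J \<Longrightarrow> P (\<nu> j) \<odot>\<^bsub>Q\<^esub> b j = b j"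
    "\<And>l k. \<lbrakk>\<And>k. k \<in> J \<Longrightarrow> l k \<in> carrier A; \<And>k. k \<in> J \<Longrightarrow> l k \<otimes> P (\<nu> k) = l k;
      (\<Oplus>\<^bsub>Q\<^esub>k\<in>J. l k \<odot>\<^bsub>Q\<^esub> b k) = \<zero>\<^bsub>Q\<^esub>; k \<in> J\<rbrakk> \<Longrightarrow> l k = \<zero>"
proof -
  obtain J0 b0 \<nu> d0 where "finite J0" "spanning J0 b0" "\<forall>j\<in>J0. bounded (\<nu> j) (d0 j) (b0 j)"
    using ex_bounded_spanning[OF assms] by blast
  then obtain J b d where J: "finite J" "spanning J b" and ind: "independent J \<nu> b"
    and bd: "\<forall>j\<in>J. bounded (\<nu> j) (d j) (b j)"
    using ex_bounded_basis[of J0 b0 \<nu> d0] by blast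
  have b: "b k \<in> carrier Q" "P (\<nu> k) \<odot>\<^bsub>Q\<^esub> b k = b k" "\<nu> k \<in> verts E" if "k \<in> J" for k
    using bd that by (auto simp: bounded_def)
  have "l k = \<zero>" if l: "\<And>k. k \<in> J \<Longrightarrow> l k \<in> carrier A" "\<And>k. k \<in> J \<Longrightarrow> l k \<otimes> P (\<nu> k) = l k"
    "(\<Oplus>\<^bsub>Q\<^esub>k\<in>J. l k \<odot>\<^bsub>Q\<^esub> b k) = \<zero>\<^bsub>Q\<^esub>" "k \<in> J" for l k
  proof -
    have "\<forall>k\<in>J. \<exists>n. l k \<in> reducible n"
      using l(1) carrier_generated generated_imp_reducible by blast
    from bchoice[OF this] obtain n where n: "\<And>k. k \<in> J \<Longrightarrow> l k \<in> reducible (n k)" by blast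
    obtain m where m: "\<And>k. k \<in> J \<Longrightarrow> n k < m"
      using finite_nat_set_iff_bounded[of "n ` J"] J(1) by auto
    have "l k \<in> reducible m" if "k \<in> J" for k
      using n[OF that] m[OF that] reducible_mono[of "n k" m "l k"] by simp
    then show ?thesis using independent_over_algebra[OF J(1) ind b] l(2-4) by blast
  qed
  then show thesis using that[of J b \<nu>] J b by blast
qed

end


section \<open>Endomorphism algebras as corners\<close>

text \<open>The module is the direct sum of the submodules generated by the \<open>b j\<close>, and \<open>b j\<close> corresponds to the
  idempotent \<open>\<pi> j\<close> under an isomorphism of the \<open>j\<close>-th summand with \<open>R \<pi> j\<close>.\<close>

locale based_module = Q: left_module R Q
  for R :: "('r, 'd) ring_scheme" (structure) and Q :: "('r, 'q, 'f) module_scheme" +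
  fixes J :: "'j set" and b :: "'j \<Rightarrow> 'q" and \<pi> :: "'j \<Rightarrow> 'r"
  assumes J: "finite J" and b [simp]: "j \<in> J \<Longrightarrow> b j \<in> carrier Q"
    and \<pi> [simp]: "j \<in> J \<Longrightarrow> \<pi> j \<in> carrier R" "j \<in> J \<Longrightarrow> \<pi> j \<otimes> \<pi> j = \<pi> j"
      "j \<in> J \<Longrightarrow> \<pi> j \<odot>\<^bsub>Q\<^esub> b j = b j"
    and spanning: "\<lbrakk>submodule N R Q; b ` J \<subseteq> N\<rbrakk> \<Longrightarrow> carrier Q \<subseteq> N"
    and indep: "\<lbrakk>\<And>k. k \<in> J \<Longrightarrow> l k \<in> carrier R; \<And>k. k \<in> J \<Longrightarrow> l k \<otimes> \<pi> k = l k;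
      (\<Oplus>\<^bsub>Q\<^esub>k\<in>J. l k \<odot>\<^bsub>Q\<^esub> b k) = \<zero>\<^bsub>Q\<^esub>; k \<in> J\<rbrakk> \<Longrightarrow> l k = \<zero>"
begin

definition coords :: "('j \<Rightarrow> 'r) \<Rightarrow> bool"
  where "coords l \<longleftrightarrow> (\<forall>k\<in>J. l k \<in> carrier R \<and> l k \<otimes> \<pi> k = l k)"

definition comb :: "('j \<Rightarrow> 'r) \<Rightarrow> 'q"
  where "comb l = (\<Oplus>\<^bsub>Q\<^esub>k\<in>J. l k \<odot>\<^bsub>Q\<^esub> b k)"

lemma coordsD: "\<lbrakk>coords l; k \<in> J\<rbrakk> \<Longrightarrow> l k \<in> carrier R" "\<lbrakk>coords l; k \<in> J\<rbrakk> \<Longrightarrow> l k \<otimes> \<pi> k = l k"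
  by (auto simp: coords_def)

lemma comb_closed: "coords l \<Longrightarrow> comb l \<in> carrier Q"
  unfolding comb_def by (intro Q.M.finsum_closed) (auto simp: coordsD)

lemma coords_add: "\<lbrakk>coords l; coords l'\<rbrakk> \<Longrightarrow> coords (\<lambda>k. l k \<oplus> l' k)"
  by (simp add: coords_def Q.R.l_distr)

lemma comb_add:
  assumes "coords l" "coords l'"
  shows "comb (\<lambda>k. l k \<oplus> l' k) = comb l \<oplus>\<^bsub>Q\<^esub> comb l'"
proof -
  have "comb (\<lambda>k. l k \<oplus> l' k) = (\<Oplus>\<^bsub>Q\<^esub>k\<in>J. l k \<odot>\<^bsub>Q\<^esub> b k \<oplus>\<^bsub>Q\<^esub> l' k \<odot>\<^bsub>Q\<^esub> b k)"
    unfolding comb_def using assms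
    by (intro Q.M.finsum_cong') (auto simp: Q.smult_l_distr coords_def)
  also have "\<dots> = comb l \<oplus>\<^bsub>Q\<^esub> comb l'"
    unfolding comb_def using assms by (intro Q.M.finsum_addf) (auto simp: coords_def)
  finally show ?thesis .
qed

lemma coords_smult: "\<lbrakk>coords l; a \<in> carrier R\<rbrakk> \<Longrightarrow> coords (\<lambda>k. a \<otimes> l k)"
  by (simp add: coords_def Q.R.m_assoc)

lemma comb_smult:
  assumes "coords l" "a \<in> carrier R"
  shows "comb (\<lambda>k. a \<otimes> l k) = a \<odot>\<^bsub>Q\<^esub> comb l"
proof -
  have "comb (\<lambda>k. a \<otimes> l k) = (\<Oplus>\<^bsub>Q\<^esub>k\<in>J. a \<odot>\<^bsub>Q\<^esub> (l k \<odot>\<^bsub>Q\<^esub> b k))"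
    unfolding comb_def using assms by (intro Q.M.finsum_cong') (auto simp: Q.smult_assoc1 coords_def)
  also have "\<dots> = a \<odot>\<^bsub>Q\<^esub> comb l"
    unfolding comb_def using assms by (intro Q.finsum_smult_r[symmetric]) (auto simp: coords_def)
  finally show ?thesis .
qed

lemma comb_unique:
  assumes l: "coords l" "coords l'" "comb l = comb l'" and k: "k \<in> J"
  shows "l k = l' k"
proof -
  let ?d = "\<lambda>k. l k \<oplus> (\<ominus> \<one>) \<otimes> l' k"
  have m: "\<ominus> \<one> \<in> carrier R" by simp
  have d: "coords ?d" by (rule coords_add[OF l(1) coords_smult[OF l(2) m]])
  have "comb ?d = comb l' \<oplus>\<^bsub>Q\<^esub> (\<ominus> \<one>) \<odot>\<^bsub>Q\<^esub> comb l'"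
    using comb_add[OF l(1) coords_smult[OF l(2) m]] comb_smult[OF l(2) m] l(3) by simp
  also have "\<dots> = \<zero>\<^bsub>Q\<^esub>"
    using comb_closed[OF l(2)] by (simp add: Q.smult_l_minus Q.M.r_neg)
  finally have "?d k = \<zero>"
    using d k unfolding comb_def by (intro indep[of ?d k]) (auto simp: coords_def)
  then have "l k \<ominus> l' k = \<zero>"
    using coordsD(1)[OF l(1) k] coordsD(1)[OF l(2) k] by (simp add: Q.R.minus_eq Q.R.l_minus)
  then show ?thesis
    using coordsD(1)[OF l(1) k] coordsD(1)[OF l(2) k] by (rule Q.R.eq_if_minus_zero)
qed

lemma basis_coords:
  assumes j: "j \<in> J"
  shows "coords (\<lambda>k. if j = k then \<pi> k else \<zero>)" "comb (\<lambda>k. if j = k then \<pi> k else \<zero>) = b j"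
proof -
  show "coords (\<lambda>k. if j = k then \<pi> k else \<zero>)" by (auto simp: coords_def)
  have "comb (\<lambda>k. if j = k then \<pi> k else \<zero>) = (\<Oplus>\<^bsub>Q\<^esub>k\<in>J. if j = k then b k else \<zero>\<^bsub>Q\<^esub>)"
    unfolding comb_def by (intro Q.M.finsum_cong') auto
  also have "\<dots> = b j" using j J by (intro Q.M.finsum_singleton) auto
  finally show "comb (\<lambda>k. if j = k then \<pi> k else \<zero>) = b j" .
qed

lemma ex_coords: "q \<in> carrier Q \<Longrightarrow> \<exists>l. coords l \<and> comb l = q"
proof -
  have "submodule (comb ` Collect coords) R Q"
  proof (rule Q.submoduleI)
    show "comb ` Collect coords \<subseteq> carrier Q" using comb_closed by auto
    have "coords (\<lambda>k. \<zero>)" by (simp add: coords_def)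
    moreover have "comb (\<lambda>k. \<zero>) = \<zero>\<^bsub>Q\<^esub>"
      unfolding comb_def by (intro Q.M.add.finprod_one_eqI) auto
    ultimately show "\<zero>\<^bsub>Q\<^esub> \<in> comb ` Collect coords" by (metis image_eqI mem_Collect_eq)
    show "x \<oplus>\<^bsub>Q\<^esub> y \<in> comb ` Collect coords"
      if "x \<in> comb ` Collect coords" "y \<in> comb ` Collect coords" for x y
      using that comb_add[symmetric] coords_add by auto
    show "a \<odot>\<^bsub>Q\<^esub> x \<in> comb ` Collect coords" if "a \<in> carrier R" "x \<in> comb ` Collect coords" for a x
      using that comb_smult[symmetric] coords_smult by auto
  qed
  moreover have "b ` J \<subseteq> comb ` Collect coords"
    using basis_coords(2)[symmetric] basis_coords(1) by auto
  ultimately have "carrier Q \<subseteq> comb ` Collect coords" by (rule spanning)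
  then show "q \<in> carrier Q \<Longrightarrow> \<exists>l. coords l \<and> comb l = q" by blast
qed

definition coord :: "'q \<Rightarrow> 'j \<Rightarrow> 'r"
  where "coord q = (SOME l. coords l \<and> comb l = q)"

lemma coord: "q \<in> carrier Q \<Longrightarrow> coords (coord q) \<and> comb (coord q) = q"
  unfolding coord_def using ex_coords by (rule someI_ex)

lemma coord_comb: "\<lbrakk>coords l; k \<in> J\<rbrakk> \<Longrightarrow> coord (comb l) k = l k"
  using coord[OF comb_closed] by (intro comb_unique) auto

end

text \<open>The ring \<open>R\<close> is identified by \<open>\<iota>\<close> with the corner of \<open>C\<close> at \<open>e = \<iota> \<one>\<close>, and \<open>s j\<close>, \<open>t j\<close> provide
  an equivalence of \<open>\<iota> (\<pi> j)\<close> with an idempotent \<open>s j \<otimes> t j\<close>; these idempotents are orthogonal, with sum \<open>p\<close>.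
  Then \<open>Q\<close> is isomorphic to the left \<open>R\<close>-module \<open>e C p\<close> by the map \<open>\<kappa>\<close>, and \<open>p C p\<close> acts on \<open>e C p\<close> from the
  right.\<close>

locale corner_realization = R: kalgebra K R + C: kalgebra K C + based_module R Q J b \<pi>
  for K :: "('k, 'c) ring_scheme" and R :: "('k, 'r, 'd) module_scheme"
    and C :: "('k, 'a, 'g) module_scheme" (structure) and Q :: "('r, 'q, 'f) module_scheme"
    and J :: "'j set" and b :: "'j \<Rightarrow> 'q" and \<pi> :: "'j \<Rightarrow> 'r" +
  fixes \<iota> :: "'r \<Rightarrow> 'a" and s t :: "'j \<Rightarrow> 'a" and p :: 'a
  assumes \<iota>: "nonunital_hom K R C \<iota>" and \<iota>_inj: "inj_on \<iota> (carrier R)"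
    and \<iota>_image: "\<lbrakk>z \<in> carrier C; \<iota> \<one>\<^bsub>R\<^esub> \<otimes> (z \<otimes> \<iota> \<one>\<^bsub>R\<^esub>) = z\<rbrakk> \<Longrightarrow> z \<in> \<iota> ` carrier R"
    and s_closed [simp]: "j \<in> J \<Longrightarrow> s j \<in> carrier C" and t_closed [simp]: "j \<in> J \<Longrightarrow> t j \<in> carrier C"
    and s_\<pi>: "j \<in> J \<Longrightarrow> s j \<otimes> \<iota> (\<pi> j) = s j" and \<pi>_t: "j \<in> J \<Longrightarrow> \<iota> (\<pi> j) \<otimes> t j = t j"
    and t_s: "\<lbrakk>j \<in> J; k \<in> J\<rbrakk> \<Longrightarrow> t j \<otimes> s k = (if j = k then \<iota> (\<pi> k) else \<zero>)"
    and p_def: "p = (\<Oplus>j\<in>J. s j \<otimes> t j)"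
begin

lemmas \<iota>_hom = nonunital_homD[OF \<iota>]

lemma \<iota>_closed [simp]: "a \<in> carrier R \<Longrightarrow> \<iota> a \<in> carrier C"
  by (rule \<iota>_hom(1))

lemma p_closed [simp]: "p \<in> carrier C"
  unfolding p_def by (intro C.finsum_closed) auto

lemma finsum_delta:
  assumes "j \<in> J" "\<And>k. k \<in> J \<Longrightarrow> f k = (if j = k then g k else \<zero>)" "g \<in> J \<rightarrow> carrier C"
  shows "(\<Oplus>k\<in>J. f k) = g j"
proof -
  have "(\<Oplus>k\<in>J. f k) = (\<Oplus>k\<in>J. if j = k then g k else \<zero>)"
    using assms by (intro C.finsum_cong') auto
  also have "\<dots> = g j" using assms J by (intro C.finsum_singleton) auto
  finally show ?thesis .
qed

lemma p_left:
  assumes x: "x \<in> carrier C"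
  shows "p \<otimes> x = (\<Oplus>j\<in>J. s j \<otimes> (t j \<otimes> x))"
proof -
  have "p \<otimes> x = (\<Oplus>j\<in>J. (s j \<otimes> t j) \<otimes> x)"
    unfolding p_def using x J by (intro C.finsum_ldistr) auto
  also have "\<dots> = (\<Oplus>j\<in>J. s j \<otimes> (t j \<otimes> x))"
    using x by (intro C.finsum_cong') (auto simp: C.m_assoc)
  finally show ?thesis .
qed

lemma p_right:
  assumes x: "x \<in> carrier C"
  shows "x \<otimes> p = (\<Oplus>j\<in>J. (x \<otimes> s j) \<otimes> t j)"
proof -
  have "x \<otimes> p = (\<Oplus>j\<in>J. x \<otimes> (s j \<otimes> t j))"
    unfolding p_def using x J by (intro C.finsum_rdistr) auto
  also have "\<dots> = (\<Oplus>j\<in>J. (x \<otimes> s j) \<otimes> t j)"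
    using x by (intro C.finsum_cong') (auto simp: C.m_assoc)
  finally show ?thesis .
qed

lemma p_s: "j \<in> J \<Longrightarrow> p \<otimes> s j = s j"
  by (subst p_left, simp, rule finsum_delta[where g = s]) (auto simp: t_s s_\<pi>)

lemma t_p: "j \<in> J \<Longrightarrow> t j \<otimes> p = t j"
  by (subst p_right, simp, rule finsum_delta[where g = t]) (auto simp: t_s \<pi>_t)

lemma p_p: "p \<otimes> p = p"
proof -
  have "p \<otimes> p = (\<Oplus>j\<in>J. s j \<otimes> (t j \<otimes> p))" by (rule p_left) simp
  also have "\<dots> = p" unfolding p_def by (intro C.finsum_cong') (auto simp: t_p simp flip: p_def)
  finally show ?thesis .
qed

definition \<kappa> :: "'q \<Rightarrow> 'a"
  where "\<kappa> q = (\<Oplus>k\<in>J. \<iota> (coord q k) \<otimes> t k)"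

lemma \<kappa>_comb: "coords l \<Longrightarrow> \<kappa> (comb l) = (\<Oplus>k\<in>J. \<iota> (l k) \<otimes> t k)"
  unfolding \<kappa>_def by (intro C.finsum_cong') (auto simp: coord_comb coordsD)

lemma \<kappa>_comb_s:
  assumes l: "coords l" and j: "j \<in> J"
  shows "\<kappa> (comb l) \<otimes> s j = \<iota> (l j)"
proof -
  have lc: "l k \<in> carrier R" if "k \<in> J" for k using coordsD(1)[OF l that] .
  have "\<kappa> (comb l) \<otimes> s j = (\<Oplus>k\<in>J. (\<iota> (l k) \<otimes> t k) \<otimes> s j)"
    unfolding \<kappa>_comb[OF l] using lc J j by (intro C.finsum_ldistr) auto
  also have "\<dots> = \<iota> (l j)"
  proof (rule finsum_delta[OF j])
    fix k assume k: "k \<in> J"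
    have "\<iota> (l k) \<otimes> \<iota> (\<pi> k) = \<iota> (l k)"
      using coordsD[OF l k] k by (simp flip: \<iota>_hom(3))
    then show "(\<iota> (l k) \<otimes> t k) \<otimes> s j = (if j = k then \<iota> (l k) else \<zero>)"
      using k j lc t_s[OF k j] by (auto simp: C.m_assoc)
  qed (use lc in auto)
  finally show ?thesis .
qed

lemma \<kappa>_closed [simp]: "q \<in> carrier Q \<Longrightarrow> \<kappa> q \<in> carrier C"
  unfolding \<kappa>_def using coord coordsD(1) by (intro C.finsum_closed) auto

lemma \<kappa>_add:
  assumes "x \<in> carrier Q" "y \<in> carrier Q"
  shows "\<kappa> (x \<oplus>\<^bsub>Q\<^esub> y) = \<kappa> x \<oplus> \<kappa> y"
proof -
  obtain l l' where l: "coords l" "x = comb l" "coords l'" "y = comb l'"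
    using assms ex_coords by metis
  have "\<kappa> (x \<oplus>\<^bsub>Q\<^esub> y) = (\<Oplus>k\<in>J. \<iota> (l k \<oplus>\<^bsub>R\<^esub> l' k) \<otimes> t k)"
    using l \<kappa>_comb[OF coords_add[OF l(1,3)]] by (simp add: comb_add)
  also have "\<dots> = (\<Oplus>k\<in>J. \<iota> (l k) \<otimes> t k \<oplus> \<iota> (l' k) \<otimes> t k)"
    using coordsD(1)[OF l(1)] coordsD(1)[OF l(3)] by (intro C.finsum_cong') (auto simp: \<iota>_hom C.l_distr)
  also have "\<dots> = \<kappa> x \<oplus> \<kappa> y"
    unfolding l \<kappa>_comb[OF l(1)] \<kappa>_comb[OF l(3)]
    using coordsD(1)[OF l(1)] coordsD(1)[OF l(3)] by (intro C.finsum_addf) auto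
  finally show ?thesis .
qed

lemma \<kappa>_smult:
  assumes a: "a \<in> carrier R" and x: "x \<in> carrier Q"
  shows "\<kappa> (a \<odot>\<^bsub>Q\<^esub> x) = \<iota> a \<otimes> \<kappa> x"
proof -
  obtain l where l: "coords l" "x = comb l" using x ex_coords by metis
  have "\<kappa> (a \<odot>\<^bsub>Q\<^esub> x) = (\<Oplus>k\<in>J. \<iota> (a \<otimes>\<^bsub>R\<^esub> l k) \<otimes> t k)"
    using l \<kappa>_comb[OF coords_smult[OF l(1) a]] a by (simp add: comb_smult)
  also have "\<dots> = (\<Oplus>k\<in>J. \<iota> a \<otimes> (\<iota> (l k) \<otimes> t k))"
    using coordsD(1)[OF l(1)] a by (intro C.finsum_cong') (auto simp: \<iota>_hom C.m_assoc)
  also have "\<dots> = \<iota> a \<otimes> \<kappa> x"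
    unfolding l \<kappa>_comb[OF l(1)]
    using coordsD(1)[OF l(1)] a J by (intro C.finsum_rdistr[symmetric]) auto
  finally show ?thesis .
qed

lemma \<kappa>_eqI:
  assumes "\<kappa> x = \<kappa> y" "x \<in> carrier Q" "y \<in> carrier Q"
  shows "x = y"
proof -
  obtain l l' where l: "coords l" "x = comb l" "coords l'" "y = comb l'"
    using assms ex_coords by metis
  have "l k = l' k" if k: "k \<in> J" for k
  proof (rule inj_onD[OF \<iota>_inj _ coordsD(1)[OF l(1) k] coordsD(1)[OF l(3) k]])
    show "\<iota> (l k) = \<iota> (l' k)" using \<kappa>_comb_s[OF l(1) k] \<kappa>_comb_s[OF l(3) k] assms(1) l by simp
  qed
  then show "x = y"
    unfolding l comb_def using coordsD(1)[OF l(3)] by (intro Q.M.finsum_cong') auto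
qed

lemma \<kappa>_unit: "q \<in> carrier Q \<Longrightarrow> \<iota> \<one>\<^bsub>R\<^esub> \<otimes> \<kappa> q = \<kappa> q"
  using \<kappa>_smult[of "\<one>\<^bsub>R\<^esub>" q] by simp

lemma \<kappa>_b: "j \<in> J \<Longrightarrow> \<kappa> (b j) = t j"
proof -
  assume j: "j \<in> J"
  have "\<kappa> (b j) = (\<Oplus>k\<in>J. \<iota> (if j = k then \<pi> k else \<zero>\<^bsub>R\<^esub>) \<otimes> t k)"
    using \<kappa>_comb[OF basis_coords(1)[OF j]] basis_coords(2)[OF j] by simp
  also have "\<dots> = t j"
  proof (rule finsum_delta[OF j])
    have zero: "\<iota> \<zero>\<^bsub>R\<^esub> = \<zero>"
      by (rule nonunital_hom_zero[OF R.kalgebra_axioms C.kalgebra_axioms \<iota>])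
    fix k assume k: "k \<in> J"
    show "\<iota> (if j = k then \<pi> k else \<zero>\<^bsub>R\<^esub>) \<otimes> t k = (if j = k then t k else \<zero>)"
      using k by (cases "j = k") (simp_all add: \<pi>_t zero)
  qed simp
  finally show ?thesis .
qed

text \<open>An element \<open>z\<close> of \<open>e C p\<close> equals \<open>\<Sum>j. (z \<otimes> s j) \<otimes> t j\<close>, and the \<open>z \<otimes> s j\<close> lie in \<open>e C e\<close>, the
  image of \<open>R\<close>.\<close>

lemma \<kappa>_image: "\<kappa> ` carrier Q = {z \<in> carrier C. \<iota> \<one>\<^bsub>R\<^esub> \<otimes> z = z \<and> z \<otimes> p = z}"
proof (intro equalityI subsetI)
  fix z assume "z \<in> \<kappa> ` carrier Q"
  then obtain q where q: "q \<in> carrier Q" "z = \<kappa> q" by blast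
  from ex_coords[OF q(1)] obtain l where "coords l" "comb l = q" by blast
  with q have l: "coords l" "z = \<kappa> (comb l)" by simp_all
  then have c: "comb l \<in> carrier Q" using comb_closed by blast
  have "z \<otimes> p = (\<Oplus>k\<in>J. (z \<otimes> s k) \<otimes> t k)"
    using p_right[OF \<kappa>_closed[OF c]] l(2) by simp
  also have "\<dots> = (\<Oplus>k\<in>J. \<iota> (l k) \<otimes> t k)"
    using coordsD(1)[OF l(1)] \<kappa>_comb_s[OF l(1)] l(2) by (intro C.finsum_cong') auto
  finally have "z \<otimes> p = z" using \<kappa>_comb[OF l(1)] l(2) by simp
  then show "z \<in> {z \<in> carrier C. \<iota> \<one>\<^bsub>R\<^esub> \<otimes> z = z \<and> z \<otimes> p = z}"
    using \<kappa>_unit[OF c] \<kappa>_closed[OF c] l(2) by simp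
next
  fix z assume "z \<in> {z \<in> carrier C. \<iota> \<one>\<^bsub>R\<^esub> \<otimes> z = z \<and> z \<otimes> p = z}"
  then have z: "z \<in> carrier C" "\<iota> \<one>\<^bsub>R\<^esub> \<otimes> z = z" "z \<otimes> p = z" by auto
  have "\<exists>a. a \<in> carrier R \<and> z \<otimes> s j = \<iota> a" if j: "j \<in> J" for j
  proof -
    have "s j \<otimes> \<iota> \<one>\<^bsub>R\<^esub> = s j \<otimes> (\<iota> (\<pi> j) \<otimes> \<iota> \<one>\<^bsub>R\<^esub>)"
      using j s_\<pi>[OF j] by (simp flip: C.m_assoc)
    also have "\<dots> = s j" using j s_\<pi>[OF j] by (simp flip: \<iota>_hom(3))
    finally have se: "s j \<otimes> \<iota> \<one>\<^bsub>R\<^esub> = s j" .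
    have "\<iota> \<one>\<^bsub>R\<^esub> \<otimes> ((z \<otimes> s j) \<otimes> \<iota> \<one>\<^bsub>R\<^esub>) = (\<iota> \<one>\<^bsub>R\<^esub> \<otimes> z) \<otimes> (s j \<otimes> \<iota> \<one>\<^bsub>R\<^esub>)"
      using z(1) j by (simp add: C.m_assoc)
    also have "\<dots> = z \<otimes> s j" using z(2) se by simp
    finally have "z \<otimes> s j \<in> \<iota> ` carrier R" using z(1) j by (intro \<iota>_image) auto
    then show ?thesis by blast
  qed
  then have "\<forall>j\<in>J. \<exists>a. a \<in> carrier R \<and> z \<otimes> s j = \<iota> a" by blast
  from bchoice[OF this] obtain l where l: "\<And>j. j \<in> J \<Longrightarrow> l j \<in> carrier R"
    "\<And>j. j \<in> J \<Longrightarrow> z \<otimes> s j = \<iota> (l j)" by blast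
  have "l j \<otimes>\<^bsub>R\<^esub> \<pi> j = l j" if j: "j \<in> J" for j
  proof (rule inj_onD[OF \<iota>_inj])
    have "\<iota> (l j \<otimes>\<^bsub>R\<^esub> \<pi> j) = (z \<otimes> s j) \<otimes> \<iota> (\<pi> j)" using l[OF j] j by (simp add: \<iota>_hom(3))
    also have "\<dots> = z \<otimes> s j" using z(1) j s_\<pi>[OF j] by (simp add: C.m_assoc)
    finally show "\<iota> (l j \<otimes>\<^bsub>R\<^esub> \<pi> j) = \<iota> (l j)" using l(2)[OF j] by simp
  qed (use l(1)[OF j] j in auto)
  then have lc: "coords l" using l(1) by (simp add: coords_def)
  have "z = (\<Oplus>j\<in>J. (z \<otimes> s j) \<otimes> t j)" using z p_right by simp
  also have "\<dots> = \<kappa> (comb l)"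
    unfolding \<kappa>_comb[OF lc] using l by (intro C.finsum_cong') auto
  finally show "z \<in> \<kappa> ` carrier Q" using comb_closed[OF lc] by blast
qed

lemma \<kappa>_p: "q \<in> carrier Q \<Longrightarrow> \<kappa> q \<otimes> p = \<kappa> q"
  using \<kappa>_image by blast

definition act :: "'a \<Rightarrow> 'q \<Rightarrow> 'q"
  where "act x = (\<lambda>q\<in>carrier Q. inv_into (carrier Q) \<kappa> (\<kappa> q \<otimes> x))"

context
  fixes x assumes x: "x \<in> carrier (corner C p)"
begin

lemma act_closed: "q \<in> carrier Q \<Longrightarrow> act x q \<in> carrier Q"
  and \<kappa>_act: "q \<in> carrier Q \<Longrightarrow> \<kappa> (act x q) = \<kappa> q \<otimes> x"
proof -
  assume q: "q \<in> carrier Q"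
  have xc: "x \<in> carrier C" "x \<otimes> p = x"
    using x C.corner_iff[OF p_closed p_p] by auto
  have \<iota>c: "\<iota> \<one>\<^bsub>R\<^esub> \<in> carrier C" using nonunital_homD(1)[OF \<iota>] by blast
  have "\<kappa> q \<otimes> x \<in> \<kappa> ` carrier Q"
    unfolding \<kappa>_image using q xc \<kappa>_unit[OF q] \<iota>c C.m_assoc[OF \<iota>c \<kappa>_closed[OF q] xc(1)]
    by (simp add: C.m_assoc)
  then show "act x q \<in> carrier Q" "\<kappa> (act x q) = \<kappa> q \<otimes> x"
    using q by (simp_all add: act_def inv_into_into f_inv_into_f)
qed

end

lemma act_hom: "x \<in> carrier (corner C p) \<Longrightarrow> act x \<in> carrier (End_algebra R Q)"
proof -
  assume x: "x \<in> carrier (corner C p)"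
  have xc: "x \<in> carrier C" using x by simp
  note cl = act_closed[OF x] and \<kappa> = \<kappa>_act[OF x]
  have "act x (q \<oplus>\<^bsub>Q\<^esub> q') = act x q \<oplus>\<^bsub>Q\<^esub> act x q'" if "q \<in> carrier Q" "q' \<in> carrier Q" for q q'
    using that xc cl by (intro \<kappa>_eqI) (simp_all add: \<kappa> \<kappa>_add C.l_distr)
  moreover have "act x (a \<odot>\<^bsub>Q\<^esub> q) = a \<odot>\<^bsub>Q\<^esub> act x q" if "a \<in> carrier R" "q \<in> carrier Q" for a q
    using that xc cl nonunital_homD(1)[OF \<iota>] by (intro \<kappa>_eqI) (simp_all add: \<kappa> \<kappa>_smult C.m_assoc)
  ultimately show ?thesis
    using cl by (auto simp: End_algebra_def left_module_hom_def act_def)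
qed

lemma End_eqI:
  assumes "f \<in> carrier (End_algebra R Q)" "g \<in> extensional (carrier Q)"
    "\<And>q. q \<in> carrier Q \<Longrightarrow> g q \<in> carrier Q \<and> \<kappa> (f q) = \<kappa> (g q)"
  shows "f = g"
proof (rule extensionalityI[of _ "carrier Q"])
  show "f \<in> extensional (carrier Q)" using assms(1) by (simp add: End_algebra_def)
  fix q assume q: "q \<in> carrier Q"
  have "f q \<in> carrier Q" using assms(1) q by (auto simp: End_algebra_def left_module_hom_def)
  then show "f q = g q" using assms(3)[OF q] by (intro \<kappa>_eqI) auto
qed (rule assms(2))

text \<open>An endomorphism \<open>h\<close> is determined by the \<open>h (b j)\<close>; it is right multiplication by
  \<open>\<Sum>j. s j \<otimes> \<kappa> (h (b j))\<close>.  That endomorphisms are composed from left to right makes the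
  correspondence multiplicative.\<close>

theorem End_isomorphic_corner: "algebra_isomorphic K (End_algebra R Q) (corner C p)"
proof -
  note cp = C.corner_iff[OF p_closed p_p]
  interpret CP: kalgebra K "corner C p" by (rule C.kalgebra_corner[OF p_closed p_p])
  have hom: "nonunital_hom K (corner C p) (End_algebra R Q) act"
    unfolding nonunital_hom_def
  proof (intro conjI ballI)
    fix x assume x: "x \<in> carrier (corner C p)"
    show "act x \<in> carrier (End_algebra R Q)" using x by (rule act_hom)
    have xc: "x \<in> carrier C" using x by simp
    {
      fix a assume a: "a \<in> carrier K"
      have ax: "a \<odot>\<^bsub>corner C p\<^esub> x \<in> carrier (corner C p)" using CP.smult_closed[OF a x] .
      have \<kappa>_ax: "\<kappa> (act (a \<odot> x) q) = a \<odot> \<kappa> (act x q)" if q: "q \<in> carrier Q" for q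
        using \<kappa>_act[OF ax q] \<kappa>_act[OF x q] a q xc by (simp add: C.smult_mult_r)
      show "act (a \<odot>\<^bsub>corner C p\<^esub> x) = a \<odot>\<^bsub>End_algebra R Q\<^esub> act x"
      proof (rule End_eqI[OF act_hom[OF ax]])
        fix q assume q: "q \<in> carrier Q"
        have "\<kappa> ((a \<odot>\<^bsub>R\<^esub> \<one>\<^bsub>R\<^esub>) \<odot>\<^bsub>Q\<^esub> act x q) = a \<odot> (\<iota> \<one>\<^bsub>R\<^esub> \<otimes> \<kappa> (act x q))"
          using a act_closed[OF x q] by (simp add: \<kappa>_smult \<iota>_hom C.smult_mult_l)
        also have "\<dots> = \<kappa> (act (a \<odot>\<^bsub>corner C p\<^esub> x) q)"
          using \<kappa>_unit[OF act_closed[OF x q]] \<kappa>_ax[OF q] by simp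
        finally show "(a \<odot>\<^bsub>End_algebra R Q\<^esub> act x) q \<in> carrier Q \<and>
            \<kappa> (act (a \<odot>\<^bsub>corner C p\<^esub> x) q) = \<kappa> ((a \<odot>\<^bsub>End_algebra R Q\<^esub> act x) q)"
          using a q act_closed[OF x q] by (simp add: End_algebra_def)
      qed (simp add: End_algebra_def)
    }
    fix y assume y: "y \<in> carrier (corner C p)"
    have yc: "y \<in> carrier C" using y by simp
    have sum: "x \<oplus>\<^bsub>corner C p\<^esub> y \<in> carrier (corner C p)" using CP.a_closed[OF x y] .
    have \<kappa>_sum: "\<kappa> (act (x \<oplus> y) q) = \<kappa> q \<otimes> x \<oplus> \<kappa> q \<otimes> y" if "q \<in> carrier Q" for q
      using \<kappa>_act[OF sum that] that xc yc by (simp add: C.r_distr)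
    show "act (x \<oplus>\<^bsub>corner C p\<^esub> y) = act x \<oplus>\<^bsub>End_algebra R Q\<^esub> act y"
      by (rule End_eqI[OF act_hom[OF sum]])
        (simp_all add: End_algebra_def act_closed[OF x] act_closed[OF y] \<kappa>_act[OF x]
          \<kappa>_act[OF y] \<kappa>_sum \<kappa>_add)
    have prod: "x \<otimes>\<^bsub>corner C p\<^esub> y \<in> carrier (corner C p)" using CP.m_closed[OF x y] .
    have \<kappa>_prod: "\<kappa> (act (x \<otimes> y) q) = (\<kappa> q \<otimes> x) \<otimes> y" if "q \<in> carrier Q" for q
      using \<kappa>_act[OF prod that] that xc yc by (simp add: C.m_assoc)
    show "act (x \<otimes>\<^bsub>corner C p\<^esub> y) = act x \<otimes>\<^bsub>End_algebra R Q\<^esub> act y"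
      by (rule End_eqI[OF act_hom[OF prod]])
        (simp_all add: End_algebra_def compose_def act_closed[OF x] act_closed[OF y]
          \<kappa>_act[OF x] \<kappa>_act[OF y] \<kappa>_prod)
  qed
  have inj: "inj_on act (carrier (corner C p))"
  proof (rule inj_onI)
    fix x y assume x: "x \<in> carrier (corner C p)" and y: "y \<in> carrier (corner C p)" and eq: "act x = act y"
    have xy: "x \<in> carrier C" "y \<in> carrier C" "p \<otimes> x = x" "p \<otimes> y = y" using x y cp by auto
    have "t j \<otimes> x = t j \<otimes> y" if "j \<in> J" for j
      using \<kappa>_act[OF x b[OF that]] \<kappa>_act[OF y b[OF that]] eq \<kappa>_b[OF that] by simp
    then have "(\<Oplus>j\<in>J. s j \<otimes> (t j \<otimes> x)) = (\<Oplus>j\<in>J. s j \<otimes> (t j \<otimes> y))"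
      using xy s_closed by (intro C.finsum_cong') auto
    then show "x = y" using p_left[OF xy(1)] p_left[OF xy(2)] xy by simp
  qed
  have surj: "h \<in> act ` carrier (corner C p)" if h: "h \<in> carrier (End_algebra R Q)" for h
  proof -
    have hQ: "h q \<in> carrier Q" if "q \<in> carrier Q" for q
      using h that by (auto simp: End_algebra_def left_module_hom_def)
    have hadd: "h (q \<oplus>\<^bsub>Q\<^esub> q') = h q \<oplus>\<^bsub>Q\<^esub> h q'" if "q \<in> carrier Q" "q' \<in> carrier Q" for q q'
      using h that by (auto simp: End_algebra_def left_module_hom_def)
    have hsm: "h (a \<odot>\<^bsub>Q\<^esub> q) = a \<odot>\<^bsub>Q\<^esub> h q" if "a \<in> carrier R" "q \<in> carrier Q" for a q
      using h that by (auto simp: End_algebra_def left_module_hom_def)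
    define x where "x = (\<Oplus>j\<in>J. s j \<otimes> \<kappa> (h (b j)))"
    have cl: "s j \<otimes> \<kappa> (h (b j)) \<in> carrier C" if "j \<in> J" for j
      using that b hQ s_closed by simp
    have xc: "x \<in> carrier C" unfolding x_def using cl by (intro C.finsum_closed) auto
    have "p \<otimes> x = (\<Oplus>j\<in>J. p \<otimes> (s j \<otimes> \<kappa> (h (b j))))"
      unfolding x_def using cl J by (intro C.finsum_rdistr) auto
    also have "\<dots> = x" unfolding x_def
      using b hQ s_closed p_s by (intro C.finsum_cong') (auto simp flip: C.m_assoc)
    finally have px: "p \<otimes> x = x" .
    have "x \<otimes> p = (\<Oplus>j\<in>J. (s j \<otimes> \<kappa> (h (b j))) \<otimes> p)"
      unfolding x_def using cl J by (intro C.finsum_ldistr) auto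
    also have "\<dots> = x" unfolding x_def
      using b hQ s_closed \<kappa>_p by (intro C.finsum_cong') (auto simp: C.m_assoc)
    finally have xp: "x \<otimes> p = x" .
    have x: "x \<in> carrier (corner C p)" using xc px xp by simp
    have tx: "t j \<otimes> x = \<kappa> (h (b j))" if j: "j \<in> J" for j
    proof -
      have "t j \<otimes> x = (\<Oplus>k\<in>J. t j \<otimes> (s k \<otimes> \<kappa> (h (b k))))"
        unfolding x_def using cl J j by (intro C.finsum_rdistr) auto
      also have "\<dots> = (\<Oplus>k\<in>J. if j = k then \<iota> (\<pi> k) \<otimes> \<kappa> (h (b k)) else \<zero>)"
        using b hQ s_closed j t_s \<pi> \<iota>_hom(1)
        by (intro C.finsum_cong') (auto simp flip: C.m_assoc)
      also have "\<dots> = \<iota> (\<pi> j) \<otimes> \<kappa> (h (b j))"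
        using j J b hQ \<pi> \<iota>_hom(1) by (intro C.finsum_singleton) auto
      also have "\<dots> = \<kappa> (h (b j))"
        using hsm[OF \<pi>(1)[OF j] b[OF j]] \<pi>[OF j] b[OF j] hQ[OF b[OF j]] by (simp flip: \<kappa>_smult)
      finally show ?thesis .
    qed
    let ?N = "{q \<in> carrier Q. \<kappa> q \<otimes> x = \<kappa> (h q)}"
    have "submodule ?N R Q"
    proof (rule Q.submoduleI)
      have "\<kappa> \<zero>\<^bsub>Q\<^esub> = \<zero>" "h \<zero>\<^bsub>Q\<^esub> = \<zero>\<^bsub>Q\<^esub>"
        using \<kappa>_smult[of "\<zero>\<^bsub>R\<^esub>" "\<zero>\<^bsub>Q\<^esub>"] hsm[of "\<zero>\<^bsub>R\<^esub>" "\<zero>\<^bsub>Q\<^esub>"]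
          nonunital_hom_zero[OF R.kalgebra_axioms C.kalgebra_axioms \<iota>] hQ[of "\<zero>\<^bsub>Q\<^esub>"] by simp_all
      then show "\<zero>\<^bsub>Q\<^esub> \<in> ?N" using xc by simp
    qed (use xc hQ \<iota>_hom(1) in \<open>auto simp: \<kappa>_add hadd C.l_distr \<kappa>_smult hsm C.m_assoc\<close>)
    moreover have "b ` J \<subseteq> ?N" using b \<kappa>_b tx by auto
    ultimately have "carrier Q \<subseteq> ?N" by (rule spanning)
    then have "act x = h"
      using h hQ by (intro End_eqI[OF act_hom[OF x]]) (auto simp: \<kappa>_act[OF x] End_algebra_def)
    then show ?thesis using x by blast
  qed
  have one: "act \<one>\<^bsub>corner C p\<^esub> = \<one>\<^bsub>End_algebra R Q\<^esub>"
    by (rule End_eqI[OF act_hom[OF CP.one_closed]])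
      (auto simp: End_algebra_def \<kappa>_act[OF CP.one_closed, simplified] \<kappa>_p)
  have "bij_betw act (carrier (corner C p)) (carrier (End_algebra R Q))"
    unfolding bij_betw_def using inj surj act_hom by auto
  then have "algebra_isomorphic K (corner C p) (End_algebra R Q)"
    using hom one by (intro algebra_isomorphicI)
  then show ?thesis by (rule algebra_isomorphic_sym[OF CP.kalgebra_axioms])
qed

end

section \<open>Attaching an edge for each basis element\<close>

text \<open>New vertices \<open>j\<close>, each of which emits exactly one edge, to \<open>\<nu> j\<close>.  In the Leavitt path algebra of the
  new graph the idempotent \<open>j\<close> is therefore equivalent to \<open>\<nu> j\<close>.\<close>

definition attach :: "('v, 'e) pre_digraph \<Rightarrow> nat set \<Rightarrow> (nat \<Rightarrow> 'v) \<Rightarrow> ('v + nat, 'e + nat) pre_digraph"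
  where "attach E J \<nu> = \<lparr>verts = Inl ` verts E \<union> Inr ` J, arcs = Inl ` arcs E \<union> Inr ` J,
    tail = case_sum (\<lambda>e. Inl (tail E e)) Inr, head = case_sum (\<lambda>e. Inl (head E e)) (\<lambda>j. Inl (\<nu> j))\<rparr>"

lemma attach_simps [simp]:
  "verts (attach E J \<nu>) = Inl ` verts E \<union> Inr ` J" "arcs (attach E J \<nu>) = Inl ` arcs E \<union> Inr ` J"
  "tail (attach E J \<nu>) (Inl e) = Inl (tail E e)" "tail (attach E J \<nu>) (Inr j) = Inr j"
  "head (attach E J \<nu>) (Inl e) = Inl (head E e)" "head (attach E J \<nu>) (Inr j) = Inl (\<nu> j)"
  by (simp_all add: attach_def)

lemma fin_digraph_attach:
  assumes "fin_digraph E" "finite J" "\<And>j. j \<in> J \<Longrightarrow> \<nu> j \<in> verts E"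
  shows "fin_digraph (attach E J \<nu>)"
proof -
  interpret fin_digraph E by fact
  show ?thesis by unfold_locales (use assms in auto)
qed

lemma (in leavitt_presentation) L_full: "L.full"
  unfolding L.full_def using L_generated by blast

theorem theorem3p17:
  fixes K :: "('k, 'c) ring_scheme"
    and E :: "('v, 'e) pre_digraph"
    and Q :: "((('v, 'e) generator list \<Rightarrow> 'k) set, 'q, 'd) module_scheme"
  assumes "field K"
    and "finite_graph E"
    and "left_module (leavitt_path_algebra K E) Q"
    and "carrier Q \<noteq> {\<zero>\<^bsub>Q\<^esub>}"
    and "finitely_generated (leavitt_path_algebra K E) Q"
    and "projective (leavitt_path_algebra K E) Q"
  shows "\<exists>G :: (nat, nat) pre_digraph. finite_graph G \<and>
    algebra_isomorphic K (End_algebra (leavitt_path_algebra K E) Q) (leavitt_path_algebra K G)"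
proof -
  interpret X: leavitt_presentation K E
    using assms(1,2) by (simp add: leavitt_presentation_def finite_graph_def)
  interpret Q: left_module X.L Q by fact
  obtain \<phi> :: "'q \<Rightarrow> 'q \<Rightarrow> (('v, 'e) generator list \<Rightarrow> 'k) set" where \<phi>:
    "\<And>i x. x \<in> carrier Q \<Longrightarrow> \<phi> i x \<in> carrier X.L"
    "\<And>i x y. \<lbrakk>x \<in> carrier Q; y \<in> carrier Q\<rbrakk> \<Longrightarrow> \<phi> i (x \<oplus>\<^bsub>Q\<^esub> y) = \<phi> i x \<oplus>\<^bsub>X.L\<^esub> \<phi> i y"
    "\<And>i a x. \<lbrakk>a \<in> carrier X.L; x \<in> carrier Q\<rbrakk> \<Longrightarrow> \<phi> i (a \<odot>\<^bsub>Q\<^esub> x) = a \<otimes>\<^bsub>X.L\<^esub> \<phi> i x"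
    "\<And>x. x \<in> carrier Q \<Longrightarrow> finite {i. \<phi> i x \<noteq> \<zero>\<^bsub>X.L\<^esub>}"
    "\<And>x. \<lbrakk>x \<in> carrier Q; \<And>i. \<phi> i x = \<zero>\<^bsub>X.L\<^esub>\<rbrakk> \<Longrightarrow> x = \<zero>\<^bsub>Q\<^esub>"
    using Q.projective_coordinates[OF assms(6)] by blast
  interpret M: family_module K X.L E X.LV X.LE X.LG Q \<phi>
  proof (intro family_module.intro X.L.leavitt_family_axioms assms(3) family_module_axioms.intro
      X.unit_L X.L_faithful)
    show "carrier X.L \<subseteq> X.L.generated" using X.L_generated by blast
  qed (fact \<phi>)+
  obtain J :: "nat set" and b \<nu> where J: "finite J" and sp: "M.spanning J b"
    and b: "\<And>j. j \<in> J \<Longrightarrow> b j \<in> carrier Q" and \<nu>: "\<And>j. j \<in> J \<Longrightarrow> \<nu> j \<in> verts E"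
    and Pb: "\<And>j. j \<in> J \<Longrightarrow> X.LV (\<nu> j) \<odot>\<^bsub>Q\<^esub> b j = b j"
    and indep: "\<And>l k. \<lbrakk>\<And>k. k \<in> J \<Longrightarrow> l k \<in> carrier X.L;
      \<And>k. k \<in> J \<Longrightarrow> l k \<otimes>\<^bsub>X.L\<^esub> X.LV (\<nu> k) = l k;
      (\<Oplus>\<^bsub>Q\<^esub>k\<in>J. l k \<odot>\<^bsub>Q\<^esub> b k) = \<zero>\<^bsub>Q\<^esub>; k \<in> J\<rbrakk> \<Longrightarrow> l k = \<zero>\<^bsub>X.L\<^esub>"
    using M.vertex_basis[OF assms(5)] by blast
  have spanning: "carrier Q \<subseteq> N" if "submodule N X.L Q" "b ` J \<subseteq> N" for N
    using sp that unfolding M.spanning_def by blast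
  have Jne: "J \<noteq> {}"
  proof
    assume "J = {}"
    moreover have "submodule {\<zero>\<^bsub>Q\<^esub>} X.L Q" by (rule Q.submoduleI) auto
    ultimately have "carrier Q \<subseteq> {\<zero>\<^bsub>Q\<^esub>}" using spanning by auto
    then show False using assms(4) by auto
  qed
  \<comment> \<open>\<open>Q\<close> is the direct sum of the modules \<open>L (\<nu> j)\<close>, which become the modules of the new vertices.\<close>
  let ?E = "attach E J \<nu>"
  interpret Y: leavitt_presentation K ?E
    using fin_digraph_attach[OF X.E.fin_digraph J \<nu>] assms(1)
    by (simp add: leavitt_presentation_def)
  \<comment> \<open>No edge leaves \<open>E\<close> in the new graph, so the old Leavitt path algebra is a corner of the new one.\<close>
  interpret H: hereditary_embedding K Y.L ?E Y.LV Y.LE Y.LG E Inl Inl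
    by (intro hereditary_embedding.intro Y.L.leavitt_family_axioms X.E.fin_digraph_axioms
        hereditary_embedding_axioms.intro) auto
  note subfull = H.sub_full[OF Y.L_full] and subfaithful = H.sub_faithful[OF Y.L_faithful]
  obtain \<iota> where \<iota>: "nonunital_hom K X.L Y.L \<iota>" and \<iota>_inj: "inj_on \<iota> (carrier X.L)"
    and \<iota>_image: "\<iota> ` carrier X.L = H.sub.generated" and \<iota>_one: "\<iota> \<one>\<^bsub>X.L\<^esub> = H.sub.unit"
    and "\<forall>v\<in>verts E. \<iota> (X.LV v) = Y.LV (Inl v)"
    by (rule H.sub.leavitt_embedding[OF subfaithful])
  then have \<iota>_LV: "\<And>v. v \<in> verts E \<Longrightarrow> \<iota> (X.LV v) = Y.LV (Inl v)" by blast
  let ?s = "\<lambda>j. Y.LE (Inr j)" and ?t = "\<lambda>j. Y.LG (Inr j)"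
  define p where "p = (\<Oplus>\<^bsub>Y.L\<^esub>j\<in>J. ?s j \<otimes>\<^bsub>Y.L\<^esub> ?t j)"
  have arcs: "Inr j \<in> arcs ?E" if "j \<in> J" for j using that by simp
  interpret Z: corner_realization K X.L Y.L Q J b "\<lambda>j. X.LV (\<nu> j)" \<iota> ?s ?t p
  proof (intro corner_realization.intro corner_realization_axioms.intro based_module.intro
      based_module_axioms.intro \<iota> \<iota>_inj X.L.kalgebra_axioms Y.L.kalgebra_axioms assms(3) J b Pb spanning
      indep p_def)
    fix z assume "z \<in> carrier Y.L" "\<iota> \<one>\<^bsub>X.L\<^esub> \<otimes>\<^bsub>Y.L\<^esub> (z \<otimes>\<^bsub>Y.L\<^esub> \<iota> \<one>\<^bsub>X.L\<^esub>) = z"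
    then show "z \<in> \<iota> ` carrier X.L"
      using subfull unfolding H.sub.full_def \<iota>_image \<iota>_one by blast
  next
    fix j assume j: "j \<in> J"
    show "X.LV (\<nu> j) \<in> carrier X.L" "X.LV (\<nu> j) \<otimes>\<^bsub>X.L\<^esub> X.LV (\<nu> j) = X.LV (\<nu> j)"
      using \<nu>[OF j] by (simp_all add: X.L.P_P)
    show "?s j \<in> carrier Y.L" "?t j \<in> carrier Y.L" using arcs[OF j] by simp_all
    show "?s j \<otimes>\<^bsub>Y.L\<^esub> \<iota> (X.LV (\<nu> j)) = ?s j" "\<iota> (X.LV (\<nu> j)) \<otimes>\<^bsub>Y.L\<^esub> ?t j = ?t j"
      using Y.L.S_head[OF arcs[OF j]] Y.L.head_T[OF arcs[OF j]] \<iota>_LV[OF \<nu>[OF j]] by simp_all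
    fix k assume k: "k \<in> J"
    show "?t j \<otimes>\<^bsub>Y.L\<^esub> ?s k = (if j = k then \<iota> (X.LV (\<nu> k)) else \<zero>\<^bsub>Y.L\<^esub>)"
      using Y.L.T_S[OF arcs[OF j] arcs[OF k]] \<iota>_LV[OF \<nu>[OF k]] by simp
  qed
  have IJ: "Inr ` J \<subseteq> verts ?E" by auto
  have "(\<Oplus>\<^bsub>Y.L\<^esub>w\<in>Inr ` J. Y.LV w) = (\<Oplus>\<^bsub>Y.L\<^esub>j\<in>J. Y.LV (Inr j))"
    using IJ by (intro Y.L.finsum_reindex) auto
  also have "\<dots> = p"
    unfolding p_def
  proof (rule Y.L.finsum_cong')
    fix j assume j: "j \<in> J"
    \<comment> \<open>The new arc is the only one that leaves the new vertex.\<close>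
    have "out_arcs ?E (Inr j) = {Inr j}" using j by (auto simp: out_arcs_def)
    then show "Y.LV (Inr j) = ?s j \<otimes>\<^bsub>Y.L\<^esub> ?t j"
      using Y.L.sum_S_T[of "Inr j"] j by simp
  qed auto
  finally have p: "(\<Oplus>\<^bsub>Y.L\<^esub>w\<in>Inr ` J. Y.LV w) = p" .
  have "\<exists>G :: (nat, nat) pre_digraph. finite_graph G \<and>
      algebra_isomorphic K (corner Y.L p) (leavitt_path_algebra K G)"
    using Y.L.corner_vertices_leavitt[OF Y.L_faithful Y.L_full IJ] Jne unfolding p by simp
  then show ?thesis
    using algebra_isomorphic_trans[OF Z.End_isomorphic_corner] by blast
qed

end
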